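(* Let $f$ be the restriction to a compact invariant set $X$ of a $C^1$ random map of a Riemannian manifold satisfying $\int(\log^+\|Df_\omega\|_\infty+\log^+\|(Df_\omega)^{-1}\|_\infty)\,d\mathbb P<\infty$. If $\mu_0\in\mathcal I(f)$ is quasi-irreducible, then the map $\mu\in\mathcal I(f)\mapsto\lambda_1(\mu)$ is continuous at $\mu_0$ with respect to the weak$^*$ topology. In particular, if $f$ is quasi-irreducible, then $\mu\in\mathcal I(f)\mapsto\lambda_1(\mu)$ is continuous.
   Context: Setting. $M$ is a Riemannian manifold of dimension $m$. $(T,\mathscr A,p)$ is a probability space and $(\Omega,\mathscr F,\mathbb P)=(T^{\mathbb N},\mathscr A^{\mathbb N},p^{\mathbb N})$. A $C^1$ random map is a measurable map $f:\Omega\times M\to M$ such that $f_\omega:=f(\omega,\cdot)=f_{\omega_0}$ depends only on the coordinate $\omega_0$ of $\omega$ and is a $C^1$ local diffeomorphism for $\mathbb P$-a.e. $\omega$. Put $f^0_\omega=\mathrm{id}$, $f^n_\omega=f_{\omega_{n-1}}\circ\dots\circ f_{\omega_0}$. $X\subset M$ is compact with $f_\omega(X)\subset X$ for $\mathbb P$-a.e. $\omega$; $f$ also denotes the restriction to $\Omega\times X$. $\|Df_\omega\|_\infty=\sup_{x\in X}\|Df_\omega(x)\|$, $\|(Df_\omega)^{-1}\|_\infty=\sup_{x\in X}\|Df_\omega(x)^{-1}\|$. $\mathcal I(f)$ is the set of $f$-stationary Borel probability measures on $X$ ($\mu=\int (f_\omega)_*\mu\,d\mathbb P$). $\lambda_1(\mu)=\lim_n\frac1n\int\log\|Df^n_\omega(x)\|\,d\mathbb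 P\,d\mu$. $\hat X=P(T_XM)$ is the projectivized tangent bundle over $X$ with points $(x,\hat v)$, $v\in T_xM$ unit; $\hat f_\omega(x,\hat v)=(f_\omega(x),Df_\omega(x)\hat v)$; $\mathcal I_\mu(\hat f)$ is the set of $\hat f$-stationary probability measures on $\hat X$ projecting to $\mu$; $\phi_f(x,\hat v)=\int\log\|Df_\omega(x)v\|\,d\mathbb P$. $\mu\in\mathcal I(f)$ is quasi-irreducible if $\int\phi_f\,d\nu=\lambda_1(\mu)$ for every $\nu\in\mathcal I_\mu(\hat f)$; $f$ is quasi-irreducible if every $\mu\in\mathcal I(f)$ is. *)

theory Defs
  imports "HOL-Probability.Probability"
begin

section \<open>Differentiability classes in normed spaces\<close>

text \<open>Meant for open \<open>S\<close>: all iterated directional derivatives up to order \<open>k\<close> exist (as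
  Frechet derivatives) and are continuous. In finite dimension this is the usual class
  \<open>C\<^sup>k\<close>.\<close>

primrec Ck_on :: "nat \<Rightarrow> 'b::real_normed_vector set \<Rightarrow> ('b \<Rightarrow> 'c::real_normed_vector) \<Rightarrow> bool" where
  "Ck_on 0 S h \<longleftrightarrow> continuous_on S h"
| "Ck_on (Suc k) S h \<longleftrightarrow>
     (\<forall>y\<in>S. h differentiable (at y)) \<and> (\<forall>v. Ck_on k S (\<lambda>y. frechet_derivative h (at y) v))"

definition smooth_on :: "'b::real_normed_vector set \<Rightarrow> ('b \<Rightarrow> 'c::real_normed_vector) \<Rightarrow> bool" where
  "smooth_on S h \<longleftrightarrow> (\<forall>k. Ck_on k S h)"


section \<open>Smooth manifolds\<close>

text \<open>A chart is an open domain together with a coordinate map; values of the coordinate map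
  outside of the domain are irrelevant.\<close>

type_synonym ('a, 'e) chart = "'a set \<times> ('a \<Rightarrow> 'e)"

abbreviation cdom :: "('a, 'e) chart \<Rightarrow> 'a set" where "cdom \<equiv> fst"
abbreviation cmap :: "('a, 'e) chart \<Rightarrow> 'a \<Rightarrow> 'e" where "cmap \<equiv> snd"
abbreviation cimage :: "('a, 'e) chart \<Rightarrow> 'e set" where "cimage c \<equiv> cmap c ` cdom c"
abbreviation cinv :: "('a, 'e) chart \<Rightarrow> 'e \<Rightarrow> 'a" where "cinv c \<equiv> inv_into (cdom c) (cmap c)"

text \<open>The manifold is the whole type \<open>'a\<close>, its dimension is \<open>DIM('e)\<close>; the smooth structure is
  given by an atlas that need not be maximal.\<close>

locale smooth_manifold =
  fixes A :: "('a::{t2_space, second_countable_topology}, 'e::euclidean_space) chart set"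
  assumes open_cdom: "c \<in> A \<Longrightarrow> open (cdom c)"
    and open_cimage: "c \<in> A \<Longrightarrow> open (cimage c)"
    and homeomorphism_chart: "c \<in> A \<Longrightarrow> homeomorphism (cdom c) (cimage c) (cmap c) (cinv c)"
    and charts_cover: "(\<Union>c\<in>A. cdom c) = UNIV"
    and smooth_transition:
      "c \<in> A \<Longrightarrow> d \<in> A \<Longrightarrow> smooth_on (cmap c ` (cdom c \<inter> cdom d)) (cmap d \<circ> cinv c)"

definition charts_at :: "('a, 'e) chart set \<Rightarrow> 'a \<Rightarrow> ('a, 'e) chart set" where
  "charts_at A x = {c \<in> A. x \<in> cdom c}"


subsection \<open>Tangent spaces and derivatives\<close>

text \<open>A tangent vector at \<open>x\<close> is the family of its coordinate vectors, one for each chart around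
  \<open>x\<close>, related by the derivatives of the transition maps; at all other charts the family is \<open>0\<close>.
  The linear structure is pointwise.\<close>

type_synonym ('a, 'e) tvec = "('a, 'e) chart \<Rightarrow> 'e"

definition coord_change ::
  "('a, 'e::euclidean_space) chart \<Rightarrow> ('a, 'e) chart \<Rightarrow> 'a \<Rightarrow> 'e \<Rightarrow> 'e" where
  "coord_change c d x = frechet_derivative (cmap d \<circ> cinv c) (at (cmap c x))"

definition tangent_space ::
  "('a, 'e::euclidean_space) chart set \<Rightarrow> 'a \<Rightarrow> ('a, 'e) tvec set" where
  "tangent_space A x =
     {\<xi>. (\<forall>c\<in>charts_at A x. \<forall>d\<in>charts_at A x. \<xi> d = coord_change c d x (\<xi> c)) \<and>
         (\<forall>c. c \<notin> charts_at A x \<longrightarrow> \<xi> c = 0)}"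

text \<open>The tangent vector at \<open>x\<close> with coordinates \<open>v\<close> in the chart \<open>c\<close>.\<close>

definition tvec_of ::
  "('a, 'e::euclidean_space) chart set \<Rightarrow> 'a \<Rightarrow> ('a, 'e) chart \<Rightarrow> 'e \<Rightarrow> ('a, 'e) tvec" where
  "tvec_of A x c v = (\<lambda>d. if d \<in> charts_at A x then coord_change c d x v else 0)"

text \<open>The derivative \<open>Dh(x)\<close>; by the chain rule it does not depend on the chosen chart at \<open>x\<close>.\<close>

definition tangent_map ::
  "('a, 'e::euclidean_space) chart set \<Rightarrow> ('a \<Rightarrow> 'a) \<Rightarrow> 'a \<Rightarrow> ('a, 'e) tvec \<Rightarrow> ('a, 'e) tvec" where
  "tangent_map A h x \<xi> =
     (let c = (SOME c. c \<in> charts_at A x) in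
      (\<lambda>d. if d \<in> charts_at A (h x)
           then frechet_derivative (cmap d \<circ> h \<circ> cinv c) (at (cmap c x)) (\<xi> c) else 0))"

definition C1_map_on ::
  "('a::topological_space, 'e::euclidean_space) chart set \<Rightarrow> 'a set \<Rightarrow> ('a \<Rightarrow> 'a) \<Rightarrow> bool" where
  "C1_map_on A U h \<longleftrightarrow> continuous_on U h \<and>
     (\<forall>c\<in>A. \<forall>d\<in>A. Ck_on 1 (cmap c ` (cdom c \<inter> U \<inter> h -` cdom d)) (cmap d \<circ> h \<circ> cinv c))"

definition C1_local_diffeo ::
  "('a::topological_space, 'e::euclidean_space) chart set \<Rightarrow> ('a \<Rightarrow> 'a) \<Rightarrow> bool" where
  "C1_local_diffeo A h \<longleftrightarrow>
     (\<forall>x. \<exists>U. open U \<and> x \<in> U \<and> inj_on h U \<and> open (h ` U) \<and>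
        C1_map_on A U h \<and> C1_map_on A (h ` U) (inv_into U h))"


subsection \<open>The projectivized tangent bundle\<close>

text \<open>A point of the bundle is a pair of a base point and a line through the origin of its
  tangent space.\<close>

type_synonym ('a, 'e) pvec = "'a \<times> ('a, 'e) tvec set"

definition tangent_line :: "('a, 'e::euclidean_space) tvec \<Rightarrow> ('a, 'e) tvec set" where
  "tangent_line \<xi> = range (\<lambda>t c. t *\<^sub>R \<xi> c)"

definition proj_bundle ::
  "('a, 'e::euclidean_space) chart set \<Rightarrow> 'a set \<Rightarrow> ('a, 'e) pvec set" where
  "proj_bundle A X =
     {(x, tangent_line \<xi>) | x \<xi>. x \<in> X \<and> \<xi> \<in> tangent_space A x \<and> \<xi> \<noteq> (\<lambda>_. 0)}"

text \<open>The quotient topology on the set of tangent lines: a set is open iff its preimage among the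
  nonzero tangent vectors is open, that is, open in each of the bundle charts \<open>(y, v)\<close>.\<close>

definition proj_open ::
  "('a, 'e::euclidean_space) chart set \<Rightarrow> ('a, 'e) pvec set \<Rightarrow> bool" where
  "proj_open A U \<longleftrightarrow> U \<subseteq> proj_bundle A UNIV \<and>
     (\<forall>c\<in>A. open {(y, v). y \<in> cimage c \<and> v \<noteq> 0 \<and>
                    (cinv c y, tangent_line (tvec_of A (cinv c y) c v)) \<in> U})"

definition proj_topology ::
  "('a, 'e::euclidean_space) chart set \<Rightarrow> ('a, 'e) pvec topology" where
  "proj_topology A = topology (proj_open A)"

lemma istopology_proj_open: "istopology (proj_open A)"
proof -
  let ?S = "\<lambda>U c. {(y, v). y \<in> cimage c \<and> v \<noteq> 0 \<and>
                    (cinv c y, tangent_line (tvec_of A (cinv c y) c v)) \<in> U}"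
  have I: "?S (U \<inter> V) c = ?S U c \<inter> ?S V c" for U V c
    by auto
  have U: "?S (\<Union>K) c = (\<Union>U\<in>K. ?S U c)" for K c
    by auto
  show ?thesis
    unfolding istopology_def proj_open_def
    by (auto simp only: I U intro!: open_Int open_UN)
qed

lemma openin_proj_topology: "openin (proj_topology A) = proj_open A"
  unfolding proj_topology_def by (rule topology_inverse'[OF istopology_proj_open])

definition proj_borel ::
  "('a, 'e::euclidean_space) chart set \<Rightarrow> 'a set \<Rightarrow> ('a, 'e) pvec measure" where
  "proj_borel A X =
     sigma (proj_bundle A X) {U. openin (subtopology (proj_topology A) (proj_bundle A X)) U}"

definition proj_map ::
  "('a, 'e::euclidean_space) chart set \<Rightarrow> ('a \<Rightarrow> 'a) \<Rightarrow> ('a, 'e) pvec \<Rightarrow> ('a, 'e) pvec" where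
  "proj_map A h = (\<lambda>(x, l). (h x, tangent_map A h x ` l))"


section \<open>Riemannian manifolds\<close>

locale riemannian_manifold = smooth_manifold A
  for A :: "('a::{t2_space, second_countable_topology}, 'e::euclidean_space) chart set" +
  fixes g :: "'a \<Rightarrow> ('a, 'e) tvec \<Rightarrow> ('a, 'e) tvec \<Rightarrow> real"
  assumes metric_sym:
      "\<xi> \<in> tangent_space A x \<Longrightarrow> \<eta> \<in> tangent_space A x \<Longrightarrow> g x \<xi> \<eta> = g x \<eta> \<xi>"
    and metric_add:
      "\<xi> \<in> tangent_space A x \<Longrightarrow> \<zeta> \<in> tangent_space A x \<Longrightarrow> \<eta> \<in> tangent_space A x \<Longrightarrow>
       g x (\<lambda>c. \<xi> c + \<zeta> c) \<eta> = g x \<xi> \<eta> + g x \<zeta> \<eta>"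
    and metric_scale:
      "\<xi> \<in> tangent_space A x \<Longrightarrow> \<eta> \<in> tangent_space A x \<Longrightarrow>
       g x (\<lambda>c. r *\<^sub>R \<xi> c) \<eta> = r * g x \<xi> \<eta>"
    and metric_pos:
      "\<xi> \<in> tangent_space A x \<Longrightarrow> \<xi> \<noteq> (\<lambda>_. 0) \<Longrightarrow> g x \<xi> \<xi> > 0"
    and metric_smooth:
      "c \<in> A \<Longrightarrow> smooth_on (cimage c)
         (\<lambda>y. g (cinv c y) (tvec_of A (cinv c y) c v) (tvec_of A (cinv c y) c w))"

definition tnorm ::
  "('a \<Rightarrow> ('a, 'e) tvec \<Rightarrow> ('a, 'e) tvec \<Rightarrow> real) \<Rightarrow> 'a \<Rightarrow> ('a, 'e) tvec \<Rightarrow> real" where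
  "tnorm g x \<xi> = sqrt (g x \<xi> \<xi>)"

text \<open>Operator norm of a linear map \<open>L\<close> from the tangent space at \<open>x\<close> to the one at \<open>y\<close>.\<close>

definition tangent_onorm ::
  "('a, 'e::euclidean_space) chart set \<Rightarrow> ('a \<Rightarrow> ('a, 'e) tvec \<Rightarrow> ('a, 'e) tvec \<Rightarrow> real) \<Rightarrow>
   'a \<Rightarrow> 'a \<Rightarrow> (('a, 'e) tvec \<Rightarrow> ('a, 'e) tvec) \<Rightarrow> real" where
  "tangent_onorm A g x y L =
     (SUP \<xi>\<in>{\<xi> \<in> tangent_space A x. tnorm g x \<xi> = 1}. tnorm g y (L \<xi>))"

definition deriv_norm ::
  "('a, 'e::euclidean_space) chart set \<Rightarrow> ('a \<Rightarrow> ('a, 'e) tvec \<Rightarrow> ('a, 'e) tvec \<Rightarrow> real) \<Rightarrow>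
   ('a \<Rightarrow> 'a) \<Rightarrow> 'a \<Rightarrow> real" where
  "deriv_norm A g h x = tangent_onorm A g x (h x) (tangent_map A h x)"

definition inv_deriv_norm ::
  "('a, 'e::euclidean_space) chart set \<Rightarrow> ('a \<Rightarrow> ('a, 'e) tvec \<Rightarrow> ('a, 'e) tvec \<Rightarrow> real) \<Rightarrow>
   ('a \<Rightarrow> 'a) \<Rightarrow> 'a \<Rightarrow> real" where
  "inv_deriv_norm A g h x =
     tangent_onorm A g (h x) x (inv_into (tangent_space A x) (tangent_map A h x))"


section \<open>Stationary measures\<close>

definition prob_measures :: "'b measure \<Rightarrow> 'b measure set" where
  "prob_measures N = {\<mu>. prob_space \<mu> \<and> sets \<mu> = sets N}"

definition weak_star_topology :: "'a::topological_space set \<Rightarrow> 'a measure topology" where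
  "weak_star_topology X = topology_generated_by
     {{\<mu> \<in> prob_measures (restrict_space borel X). (\<integral>x. h x \<partial>\<mu>) \<in> V} | (h :: 'a \<Rightarrow> real) V.
        continuous_on X h \<and> open V}"

definition iid_seq :: "'t measure \<Rightarrow> (nat \<Rightarrow> 't) measure" where
  "iid_seq p = PiM UNIV (\<lambda>_. p)"

definition stationary_measures ::
  "'w measure \<Rightarrow> 'b measure \<Rightarrow> ('w \<Rightarrow> 'b \<Rightarrow> 'b) \<Rightarrow> 'b measure set" where
  "stationary_measures P N F = {\<mu> \<in> prob_measures N.
     \<forall>B\<in>sets N. emeasure \<mu> B = (\<integral>\<^sup>+\<omega>. emeasure (distr \<mu> N (F \<omega>)) B \<partial>P)}"


section \<open>Random maps\<close>

locale compact_random_map = riemannian_manifold A g + prob_space p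
  for A :: "('a::{t2_space, second_countable_topology}, 'e::euclidean_space) chart set"
    and g :: "'a \<Rightarrow> ('a, 'e) tvec \<Rightarrow> ('a, 'e) tvec \<Rightarrow> real"
    and p :: "'t measure" +
  fixes f :: "(nat \<Rightarrow> 't) \<Rightarrow> 'a \<Rightarrow> 'a"
    and X :: "'a set"
  assumes measurable_f: "(\<lambda>(\<omega>, x). f \<omega> x) \<in> iid_seq p \<Otimes>\<^sub>M borel \<rightarrow>\<^sub>M borel"
    and f_depends_on_0:
      "\<omega> \<in> space (iid_seq p) \<Longrightarrow> \<omega>' \<in> space (iid_seq p) \<Longrightarrow> \<omega> 0 = \<omega>' 0 \<Longrightarrow> f \<omega> = f \<omega>'"
    and f_local_diffeo: "AE \<omega> in iid_seq p. C1_local_diffeo A (f \<omega>)"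
    and compact_X: "compact X"
    and f_invariant: "AE \<omega> in iid_seq p. f \<omega> ` X \<subseteq> X"

text \<open>\<open>f\<^bsub>\<omega>\<^sub>n\<^esub>\<close> is \<open>f\<close> at any sequence starting with \<open>\<omega>\<^sub>n\<close>, for instance the shifted sequence.\<close>

primrec random_iter :: "((nat \<Rightarrow> 't) \<Rightarrow> 'a \<Rightarrow> 'a) \<Rightarrow> nat \<Rightarrow> (nat \<Rightarrow> 't) \<Rightarrow> 'a \<Rightarrow> 'a" where
  "random_iter f 0 \<omega> = id"
| "random_iter f (Suc n) \<omega> = f (\<lambda>i. \<omega> (i + n)) \<circ> random_iter f n \<omega>"

text \<open>The derivative of \<open>f \<omega>\<close> makes sense for almost every \<open>\<omega>\<close> only. Bochner integrals over
  \<open>\<omega>\<close> are therefore taken with respect to the completion, under which arbitrary values on a null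
  set do not affect measurability (for measurable integrands the completion changes nothing);
  the nonnegative integral is insensitive to null sets anyway.\<close>

definition log_plus :: "real \<Rightarrow> real" where
  "log_plus r = max 0 (ln r)"

definition log_integrable ::
  "('a, 'e::euclidean_space) chart set \<Rightarrow> ('a \<Rightarrow> ('a, 'e) tvec \<Rightarrow> ('a, 'e) tvec \<Rightarrow> real) \<Rightarrow>
   't measure \<Rightarrow> ((nat \<Rightarrow> 't) \<Rightarrow> 'a \<Rightarrow> 'a) \<Rightarrow> 'a set \<Rightarrow> bool" where
  "log_integrable A g p f X \<longleftrightarrow>
     (\<integral>\<^sup>+\<omega>. ennreal (log_plus (SUP x\<in>X. deriv_norm A g (f \<omega>) x) +
                   log_plus (SUP x\<in>X. inv_deriv_norm A g (f \<omega>) x)) \<partial>iid_seq p) < \<infinity>"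

abbreviation stationary ::
  "'t measure \<Rightarrow> ((nat \<Rightarrow> 't) \<Rightarrow> 'a::topological_space \<Rightarrow> 'a) \<Rightarrow> 'a set \<Rightarrow> 'a measure set" where
  "stationary p f X \<equiv> stationary_measures (iid_seq p) (restrict_space borel X) f"

definition stationary_lifts ::
  "('a::topological_space, 'e::euclidean_space) chart set \<Rightarrow> 't measure \<Rightarrow>
   ((nat \<Rightarrow> 't) \<Rightarrow> 'a \<Rightarrow> 'a) \<Rightarrow> 'a set \<Rightarrow> 'a measure \<Rightarrow> ('a, 'e) pvec measure set" where
  "stationary_lifts A p f X \<mu> =
     {\<nu> \<in> stationary_measures (iid_seq p) (proj_borel A X) (\<lambda>\<omega>. proj_map A (f \<omega>)).
        distr \<nu> (restrict_space borel X) fst = \<mu>}"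

definition top_lyapunov ::
  "('a, 'e::euclidean_space) chart set \<Rightarrow> ('a \<Rightarrow> ('a, 'e) tvec \<Rightarrow> ('a, 'e) tvec \<Rightarrow> real) \<Rightarrow>
   't measure \<Rightarrow> ((nat \<Rightarrow> 't) \<Rightarrow> 'a \<Rightarrow> 'a) \<Rightarrow> 'a measure \<Rightarrow> real" where
  "top_lyapunov A g p f \<mu> =
     lim (\<lambda>n. 1 / real n *
       (\<integral>x. (\<integral>\<omega>. ln (deriv_norm A g (random_iter f n \<omega>) x) \<partial>completion (iid_seq p)) \<partial>\<mu>))"

text \<open>The value does not depend on which of the two unit vectors of the line \<open>l\<close> is chosen.\<close>

definition phi ::
  "('a, 'e::euclidean_space) chart set \<Rightarrow> ('a \<Rightarrow> ('a, 'e) tvec \<Rightarrow> ('a, 'e) tvec \<Rightarrow> real) \<Rightarrow>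
   't measure \<Rightarrow> ((nat \<Rightarrow> 't) \<Rightarrow> 'a \<Rightarrow> 'a) \<Rightarrow> ('a, 'e) pvec \<Rightarrow> real" where
  "phi A g p f = (\<lambda>(x, l). let v = (SOME v. v \<in> l \<and> tnorm g x v = 1) in
     (\<integral>\<omega>. ln (tnorm g (f \<omega> x) (tangent_map A (f \<omega>) x v)) \<partial>completion (iid_seq p)))"

definition quasi_irreducible_measure ::
  "('a::topological_space, 'e::euclidean_space) chart set \<Rightarrow>
   ('a \<Rightarrow> ('a, 'e) tvec \<Rightarrow> ('a, 'e) tvec \<Rightarrow> real) \<Rightarrow>
   't measure \<Rightarrow> ((nat \<Rightarrow> 't) \<Rightarrow> 'a \<Rightarrow> 'a) \<Rightarrow> 'a set \<Rightarrow> 'a measure \<Rightarrow> bool" where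
  "quasi_irreducible_measure A g p f X \<mu> \<longleftrightarrow> \<mu> \<in> stationary p f X \<and>
     (\<forall>\<nu>\<in>stationary_lifts A p f X \<mu>. (\<integral>z. phi A g p f z \<partial>\<nu>) = top_lyapunov A g p f \<mu>)"

definition quasi_irreducible ::
  "('a::topological_space, 'e::euclidean_space) chart set \<Rightarrow>
   ('a \<Rightarrow> ('a, 'e) tvec \<Rightarrow> ('a, 'e) tvec \<Rightarrow> real) \<Rightarrow>
   't measure \<Rightarrow> ((nat \<Rightarrow> 't) \<Rightarrow> 'a \<Rightarrow> 'a) \<Rightarrow> 'a set \<Rightarrow> bool" where
  "quasi_irreducible A g p f X \<longleftrightarrow>
     (\<forall>\<mu>\<in>stationary p f X. quasi_irreducible_measure A g p f X \<mu>)"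

end

theory Submission
  imports Defs
begin

text \<open>Let \<open>Q\<close> be the transition operator on the projectivized bundle \<open>Y\<close> over \<open>X\<close>, let
  \<open>S\<^sub>n = \<phi> + Q \<phi> + \<dots> + Q\<^bsup>n-1\<^esup> \<phi>\<close>, let \<open>b\<^sub>n(x)\<close> be the expectation of
  \<open>ln \<parallel>Df\<^sup>n(x)\<parallel>\<close>, and let \<open>\<psi>\<^sub>n(x)\<close> be the minimum of \<open>S\<^sub>n / n\<close> over the fibre of \<open>x\<close>.
  Both \<open>b\<^sub>n\<close> and \<open>\<psi>\<^sub>n\<close> are continuous on \<open>X\<close>, and for every stationary \<open>\<mu>\<close>
  subadditivity and stationarity give
  \<open>\<integral>\<psi>\<^sub>n d\<mu> \<le> \<lambda>\<^sub>1(\<mu>) \<le> \<integral>b\<^sub>n d\<mu> / n\<close>. The right-hand side tends to \<open>\<lambda>\<^sub>1(\<mu>)\<close>. For the left-hand side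
  choose a measurable section of \<open>Y\<close> that minimizes \<open>S\<^sub>n\<close> in each fibre, lift \<open>\<mu>\<close> along it and
  average over \<open>n\<close> steps: the integral of \<open>\<phi>\<close> against this average is \<open>\<integral>\<psi>\<^sub>n d\<mu>\<close>, and every
  limit point as \<open>n \<rightarrow> \<infinity>\<close> is a stationary lift of \<open>\<mu>\<close>. If \<open>\<mu>\<close> is quasi-irreducible, the integral
  of \<open>\<phi>\<close> against such a limit is \<open>\<lambda>\<^sub>1(\<mu>)\<close>, so \<open>\<lambda>\<^sub>1\<close> is squeezed near \<open>\<mu>\<close> between
  two weak* continuous functions with almost the same value at \<open>\<mu>\<close>.

  Weak* compactness and measurable selection are reduced to the real line: \<open>X\<close> and \<open>Y\<close> are
  continuous images of compact sets of reals, so that Helly's theorem and least preimages apply.\<close>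


text \<open>For every stationary measure the exponent is an infimum of integrals of continuous
  functions, hence upper semicontinuous; quasi-irreducibility is needed for lower semicontinuity. It
  concerns the stationary lifts of one measure and says nothing about the lifts of its neighbours.
  Taking the minimum over each fibre resolves this: the lower bound becomes the integral of a
  function on the base, so it varies continuously with the measure, and lifts are needed at
  \<open>\<mu>0\<close> alone. That lower bound comes from cutting an orbit of length k n into k
  blocks. Along any direction each block grows in expectation by at least n times
  \<open>psi n\<close> at the point where it starts, and stationarity gives every block the same
  mean. All of this is carried out for an abstract factor map \<open>pr\<close> between random maps
  of compact spaces. Linear algebra enters only when the fibrewise maximum of the growth is
  recognized as the logarithm of an operator norm.\<close>

section \<open>Compact sets of reals as parameter spaces\<close>

text \<open>For subsets of a Hausdorff space this is compact metrizability, by the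
  Hausdorff-Alexandroff theorem. The existential form passes directly to continuous images and
  finite unions, which is how the bundle is assembled from pieces over charts.\<close>

definition real_image :: "'y topology \<Rightarrow> 'y set \<Rightarrow> bool" where
  "real_image T S \<longleftrightarrow> (\<exists>(C::real set) q. compact C \<and> continuous_map (top_of_set C) T q \<and> q ` C = S)"

lemma real_image_compose:
  assumes "real_image T S" "continuous_map (subtopology T S) T' h"
  shows "real_image T' (h ` S)"
proof -
  obtain C q where C: "compact (C::real set)" "continuous_map (top_of_set C) T q" "q ` C = S"
    using assms(1) by (auto simp: real_image_def)
  have "continuous_map (top_of_set C) (subtopology T S) q"
    using C by (auto simp: continuous_map_in_subtopology)
  from continuous_map_compose[OF this assms(2)] C show ?thesis
    unfolding real_image_def by (intro exI[of _ C] exI[of _ "h \<circ> q"]) (auto simp: image_comp)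
qed

lemma real_image_empty: "real_image T {}"
  unfolding real_image_def by (intro exI[of _ "{}"] exI) (auto simp: continuous_map_def)

lemma real_image_Un:
  assumes "real_image T S1" "real_image T S2"
  shows "real_image T (S1 \<union> S2)"
proof -
  obtain C1 q1 where 1: "compact (C1::real set)" "continuous_map (top_of_set C1) T q1" "q1 ` C1 = S1"
    using assms(1) by (auto simp: real_image_def)
  obtain C2 q2 where 2: "compact (C2::real set)" "continuous_map (top_of_set C2) T q2" "q2 ` C2 = S2"
    using assms(2) by (auto simp: real_image_def)
  obtain a where a: "\<And>t. t \<in> C1 \<Longrightarrow> \<bar>t\<bar> \<le> a"
    using compact_imp_bounded[OF 1(1)] by (auto simp: bounded_real)
  obtain b where b: "\<And>t. t \<in> C2 \<Longrightarrow> \<bar>t\<bar> \<le> b"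
    using compact_imp_bounded[OF 2(1)] by (auto simp: bounded_real)
  \<comment> \<open>\<open>C2\<close> lies above \<open>- b\<close>, so its translate by
    \<open>d\<close> lies above \<open>a + 1\<close> and misses \<open>C1\<close>.\<close>
  define d where "d = a + b + 1"
  define D where "D = (\<lambda>t. t + d) ` C2"
  define q where "q = (\<lambda>t. if t \<in> C1 then q1 t else q2 (t - d))"
  have dis: "C1 \<inter> D = {}"
  proof -
    have False if "t \<in> C1" "t - d \<in> C2" for t
      using a[OF that(1)] b[OF that(2)] by (auto simp: d_def)
    then show ?thesis by (force simp: D_def)
  qed
  have cD: "compact D"
    unfolding D_def by (intro compact_continuous_image 2) (auto intro!: continuous_intros)
  have q2: "continuous_map (top_of_set D) T (\<lambda>t. q2 (t - d))"
  proof -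
    have "continuous_map (top_of_set D) (top_of_set C2) (\<lambda>t. t - d)"
      by (auto simp: D_def intro!: continuous_intros)
    from continuous_map_compose[OF this 2(2)] show ?thesis by (simp add: o_def)
  qed
  have "continuous_map (top_of_set (C1 \<union> D)) T q"
    unfolding continuous_map_closedin
  proof (intro conjI allI impI)
    show "q \<in> topspace (top_of_set (C1 \<union> D)) \<rightarrow> topspace T"
      using 1 2 by (auto simp: q_def D_def continuous_map_def)
  next
    fix K assume K: "closedin T K"
    have k1: "closedin (top_of_set C1) {x \<in> topspace (top_of_set C1). q1 x \<in> K}"
      using 1(2) K by (auto simp: continuous_map_closedin)
    have k2: "closedin (top_of_set D) {x \<in> topspace (top_of_set D). q2 (x - d) \<in> K}"
      using q2 K by (auto simp: continuous_map_closedin)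
    have "compact {x \<in> C1. q1 x \<in> K}" "compact {x \<in> D. q2 (x - d) \<in> K}"
      using k1 k2 1(1) cD closedin_compact by fastforce+
    then have "closed ({x \<in> C1. q1 x \<in> K} \<union> {x \<in> D. q2 (x - d) \<in> K})"
      by (intro closed_Un compact_imp_closed)
    moreover have "{x \<in> topspace (top_of_set (C1 \<union> D)). q x \<in> K} = {x \<in> C1. q1 x \<in> K} \<union> {x \<in> D. q2 (x - d) \<in> K}"
      using dis by (auto simp: q_def)
    ultimately show "closedin (top_of_set (C1 \<union> D)) {x \<in> topspace (top_of_set (C1 \<union> D)). q x \<in> K}"
      by (metis (no_types, lifting) closed_subset mem_Collect_eq subsetI topspace_euclidean_subtopology)
  qed
  moreover have "q ` (C1 \<union> D) = S1 \<union> S2"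
  proof -
    have "q ` C1 = S1" using 1 by (auto simp: q_def)
    moreover have "q ` D = (\<lambda>t. q2 (t - d)) ` D"
      using dis by (intro image_cong) (auto simp: q_def)
    moreover have "\<dots> = S2" using 2 by (auto simp: D_def image_image)
    ultimately show ?thesis by (simp add: image_Un)
  qed
  ultimately show ?thesis
    unfolding real_image_def using 1 cD by (intro exI[of _ "C1 \<union> D"] exI[of _ q]) (auto intro: compact_Un)
qed

lemma real_image_UN:
  "finite I \<Longrightarrow> (\<And>i. i \<in> I \<Longrightarrow> real_image T (S i)) \<Longrightarrow> real_image T (\<Union>i\<in>I. S i)"
  by (induction I rule: finite_induct) (auto intro: real_image_empty real_image_Un)

section \<open>Digit expansions and a space-filling curve\<close>

lemma binary_digits:
  fixes y :: real assumes "0 \<le> y" "y \<le> 1"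
  obtains a :: "nat \<Rightarrow> real" where "\<And>k. a k = 0 \<or> a k = 1" "(\<lambda>k. a k / 2 ^ Suc k) sums y"
proof -
  \<comment> \<open>Greedy binary expansion: \<open>r k\<close> is the remainder after k digits,
    rescaled to the unit interval, so that the partial sums miss \<open>y\<close> by exactly
    \<open>r n / 2 ^ n\<close>. Taking the digit 1 from one half on also covers
    \<open>y = 1\<close>, whose digits are all 1.\<close>
  define r where "r = rec_nat y (\<lambda>_ u. if u \<ge> 1/2 then 2 * u - 1 else 2 * u)"
  define a where "a k = (if r k \<ge> 1/2 then 1 else 0 :: real)" for k
  have r0: "r 0 = y" and rS: "r (Suc k) = 2 * r k - a k" for k
    by (auto simp: r_def a_def)
  have rb: "0 \<le> r k \<and> r k \<le> 1" for k
    by (induction k) (use assms in \<open>auto simp: r0 rS, auto simp: a_def\<close>)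
  have part: "(\<Sum>k<n. a k / 2 ^ Suc k) = y - r n / 2 ^ n" for n
    by (induction n) (auto simp: r0 rS field_simps)
  have "(\<lambda>n. r n * (1/2) ^ n) \<longlonglongrightarrow> 0"
  proof (rule Lim_null_comparison)
    show "\<forall>\<^sub>F n in sequentially. norm (r n * (1/2) ^ n) \<le> (1/2) ^ n"
      using rb by (auto intro!: always_eventually simp: abs_mult mult_left_le_one_le)
  qed (auto intro!: LIMSEQ_power_zero)
  then have "(\<lambda>n. y - r n * (1/2) ^ n) \<longlonglongrightarrow> y - 0"
    by (intro tendsto_intros)
  then have "(\<lambda>k. a k / 2 ^ Suc k) sums y"
    unfolding sums_def part by (simp add: power_one_over)
  then show ?thesis by (intro that[of a]) (auto simp: a_def)
qed

text \<open>The coordinate functions of Schoenberg's space-filling curve: at a point with ternary digits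
  \<open>2 * a\<^sub>0, 2 * a\<^sub>1, \<dots>\<close> the \<open>j\<close>-th one is the number with the binary digits \<open>a\<^bsub>m\<^esub>\<close>,
  \<open>m = prod_encode (j, k)\<close>.\<close>

definition schoenberg_step :: "real \<Rightarrow> real" where
  "schoenberg_step t = max 0 (min 1 (1/2 - cos (pi * t)))"

definition schoenberg :: "nat \<Rightarrow> real \<Rightarrow> real" where
  "schoenberg j t = (\<Sum>k. schoenberg_step (3 ^ prod_encode (j, k) * t) / 2 ^ Suc k)"

lemma continuous_schoenberg: "continuous_on UNIV (schoenberg j)"
proof -
  have "uniform_limit UNIV (\<lambda>n t. \<Sum>k<n. schoenberg_step (3 ^ prod_encode (j, k) * t) / 2 ^ Suc k)
          (schoenberg j) sequentially"
    unfolding schoenberg_def[abs_def]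
  proof (rule Weierstrass_m_test)
    show "norm (schoenberg_step (3 ^ prod_encode (j, k) * t) / 2 ^ Suc k) \<le> (1/2) ^ Suc k" for k t
      by (auto simp: schoenberg_step_def power_one_over divide_simps)
    show "summable (\<lambda>k. (1/2::real) ^ Suc k)"
      by (intro summable_mult summable_geometric summable_Suc_iff[THEN iffD2]) auto
  qed
  then show ?thesis
    by (rule uniform_limit_theorem[rotated])
       (auto simp: schoenberg_step_def intro!: always_eventually continuous_intros)
qed

text \<open>The binary digits of all the \<open>y j\<close> are interleaved into one sequence
  \<open>\<alpha>\<close>, and \<open>2 * \<alpha>\<close> is read as a ternary expansion.
  Multiplication by \<open>3 ^ m\<close> shifts that expansion, and \<open>schoenberg_step\<close>
  then reads off its leading digit.\<close>

lemma schoenberg_surj: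
  assumes y: "\<And>j. 0 \<le> y j \<and> y j \<le> 1"
  obtains t where "t \<in> {0..1}" "\<And>j. schoenberg j t = y j"
proof -
  have "\<exists>a. (\<forall>k. a k = 0 \<or> a k = 1) \<and> (\<lambda>k. a k / 2 ^ Suc k) sums y j" for j
    using binary_digits[of "y j"] y by metis
  then obtain a where a: "\<And>j k. a j k = 0 \<or> a j k = (1::real)" "\<And>j. (\<lambda>k. a j k / 2 ^ Suc k) sums y j"
    by metis
  define \<alpha> where "\<alpha> m = (case prod_decode m of (j, k) \<Rightarrow> a j k)" for m
  have \<alpha>: "\<alpha> m = 0 \<or> \<alpha> m = 1" for m
    using a by (auto simp: \<alpha>_def split: prod.split)
  define t where "t m = (\<Sum>i. 2 * \<alpha> (m + i) / 3 ^ Suc i)" for m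
  have geo: "(\<lambda>i. 2 / 3 ^ Suc i :: real) sums 1"
    using sums_mult[OF geometric_sums[of "1/3::real"], of "2/3"] by (simp add: power_one_over)
  have le: "0 \<le> 2 * \<alpha> (m + i) / 3 ^ Suc i \<and> 2 * \<alpha> (m + i) / 3 ^ Suc i \<le> 2 / 3 ^ Suc i" for m i
    using \<alpha>[of "m + i"] by auto
  have sm: "summable (\<lambda>i. 2 * \<alpha> (m + i) / 3 ^ Suc i)" for m
    by (rule summable_comparison_test'[OF sums_summable[OF geo], of 0]) (metis abs_of_nonneg le real_norm_def)
  have t01: "t m \<in> {0..1}" for m
    unfolding t_def sums_unique[OF geo] atLeastAtMost_iff using le
    by (intro conjI suminf_nonneg suminf_le sm sums_summable[OF geo]) auto
  have step: "3 * t m = 2 * \<alpha> m + t (Suc m)" for m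
  proof -
    have "t m = 2 * \<alpha> m / 3 + (\<Sum>i. 2 * \<alpha> (Suc m + i) / 3 ^ Suc i / 3)"
      unfolding t_def using suminf_split_initial_segment[OF sm[of m], of 1] by (simp add: mult.commute)
    also have "(\<Sum>i. 2 * \<alpha> (Suc m + i) / 3 ^ Suc i / 3) = t (Suc m) / 3"
      unfolding t_def using suminf_divide[OF sm[of "Suc m"], of 3] by simp
    finally show ?thesis by simp
  qed
  \<comment> \<open>All ternary digits are 0 or 2, so what stands before the tail \<open>t m\<close>
    is an even integer. A function of period 2 therefore sees the tail only.\<close>
  have ev: "\<exists>l::int. 3 ^ m * t 0 = 2 * of_int l + t m" for m
  proof (induction m)
    case (Suc m)
    then obtain l :: int where l: "3 ^ m * t 0 = 2 * of_int l + t m" by auto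
    have "3 ^ Suc m * t 0 = 3 * (3 ^ m * t 0)" by simp
    also have "\<dots> = 6 * of_int l + (2 * \<alpha> m + t (Suc m))" unfolding l using step[of m] by simp
    finally have *: "3 ^ Suc m * t 0 = 6 * of_int l + (2 * \<alpha> m + t (Suc m))" .
    from \<alpha>[of m] show ?case
    proof
      assume "\<alpha> m = 0" then show ?thesis using * by (intro exI[of _ "3 * l"]) simp
    next
      assume "\<alpha> m = 1" then show ?thesis using * by (intro exI[of _ "3 * l + 1"]) simp
    qed
  qed (auto intro!: exI[of _ 0])
  \<comment> \<open>\<open>schoenberg_step\<close> is 0 on [0, 1/3] and 1 on [2/3, 1], because the
    cosine is at least 1/2 on the former (after scaling by \<open>pi\<close>) and at most -1/2 on
    the latter. The leading ternary digit decides in which third \<open>t m\<close> lies.\<close>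
  have dig: "schoenberg_step (3 ^ m * t 0) = \<alpha> m" for m
  proof -
    obtain l :: int where "3 ^ m * t 0 = 2 * of_int l + t m" using ev by blast
    then have "pi * (3 ^ m * t 0) = pi * t m + of_int (2 * l) * pi" by (simp add: algebra_simps)
    then have c: "cos (pi * (3 ^ m * t 0)) = cos (pi * t m)"
      using cos_int_2pin[of l] sin_int_2pin[of l] by (simp add: cos_add mult.commute mult.left_commute)
    from \<alpha>[of m] show ?thesis
    proof
      assume 0: "\<alpha> m = 0"
      then have "0 \<le> t m" "t m \<le> 1/3" using step[of m] t01[of m] t01[of "Suc m"] by auto
      then have "cos (pi * t m) \<ge> cos (pi / 3)"
        by (intro cos_monotone_0_pi_le) (auto simp: field_simps)
      then show ?thesis using c 0 by (simp add: schoenberg_step_def cos_60)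
    next
      assume 1: "\<alpha> m = 1"
      then have "2/3 \<le> t m" "t m \<le> 1" using step[of m] t01[of m] t01[of "Suc m"] by auto
      then have "cos (pi * t m) \<le> cos (2/3 * pi)"
        by (intro cos_monotone_0_pi_le) (auto simp: field_simps)
      also have "\<dots> = - (1/2)" using cos_120 by simp
      finally show ?thesis using c 1 by (simp add: schoenberg_step_def)
    qed
  qed
  have "schoenberg j (t 0) = y j" for j
    unfolding schoenberg_def dig using sums_unique[OF a(2)[of j]] by (simp add: \<alpha>_def)
  then show ?thesis using that t01 by blast
qed

lemma real_image_compact:
  fixes K :: "'b::euclidean_space set"
  assumes "compact K" shows "real_image euclidean K"
proof -
  obtain B where B: "B > 0" "\<And>x. x \<in> K \<Longrightarrow> norm x \<le> B"
    using compact_imp_bounded[OF assms] by (auto simp: bounded_pos)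
  \<comment> \<open>In each coordinate the unit interval is stretched to [-B, B], so the curve fills
    a cube around \<open>K\<close>; restricting it to the preimage of \<open>K\<close> gives the
    parametrization.\<close>
  define q :: "real \<Rightarrow> 'b" where
    "q t = (\<Sum>b\<in>Basis. (B * (2 * schoenberg (to_nat_on Basis b) t - 1)) *\<^sub>R b)" for t
  have cq: "continuous_on UNIV q"
    unfolding q_def
    by (intro continuous_intros continuous_on_compose2[OF continuous_schoenberg]) auto
  define C where "C = {0..1} \<inter> q -` K"
  have "compact C"
    unfolding C_def
    by (intro compact_Int_closed compact_Icc continuous_closed_vimage)
       (use cq assms compact_imp_closed in \<open>auto simp: continuous_on_eq_continuous_at\<close>)
  moreover have "q ` C = K"
  proof
    show "K \<subseteq> q ` C"
    proof
      fix x assume x: "x \<in> K"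
      \<comment> \<open>The curve prescribes infinitely many coordinates at once; indices that
        number no basis vector receive the harmless value 0.\<close>
      define y where "y j = (if j \<in> to_nat_on (Basis::'b set) ` Basis
         then (x \<bullet> from_nat_into Basis j / B + 1) / 2 else 0)" for j
      have "0 \<le> y j \<and> y j \<le> 1" for j
      proof (cases "j \<in> to_nat_on (Basis::'b set) ` Basis")
        case True
        then have b: "from_nat_into Basis j \<in> (Basis::'b set)"
          by (simp add: from_nat_into)
        have "\<bar>x \<bullet> from_nat_into Basis j\<bar> \<le> B"
          using Basis_le_norm[OF b, of x] B(2)[OF x] by linarith
        then show ?thesis using B(1) True by (auto simp: y_def abs_le_iff field_simps)
      qed (auto simp: y_def)
      then obtain t where t: "t \<in> {0..1}" "\<And>j. schoenberg j t = y j"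
        using schoenberg_surj by metis
      have "q t = (\<Sum>b\<in>Basis. (x \<bullet> b) *\<^sub>R b)"
        unfolding q_def t
        by (intro sum.cong) (use B(1) in \<open>auto simp: y_def field_simps countable_finite\<close>)
      then have "q t = x" by (simp add: euclidean_representation)
      then show "x \<in> q ` C" using t(1) x by (auto simp: C_def)
    qed
  qed (auto simp: C_def)
  ultimately show ?thesis
    unfolding real_image_def
    by (intro exI[of _ C] exI[of _ q]) (use cq in \<open>auto intro: continuous_on_subset\<close>)
qed


section \<open>Measures on continuous images of compact sets of reals\<close>

definition borel_top :: "'y topology \<Rightarrow> 'y measure" where
  "borel_top T = sigma (topspace T) {U. openin T U}"

lemma space_borel_top [simp]: "space (borel_top T) = topspace T"
  unfolding borel_top_def by (intro space_measure_of) (auto dest: openin_subset)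

lemma sets_borel_top: "sets (borel_top T) = sigma_sets (topspace T) {U. openin T U}"
  unfolding borel_top_def by (intro sets_measure_of) (auto dest: openin_subset)

lemma openin_sets_borel_top: "openin T U \<Longrightarrow> U \<in> sets (borel_top T)"
  by (auto simp: sets_borel_top)

lemma closedin_sets_borel_top: "closedin T F \<Longrightarrow> F \<in> sets (borel_top T)"
  by (metis closedin_def double_diff openin_sets_borel_top order_refl sets.compl_sets space_borel_top)

lemma measurable_borel_topI:
  assumes "G \<in> space M \<rightarrow> topspace T" "\<And>U. openin T U \<Longrightarrow> G -` U \<inter> space M \<in> sets M"
  shows "G \<in> M \<rightarrow>\<^sub>M borel_top T"
  unfolding borel_top_def
  by (rule measurable_measure_of) (use assms in \<open>auto dest: openin_subset\<close>)

lemma continuous_map_measurable_top: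
  assumes "continuous_map T T' h" shows "h \<in> borel_top T \<rightarrow>\<^sub>M borel_top T'"
proof (rule measurable_borel_topI)
  show "h \<in> space (borel_top T) \<rightarrow> topspace T'"
    using assms by (auto simp: continuous_map_def)
  fix U assume "openin T' U"
  then have "openin T {x \<in> topspace T. h x \<in> U}"
    using assms by (auto simp: continuous_map_def)
  moreover have "{x \<in> topspace T. h x \<in> U} = h -` U \<inter> space (borel_top T)" by auto
  ultimately show "h -` U \<inter> space (borel_top T) \<in> sets (borel_top T)"
    by (metis openin_sets_borel_top)
qed

lemma sets_borel_top_euclidean: "sets (borel_top euclidean) = sets borel"
  by (simp add: sets_borel_top borel_def)

lemma continuous_map_measurable_real:
  "continuous_map T euclideanreal h \<Longrightarrow> h \<in> borel_measurable (borel_top T)"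
  using continuous_map_measurable_top[of T euclideanreal h]
  by (simp cong: measurable_cong_sets add: sets_borel_top_euclidean)

text \<open>A continuous map from a compact set onto a Hausdorff space is closed, so
  \<open>q\<close> is a quotient map. The order and the metric of \<open>C\<close> thereby stand in
  for structure that \<open>T\<close> does not carry itself.\<close>

locale real_param =
  fixes T :: "'y topology" and C :: "real set" and q :: "real \<Rightarrow> 'y"
  assumes Hausdorff: "Hausdorff_space T" and compact_C: "compact C"
    and cont_q: "continuous_map (top_of_set C) T q" and surj_q: "q ` C = topspace T"
begin

lemma q_in: "t \<in> C \<Longrightarrow> q t \<in> topspace T"
  using surj_q by auto

lemma compact_T: "compact_space T"
  using image_compactin[OF _ cont_q, of C] compact_C surj_q
  by (simp add: compact_space_def compactin_subtopology)

lemma closedin_image: "compact K \<Longrightarrow> K \<subseteq> C \<Longrightarrow> closedin T (q ` K)"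
  using image_compactin[OF _ cont_q, of K] Hausdorff
  by (simp add: compactin_imp_closedin compactin_subtopology)

lemma compact_preimage:
  assumes "closedin T F" shows "compact {t \<in> C. q t \<in> F}"
proof -
  have "closedin (top_of_set C) {t \<in> topspace (top_of_set C). q t \<in> F}"
    using cont_q assms unfolding continuous_map_closedin by blast
  then show ?thesis using compact_C closedin_compact by fastforce
qed

lemma continuous_mapI:
  assumes "continuous_map (top_of_set C) Z (\<lambda>t. h (q t))"
  shows "continuous_map T Z h"
  unfolding continuous_map_closedin
proof (intro conjI allI impI)
  show "h \<in> topspace T \<rightarrow> topspace Z"
  proof
    fix z assume "z \<in> topspace T"
    then obtain t where "t \<in> C" "q t = z" using surj_q by (metis imageE)
    then show "h z \<in> topspace Z" using continuous_map_funspace[OF assms] by auto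
  qed
  fix F assume "closedin Z F"
  then have "closedin (top_of_set C) {t \<in> topspace (top_of_set C). h (q t) \<in> F}"
    using assms unfolding continuous_map_closedin by blast
  then have "compact {t \<in> C. h (q t) \<in> F}"
    using compact_C closedin_compact by fastforce
  then have "closedin T (q ` {t \<in> C. h (q t) \<in> F})"
    by (intro closedin_image) auto
  moreover have "q ` {t \<in> C. h (q t) \<in> F} = {x \<in> topspace T. h x \<in> F}"
    using surj_q by auto
  ultimately show "closedin T {x \<in> topspace T. h x \<in> F}" by simp
qed

lemma continuous_comp_q:
  "continuous_map T euclideanreal h \<Longrightarrow> continuous_on C (\<lambda>t. h (q t))"
  using continuous_map_compose[OF cont_q, of euclideanreal h] by (simp add: o_def)

lemma bounded_continuous:
  assumes "continuous_map T euclideanreal h"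
  obtains B where "\<And>z. z \<in> topspace T \<Longrightarrow> \<bar>h z\<bar> \<le> B"
proof -
  have "bounded ((\<lambda>t. h (q t)) ` C)"
    by (intro compact_imp_bounded compact_continuous_image continuous_comp_q assms compact_C)
  then obtain B where "\<And>t. t \<in> C \<Longrightarrow> \<bar>h (q t)\<bar> \<le> B"
    by (auto simp: bounded_real)
  then show ?thesis using that surj_q by (metis imageE)
qed

text \<open>The least preimage is measurable because its sublevel sets are the images of the compact
  initial pieces of \<open>C\<close>, hence closed.\<close>

lemma measurable_section:
  obtains s where "s \<in> borel_top T \<rightarrow>\<^sub>M borel" "\<And>z. z \<in> topspace T \<Longrightarrow> s z \<in> C"
    "\<And>z. z \<in> topspace T \<Longrightarrow> q (s z) = z"
proof -
  define s where "s z = Inf {t \<in> C. q t = z}" for z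
  have s: "s z \<in> C \<and> q (s z) = z \<and> (\<forall>t\<in>C. q t = z \<longrightarrow> s z \<le> t)" if "z \<in> topspace T" for z
  proof -
    have "closedin T {z}"
      using that Hausdorff by (simp add: closedin_Hausdorff_singleton)
    then have c: "compact {t \<in> C. q t = z}"
      using compact_preimage[of "{z}"] by simp
    have "{t \<in> C. q t = z} \<noteq> {}" using surj_q that by (metis (mono_tags, lifting) empty_Collect_eq imageE)
    then have "s z \<in> {t \<in> C. q t = z}"
      unfolding s_def using c by (intro closed_contains_Inf compact_imp_closed bounded_imp_bdd_below compact_imp_bounded)
    moreover have "s z \<le> t" if "t \<in> {t \<in> C. q t = z}" for t
      unfolding s_def using c that by (intro cInf_lower bounded_imp_bdd_below compact_imp_bounded)
    ultimately show ?thesis by auto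
  qed
  have "s \<in> borel_measurable (borel_top T)"
  proof (rule borel_measurableI_le)
    fix a
    have "{z \<in> space (borel_top T). s z \<le> a} = q ` (C \<inter> {..a})"
      using s surj_q by (force simp: image_iff)
    moreover have "closedin T (q ` (C \<inter> {..a}))"
      using compact_C by (intro closedin_image) (auto intro: compact_Int_closed)
    ultimately show "{z \<in> space (borel_top T). s z \<le> a} \<in> sets (borel_top T)"
      by (metis closedin_sets_borel_top)
  qed
  then show ?thesis using s that[of s] by auto
qed

lemma measurable_q_comp:
  assumes [measurable]: "s \<in> borel_measurable M" and sC: "\<And>x. x \<in> space M \<Longrightarrow> s x \<in> C"
  shows "(\<lambda>x. q (s x)) \<in> M \<rightarrow>\<^sub>M borel_top T"
proof (rule measurable_borel_topI)
  show "(\<lambda>x. q (s x)) \<in> space M \<rightarrow> topspace T" using sC q_in by auto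
  fix U assume U: "openin T U"
  have "compact {t \<in> C. q t \<in> topspace T - U}" using U by (intro compact_preimage) auto
  then have [measurable]: "{t \<in> C. q t \<in> topspace T - U} \<in> sets borel" by (rule borel_compact)
  have "(\<lambda>x. q (s x)) -` U \<inter> space M = {x \<in> space M. s x \<notin> {t \<in> C. q t \<in> topspace T - U}}"
    using q_in sC by auto
  also have "\<dots> \<in> sets M" by measurable
  finally show "(\<lambda>x. q (s x)) -` U \<inter> space M \<in> sets M" .
qed

section \<open>Continuous test functions, measurability and weak limits\<close>

lemma open_indicator_limit:
  assumes "openin T U"
  obtains h :: "nat \<Rightarrow> 'y \<Rightarrow> real" where
    "\<And>n. continuous_map T euclideanreal (h n)"
    "\<And>n z. z \<in> topspace T \<Longrightarrow> 0 \<le> h n z \<and> h n z \<le> indicator U z"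
    "\<And>z. z \<in> topspace T \<Longrightarrow> (\<lambda>n. h n z) \<longlonglongrightarrow> indicator U z"
proof -
  define F where "F = {t \<in> C. q t \<in> topspace T - U}"
  have F: "compact F" unfolding F_def using assms by (intro compact_preimage) auto
  \<comment> \<open>The images of the sets \<open>K n\<close> exhaust \<open>U\<close> by closed
    sets: the parameters of \<open>U\<close> are those at positive distance from the compact set
    \<open>F\<close>. The case \<open>F = {}\<close> is separate because \<open>infdist\<close> to
    the empty set is 0 by convention. Urysohn functions for these pairs of closed sets then increase
    to the indicator pointwise.\<close>
  define K where "K n = {t \<in> C. F = {} \<or> infdist t F \<ge> 1 / Suc n}" for n
  have K: "compact (K n)" for n
  proof (cases "F = {}")
    case False
    have "K n = C \<inter> {t. infdist t F \<ge> 1 / Suc n}" using False by (auto simp: K_def)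
    moreover have "closed {t. infdist t F \<ge> 1 / Suc n}"
      by (intro closed_Collect_le continuous_intros)
    ultimately show ?thesis using compact_C by (auto intro: compact_Int_closed)
  qed (use compact_C in \<open>auto simp: K_def\<close>)
  have "\<exists>g. continuous_map T (top_of_set {0..1::real}) g \<and> g ` (topspace T - U) \<subseteq> {0} \<and> g ` (q ` K n) \<subseteq> {1}" for n
  proof -
    have "normal_space T"
      using compact_T Hausdorff compact_Hausdorff_or_regular_imp_normal_space by blast
    moreover have "closedin T (topspace T - U)" using assms by auto
    moreover have "closedin T (q ` K n)" using K by (intro closedin_image) (auto simp: K_def)
    moreover have "disjnt (topspace T - U) (q ` K n)"
    proof -
      have False if "t \<in> K n" "q t \<notin> U" for t
      proof -
        have "t \<in> F" using that surj_q by (auto simp: F_def K_def)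
        then have "infdist t F = 0" "F \<noteq> {}" by auto
        then show False using that by (auto simp: K_def)
      qed
      then show ?thesis by (auto simp: disjnt_def)
    qed
    ultimately show ?thesis using Urysohn_lemma[of T "topspace T - U" "q ` K n" 0 1] by (metis zero_le_one)
  qed
  then obtain h where h: "\<And>n. continuous_map T (top_of_set {0..1::real}) (h n)"
    "\<And>n. h n ` (topspace T - U) \<subseteq> {0}" "\<And>n. h n ` (q ` K n) \<subseteq> {1}" by metis
  show ?thesis
  proof (rule that[of h])
    show "continuous_map T euclideanreal (h n)" for n
      using h(1) continuous_map_in_subtopology by blast
    show "0 \<le> h n z \<and> h n z \<le> indicator U z" if z: "z \<in> topspace T" for n z
    proof -
      have "h n z \<in> {0..1}" using h(1)[of n] z by (auto simp: continuous_map_def)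
      then show ?thesis using h(2)[of n] z by (cases "z \<in> U") auto
    qed
    show "(\<lambda>n. h n z) \<longlonglongrightarrow> indicator U z" if z: "z \<in> topspace T" for z
    proof (cases "z \<in> U")
      case False
      then have "h n z = 0" for n using h(2)[of n] z by auto
      then show ?thesis using False by simp
    next
      case True
      obtain t where t: "t \<in> C" "q t = z" using surj_q z by (metis imageE)
      have tF: "t \<notin> F" using t True by (auto simp: F_def)
      have "\<forall>\<^sub>F n in sequentially. t \<in> K n"
      proof (cases "F = {}")
        case True then show ?thesis using t by (auto simp: K_def)
      next
        case False
        then have "infdist t F > 0"
          using tF F by (metis compact_imp_closed in_closed_iff_infdist_zero infdist_nonneg less_eq_real_def)
        then have "\<forall>\<^sub>F n in sequentially. 1 / Suc n < infdist t F"
          by (rule order_tendstoD(2)[OF LIMSEQ_Suc[OF lim_1_over_n]])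
        then show ?thesis by eventually_elim (use t in \<open>auto simp: K_def\<close>)
      qed
      then have "\<forall>\<^sub>F n in sequentially. h n z = 1"
        by eventually_elim (use h(3) t in blast)
      then show ?thesis using True by (simp add: tendsto_eventually)
    qed
  qed
qed

text \<open>The measure of an open set is a limit of integrals of continuous functions, and the open
  sets form an intersection-stable generator.\<close>

lemma measure_eqI_continuous:
  assumes M: "finite_measure M" "sets M = sets (borel_top T)"
    and N: "finite_measure N" "sets N = sets (borel_top T)"
    and eq: "\<And>h. continuous_map T euclideanreal h \<Longrightarrow> (\<integral>z. h z \<partial>M) = (\<integral>z. h z \<partial>N)"
  shows "M = N"
proof -
  interpret M: finite_measure M by fact
  interpret N: finite_measure N by fact
  have lim: "(\<lambda>n. \<integral>z. h n z \<partial>K) \<longlonglongrightarrow> measure K U"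
    if "openin T U" "finite_measure K" "sets K = sets (borel_top T)"
      and h: "\<And>n. continuous_map T euclideanreal (h n)"
      "\<And>n z. z \<in> topspace T \<Longrightarrow> 0 \<le> h n z \<and> h n z \<le> indicator U z"
      "\<And>z. z \<in> topspace T \<Longrightarrow> (\<lambda>n. h n z) \<longlonglongrightarrow> indicator U z"
    for K U and h :: "nat \<Rightarrow> 'y \<Rightarrow> real"
  proof -
    interpret K: finite_measure K by fact
    have sp: "space K = topspace T" using sets_eq_imp_space_eq[OF that(3)] by simp
    have m: "h n \<in> borel_measurable K" for n
      using continuous_map_measurable_real[OF h(1)] by (simp cong: measurable_cong_sets add: that(3))
    have U: "U \<in> sets K" using that openin_sets_borel_top by blast
    have "(\<lambda>n. \<integral>z. h n z \<partial>K) \<longlonglongrightarrow> (\<integral>z. indicator U z \<partial>K)"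
    proof (rule integral_dominated_convergence[where w="\<lambda>_. 1"])
      show "AE z in K. norm (h n z) \<le> 1" for n
      proof (rule AE_I2)
        fix z assume "z \<in> space K"
        then show "norm (h n z) \<le> 1" using h(2)[of z n] by (cases "z \<in> U") (auto simp: sp)
      qed
    qed (use m U h(3) sp in \<open>auto intro!: AE_I2\<close>)
    then show ?thesis using U by simp
  qed
  show ?thesis
  proof (rule measure_eqI_generator_eq[where E="{U. openin T U}" and \<Omega>="topspace T" and A="\<lambda>_. topspace T"])
    fix U assume U: "U \<in> {U. openin T U}"
    obtain h :: "nat \<Rightarrow> 'y \<Rightarrow> real" where h:
      "\<And>n. continuous_map T euclideanreal (h n)"
      "\<And>n z. z \<in> topspace T \<Longrightarrow> 0 \<le> h n z \<and> h n z \<le> indicator U z"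
      "\<And>z. z \<in> topspace T \<Longrightarrow> (\<lambda>n. h n z) \<longlonglongrightarrow> indicator U z"
      using open_indicator_limit U by auto
    have "(\<lambda>n. \<integral>z. h n z \<partial>M) \<longlonglongrightarrow> measure M U" "(\<lambda>n. \<integral>z. h n z \<partial>N) \<longlonglongrightarrow> measure N U"
      using lim U M N h by auto
    then have "measure M U = measure N U"
      using LIMSEQ_unique eq[OF h(1)] by simp
    then show "emeasure M U = emeasure N U"
      by (simp add: M.emeasure_eq_measure N.emeasure_eq_measure)
  qed (use M N in \<open>auto simp: Int_stable_def sets_borel_top dest: openin_subset\<close>)
qed

lemma measurable_via_continuous:
  assumes "G \<in> space M \<rightarrow> topspace T"
    and "\<And>h. continuous_map T euclideanreal h \<Longrightarrow> (\<lambda>x. h (G x)) \<in> borel_measurable M"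
  shows "G \<in> M \<rightarrow>\<^sub>M borel_top T"
proof (rule measurable_borel_topI[OF assms(1)])
  fix U assume "openin T U"
  then obtain h :: "nat \<Rightarrow> 'y \<Rightarrow> real" where h:
    "\<And>n. continuous_map T euclideanreal (h n)"
    "\<And>n z. z \<in> topspace T \<Longrightarrow> 0 \<le> h n z \<and> h n z \<le> indicator U z"
    "\<And>z. z \<in> topspace T \<Longrightarrow> (\<lambda>n. h n z) \<longlonglongrightarrow> indicator U z"
    using open_indicator_limit by auto
  have [measurable]: "(\<lambda>x. h n (G x)) \<in> borel_measurable M" for n using assms h by auto
  have "z \<in> U \<longleftrightarrow> (\<exists>n. h n z > 0)" if "z \<in> topspace T" for z
  proof
    assume "z \<in> U"
    then have "(\<lambda>n. h n z) \<longlonglongrightarrow> 1" using h(3)[OF that] by simp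
    then have "\<forall>\<^sub>F n in sequentially. h n z > 0" by (rule order_tendstoD) auto
    then show "\<exists>n. h n z > 0" by (auto simp: eventually_sequentially)
  next
    assume "\<exists>n. h n z > 0"
    then obtain n where "h n z > 0" ..
    then show "z \<in> U" using h(2)[OF that, of n] by (cases "z \<in> U") auto
  qed
  then have "G -` U \<inter> space M = {x \<in> space M. \<exists>n. h n (G x) > 0}"
    using assms(1) by auto
  then show "G -` U \<inter> space M \<in> sets M" by simp
qed

text \<open>The parameter of \<open>z\<close> is rounded to a grid of mesh \<open>1 / Suc n\<close>.
  Each rounded function takes countably many measurable pieces, and continuity in \<open>z\<close>
  makes the rounded functions converge.\<close>

lemma measurable_Caratheodory:
  fixes H :: "'w \<Rightarrow> 'y \<Rightarrow> real"
  assumes m: "\<And>z. z \<in> topspace T \<Longrightarrow> (\<lambda>w. H w z) \<in> borel_measurable M"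
    and c: "\<And>w. w \<in> space M \<Longrightarrow> continuous_map T euclideanreal (H w)"
  shows "(\<lambda>(w, z). H w z) \<in> borel_measurable (M \<Otimes>\<^sub>M borel_top T)"
proof -
  obtain s where s[measurable]: "s \<in> borel_measurable (borel_top T)" and
    sC: "\<And>z. z \<in> topspace T \<Longrightarrow> s z \<in> C" and qs: "\<And>z. z \<in> topspace T \<Longrightarrow> q (s z) = z"
    using measurable_section by blast
  \<comment> \<open>The grid point itself may lie outside \<open>C\<close>, so each cell is
    represented by some element of \<open>C\<close> inside it; cells that miss \<open>C\<close> get
    the value 0 in \<open>g\<close>.\<close>
  define c where "c n k = (SOME u. u \<in> C \<and> \<lfloor>real (Suc n) * u\<rfloor> = k)" for n k
  define g where "g n k w = (if \<exists>u\<in>C. \<lfloor>real (Suc n) * u\<rfloor> = k then H w (q (c n k)) else 0)" for n and k::int and w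
  have c: "c n k \<in> C \<and> \<lfloor>real (Suc n) * c n k\<rfloor> = k" if "\<exists>u\<in>C. \<lfloor>real (Suc n) * u\<rfloor> = k" for n k
    unfolding c_def using someI_ex[of "\<lambda>u. u \<in> C \<and> \<lfloor>real (Suc n) * u\<rfloor> = k"] that by blast
  have g[measurable]: "g n k \<in> borel_measurable M" for n k
  proof (cases "\<exists>u\<in>C. \<lfloor>real (Suc n) * u\<rfloor> = k")
    case True
    then have "g n k = (\<lambda>w. H w (q (c n k)))" by (intro ext) (simp only: g_def if_True)
    then show ?thesis using m[OF q_in] c[OF True] by simp
  next
    case False
    then have "g n k = (\<lambda>w. 0)" by (intro ext) (simp only: g_def if_False)
    then show ?thesis by simp
  qed
  show ?thesis
  proof (rule borel_measurable_LIMSEQ_metric)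
    fix n
    have "(\<lambda>x. g n \<lfloor>real (Suc n) * s (snd x)\<rfloor> (fst x)) \<in> borel_measurable (M \<Otimes>\<^sub>M borel_top T)"
    proof (rule measurable_compose_countable)
      show "(\<lambda>x. g n i (fst x)) \<in> borel_measurable (M \<Otimes>\<^sub>M borel_top T)" for i
        using measurable_compose[OF measurable_fst g] .
      have "(\<lambda>x. s (snd x)) \<in> borel_measurable (M \<Otimes>\<^sub>M borel_top T)"
        using measurable_compose[OF measurable_snd s] .
      then show "(\<lambda>x. \<lfloor>real (Suc n) * s (snd x)\<rfloor>) \<in> M \<Otimes>\<^sub>M borel_top T \<rightarrow>\<^sub>M count_space UNIV"
        by measurable
    qed
    then show "(\<lambda>(w, z). g n \<lfloor>real (Suc n) * s z\<rfloor> w) \<in> borel_measurable (M \<Otimes>\<^sub>M borel_top T)"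
      by (simp add: case_prod_beta')
  next
    fix x assume "x \<in> space (M \<Otimes>\<^sub>M borel_top T)"
    then obtain w z where x: "x = (w, z)" "w \<in> space M" "z \<in> topspace T"
      by (auto simp: space_pair_measure)
    define u where "u n = c n \<lfloor>real (Suc n) * s z\<rfloor>" for n
    have ex: "\<exists>u\<in>C. \<lfloor>real (Suc n) * u\<rfloor> = \<lfloor>real (Suc n) * s z\<rfloor>" for n
      using sC x by auto
    have u: "u n \<in> C" "\<lfloor>real (Suc n) * u n\<rfloor> = \<lfloor>real (Suc n) * s z\<rfloor>" for n
      using c[OF ex] by (auto simp: u_def)
    have "\<bar>u n - s z\<bar> \<le> 1 / Suc n" for n
    proof -
      have "\<bar>real (Suc n) * u n - real (Suc n) * s z\<bar> \<le> 1"
        using u(2)[of n] by linarith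
      then have "real (Suc n) * \<bar>u n - s z\<bar> \<le> 1"
        by (simp add: abs_mult flip: right_diff_distrib)
      then show ?thesis by (simp add: field_simps)
    qed
    then have "(\<lambda>n. u n - s z) \<longlonglongrightarrow> 0"
      by (intro Lim_null_comparison[OF _ LIMSEQ_Suc[OF lim_1_over_n]]) (auto intro: always_eventually)
    then have "u \<longlonglongrightarrow> s z" by (simp add: LIM_zero_iff)
    moreover have "continuous_on C (\<lambda>t. H w (q t))" using assms(2) x continuous_comp_q by auto
    ultimately have "(\<lambda>n. H w (q (u n))) \<longlonglongrightarrow> H w (q (s z))"
      using u sC x by (auto simp: continuous_on_sequentially o_def)
    moreover have "g n \<lfloor>real (Suc n) * s z\<rfloor> w = H w (q (u n))" for n
      using ex by (auto simp: g_def u_def)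
    ultimately show "(\<lambda>i. case x of (w, z) \<Rightarrow> g i \<lfloor>real (Suc i) * s z\<rfloor> w) \<longlonglongrightarrow> (case x of (w, z) \<Rightarrow> H w z)"
      using x qs by simp
  qed
qed

text \<open>On the parameter set continuity is sequential, which is what makes dominated convergence
  applicable.\<close>

lemma continuous_integral:
  fixes H :: "'w \<Rightarrow> 'y \<Rightarrow> real"
  assumes m: "\<And>z. z \<in> topspace T \<Longrightarrow> (\<lambda>w. H w z) \<in> borel_measurable M"
    and c: "\<And>w. w \<in> space M \<Longrightarrow> continuous_map T euclideanreal (H w)"
    and D: "integrable M D" "\<And>w z. w \<in> space M \<Longrightarrow> z \<in> topspace T \<Longrightarrow> \<bar>H w z\<bar> \<le> D w"
  shows "continuous_map T euclideanreal (\<lambda>z. \<integral>w. H w z \<partial>M)"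
proof (rule continuous_mapI)
  have "continuous_on C (\<lambda>t. \<integral>w. H w (q t) \<partial>M)"
    unfolding continuous_on_sequentially o_def
  proof safe
    fix x a assume xa: "a \<in> C" "\<forall>n. x n \<in> C" "x \<longlonglongrightarrow> a"
    show "(\<lambda>n. \<integral>w. H w (q (x n)) \<partial>M) \<longlonglongrightarrow> (\<integral>w. H w (q a) \<partial>M)"
    proof (rule integral_dominated_convergence[where w=D])
      show "AE w in M. (\<lambda>i. H w (q (x i))) \<longlonglongrightarrow> H w (q a)"
      proof (rule AE_I2)
        fix w assume "w \<in> space M"
        then have "continuous_on C (\<lambda>t. H w (q t))" using c continuous_comp_q by auto
        then show "(\<lambda>i. H w (q (x i))) \<longlonglongrightarrow> H w (q a)"
          by (rule continuous_on_tendsto_compose) (use xa in auto)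
      qed
      show "(\<lambda>w. H w (q a)) \<in> borel_measurable M" "(\<lambda>w. H w (q (x i))) \<in> borel_measurable M" for i
        using m[OF q_in] xa by blast+
      show "integrable M D" by fact
      show "AE w in M. norm (H w (q (x i))) \<le> D w" for i
        using D(2) q_in xa by (intro AE_I2) simp
    qed
  qed
  then show "continuous_map (top_of_set C) euclideanreal (\<lambda>t. \<integral>w. H w (q t) \<partial>M)" by simp
qed

text \<open>The measures are carried to the line by a measurable section, Helly's theorem gives a
  limit there, and \<open>q\<close> carries it back. The section is not continuous, but this does no
  harm: a test function is composed as \<open>h \<circ> q \<circ> s\<close>, which is
  \<open>h\<close>, and only \<open>h \<circ> q\<close> has to be extended continuously to the
  line.\<close>

lemma weak_compactness:
  assumes nu: "\<And>n. prob_space (\<nu> n)" "\<And>n. sets (\<nu> n) = sets (borel_top T)"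
  obtains r N where "strict_mono (r :: nat \<Rightarrow> nat)" "prob_space N" "sets N = sets (borel_top T)"
    "\<And>h. continuous_map T euclideanreal h \<Longrightarrow> (\<lambda>n. \<integral>z. h z \<partial>\<nu> (r n)) \<longlonglongrightarrow> (\<integral>z. h z \<partial>N)"
proof -
  obtain s where s[measurable]: "s \<in> borel_measurable (borel_top T)" and
    sC: "\<And>z. z \<in> topspace T \<Longrightarrow> s z \<in> C" and qs: "\<And>z. z \<in> topspace T \<Longrightarrow> q (s z) = z"
    using measurable_section by blast
  have sn[measurable]: "s \<in> borel_measurable (\<nu> n)" for n
    using s by (simp cong: measurable_cong_sets add: nu(2))
  have sp: "space (\<nu> n) = topspace T" for n using sets_eq_imp_space_eq[OF nu(2)] by simp
  define m where "m n = distr (\<nu> n) borel s" for n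
  have rd: "real_distribution (m n)" for n
    unfolding m_def using nu(1) sn by (intro prob_space.real_distribution_distr)
  obtain B where B: "B > 0" "\<And>t. t \<in> C \<Longrightarrow> \<bar>t\<bar> \<le> B"
    using compact_imp_bounded[OF compact_C] by (auto simp: bounded_pos)
  \<comment> \<open>Tightness asks for intervals open on the left, so the left end is lowered by one
    to keep a possible point \<open>- B\<close> inside.\<close>
  have mC: "measure (m n) {- B - 1<..B} = 1" for n
  proof -
    interpret prob_space "\<nu> n" by fact
    have "s -` {- B - 1<..B} \<inter> space (\<nu> n) = space (\<nu> n)"
      using B sC sp by (force simp: abs_le_iff)
    then show ?thesis unfolding m_def by (subst measure_distr) (auto simp: prob_space)
  qed
  have "tight m"
    unfolding tight_def
  proof (intro conjI allI impI rd)
    fix \<epsilon> :: real assume "\<epsilon> > 0"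
    then show "\<exists>a b. a < b \<and> (\<forall>n. 1 - \<epsilon> < measure (m n) {a<..b})"
      using mC B by (intro exI[of _ "- B - 1"] exI[of _ B]) auto
  qed
  then obtain r M where r: "strict_mono (r :: nat \<Rightarrow> nat)" and M: "real_distribution M"
    and conv: "weak_conv_m (m \<circ> id \<circ> r) M"
    using tight_imp_convergent_subsubsequence[of m id] by (auto simp: strict_mono_id)
  interpret M: real_distribution M by fact
  have lim: "(\<lambda>n. \<integral>t. k t \<partial>m (r n)) \<longlonglongrightarrow> (\<integral>t. k t \<partial>M)"
    if "continuous_on UNIV k" "\<And>x. \<bar>k x\<bar> \<le> b" for k :: "real \<Rightarrow> real" and b
    using weak_conv_imp_integral_bdd_continuous_conv[of "\<lambda>n. m (r n)" M k b] rd M conv that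
    by (auto simp: o_def continuous_on_eq_continuous_at)
  have ne: "C \<noteq> {}"
  proof -
    interpret prob_space "\<nu> 0" by fact
    show ?thesis using not_empty sp[of 0] surj_q by (metis image_empty)
  qed
  have closedC: "closed C" using compact_C by (rule compact_imp_closed)
  have "AE t in M. t \<in> C"
  proof -
    \<comment> \<open>A bounded continuous function that vanishes exactly on \<open>C\<close>. Its
      integral is 0 along the sequence, hence also for the limit, which is therefore carried by
      \<open>C\<close>.\<close>
    let ?k = "\<lambda>t. min 1 (infdist t C)"
    have "(\<integral>t. ?k t \<partial>m n) = 0" for n
    proof -
      have "(\<integral>t. ?k t \<partial>m n) = (\<integral>z. ?k (s z) \<partial>\<nu> n)"
        unfolding m_def by (intro integral_distr) (auto intro!: borel_measurable_continuous_onI continuous_intros)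
      also have "\<dots> = (\<integral>z. 0 \<partial>\<nu> n)"
        using sC by (intro Bochner_Integration.integral_cong) (auto simp: sp)
      finally show ?thesis by simp
    qed
    moreover have "(\<lambda>n. \<integral>t. ?k t \<partial>m (r n)) \<longlonglongrightarrow> (\<integral>t. ?k t \<partial>M)"
      by (rule lim[of _ 1]) (auto intro!: continuous_intros simp: infdist_nonneg)
    ultimately have 0: "(\<integral>t. ?k t \<partial>M) = 0"
      by (simp add: LIMSEQ_const_iff)
    have [measurable]: "?k \<in> borel_measurable borel"
      by (auto intro!: borel_measurable_continuous_onI continuous_intros)
    have "integrable M ?k"
      by (rule M.integrable_const_bound[where B=1]) (auto simp: infdist_nonneg)
    then have "AE t in M. ?k t = 0"
      using 0 by (subst (asm) integral_nonneg_eq_0_iff_AE) (auto simp: infdist_nonneg)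
    then show ?thesis
    proof (rule AE_mp, intro AE_I2 impI)
      fix t assume "?k t = 0"
      then have "infdist t C = 0" by (auto simp: min_def split: if_splits)
      then show "t \<in> C" using closedC ne in_closed_iff_infdist_zero by blast
    qed
  qed
  obtain t0 where t0: "t0 \<in> C" using ne by auto
  \<comment> \<open>Outside of \<open>C\<close> the values of \<open>q\<close> are not controlled;
    redirecting them to \<open>q t0\<close> gives a measurable map on the whole line and changes it
    on an \<open>M\<close>-null set only.\<close>
  define q' where "q' t = q (if t \<in> C then t else t0)" for t
  have q'[measurable]: "q' \<in> borel \<rightarrow>\<^sub>M borel_top T"
    unfolding q'_def
  proof (rule measurable_q_comp)
    have [measurable]: "C \<in> sets borel" using closedC by auto
    show "(\<lambda>t. if t \<in> C then t else t0) \<in> borel_measurable borel" by measurable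
  qed (use t0 in auto)
  define N where "N = distr M (borel_top T) q'"
  show ?thesis
  proof (rule that[OF r])
    show "prob_space N" unfolding N_def by (intro M.prob_space_distr) auto
    show "sets N = sets (borel_top T)" by (simp add: N_def)
    fix h assume h: "continuous_map T euclideanreal h"
    note hm[measurable] = continuous_map_measurable_real[OF h]
    obtain b where b: "\<And>z. z \<in> topspace T \<Longrightarrow> \<bar>h z\<bar> \<le> b" using bounded_continuous[OF h] by blast
    obtain k :: "real \<Rightarrow> real" where k: "continuous_on UNIV k" "\<And>t. t \<in> C \<Longrightarrow> k t = h (q t)" "\<And>t. \<bar>k t\<bar> \<le> b"
    proof (rule Tietze[OF continuous_comp_q[OF h], of UNIV b])
      show "closedin (top_of_set UNIV) C" using closedC by simp
      show "0 \<le> b" using b[OF q_in[OF t0]] by linarith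
    qed (use b q_in in auto)
    have "(\<integral>z. h z \<partial>\<nu> n) = (\<integral>t. k t \<partial>m n)" for n
    proof -
      have "(\<integral>t. k t \<partial>m n) = (\<integral>z. k (s z) \<partial>\<nu> n)"
        unfolding m_def using k by (intro integral_distr) (auto intro!: borel_measurable_continuous_onI)
      also have "\<dots> = (\<integral>z. h z \<partial>\<nu> n)"
        using sC k qs by (intro Bochner_Integration.integral_cong) (auto simp: sp)
      finally show ?thesis by simp
    qed
    moreover have "(\<integral>z. h z \<partial>N) = (\<integral>t. k t \<partial>M)"
    proof -
      have "(\<integral>z. h z \<partial>N) = (\<integral>t. h (q' t) \<partial>M)"
        unfolding N_def by (intro integral_distr) auto
      also have "\<dots> = (\<integral>t. k t \<partial>M)"
      proof (rule integral_cong_AE)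
        show "(\<lambda>t. h (q' t)) \<in> borel_measurable M" by measurable
        show "k \<in> borel_measurable M" using k(1) by (simp add: borel_measurable_continuous_onI)
        show "AE t in M. h (q' t) = k t"
          using \<open>AE t in M. t \<in> C\<close> by eventually_elim (auto simp: q'_def k)
      qed
      finally show ?thesis .
    qed
    ultimately show "(\<lambda>n. \<integral>z. h z \<partial>\<nu> (r n)) \<longlonglongrightarrow> (\<integral>z. h z \<partial>N)"
      using lim[OF k(1,3)] by simp
  qed
qed

end


section \<open>Random maps of a compact space\<close>

text \<open>The maps depend on one coordinate \<open>t\<close> and are continuous for every
  \<open>t\<close>, not merely almost every one: the given random map is altered on a null set
  before it is put in.\<close>

locale random_map = real_param T C q + prob_space p
  for T :: "'y topology" and C q and p :: "'t measure" +
  fixes G :: "'t \<Rightarrow> 'y \<Rightarrow> 'y"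
  assumes cont_G: "t \<in> space p \<Longrightarrow> continuous_map T T (G t)"
    and meas_G: "z \<in> topspace T \<Longrightarrow> (\<lambda>t. G t z) \<in> p \<rightarrow>\<^sub>M borel_top T"
begin

sublocale seq: sequence_space p
  by unfold_locales

abbreviation W :: "(nat \<Rightarrow> 't) measure" where "W \<equiv> PiM UNIV (\<lambda>_. p)"

lemma G_in: "t \<in> space p \<Longrightarrow> z \<in> topspace T \<Longrightarrow> G t z \<in> topspace T"
  using continuous_map_funspace[OF cont_G] by blast

text \<open>The Caratheodory argument concerns real functions; composing with continuous test
  functions transfers it to a map into the space itself.\<close>

lemma G_joint [measurable]: "(\<lambda>x. G (fst x) (snd x)) \<in> p \<Otimes>\<^sub>M borel_top T \<rightarrow>\<^sub>M borel_top T"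
proof (rule measurable_via_continuous)
  show "(\<lambda>x. G (fst x) (snd x)) \<in> space (p \<Otimes>\<^sub>M borel_top T) \<rightarrow> topspace T"
    using G_in by (auto simp: space_pair_measure)
  fix h assume h: "continuous_map T euclideanreal h"
  have "(\<lambda>(t, z). h (G t z)) \<in> borel_measurable (p \<Otimes>\<^sub>M borel_top T)"
  proof (rule measurable_Caratheodory)
    show "(\<lambda>t. h (G t z)) \<in> borel_measurable p" if "z \<in> topspace T" for z
      using measurable_compose[OF meas_G[OF that] continuous_map_measurable_real[OF h]] .
    show "continuous_map T euclideanreal (\<lambda>z. h (G t z))" if "t \<in> space p" for t
      using continuous_map_compose[OF cont_G[OF that] h] by (simp add: o_def)
  qed
  then show "(\<lambda>x. h (G (fst x) (snd x))) \<in> borel_measurable (p \<Otimes>\<^sub>M borel_top T)"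
    by (simp add: case_prod_beta')
qed

definition Q :: "('y \<Rightarrow> real) \<Rightarrow> 'y \<Rightarrow> real" where
  "Q h z = (\<integral>t. h (G t z) \<partial>p)"

lemma h_G_measurable:
  assumes "continuous_map T euclideanreal h" "z \<in> topspace T"
  shows "(\<lambda>t. h (G t z)) \<in> borel_measurable p"
  using measurable_compose[OF meas_G continuous_map_measurable_real] assms by blast

lemma h_G_integrable:
  assumes "continuous_map T euclideanreal h" "z \<in> topspace T"
  shows "integrable p (\<lambda>t. h (G t z))"
proof -
  obtain B where "\<And>z. z \<in> topspace T \<Longrightarrow> \<bar>h z\<bar> \<le> B" using bounded_continuous[OF assms(1)] by blast
  then show ?thesis
    using assms by (intro integrable_const_bound[where B=B]) (auto intro!: h_G_measurable AE_I2 simp: G_in)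
qed

lemma Q_cont:
  assumes h: "continuous_map T euclideanreal h" shows "continuous_map T euclideanreal (Q h)"
proof -
  obtain B where B: "\<And>z. z \<in> topspace T \<Longrightarrow> \<bar>h z\<bar> \<le> B" using bounded_continuous[OF h] by blast
  have "continuous_map T euclideanreal (\<lambda>z. \<integral>t. h (G t z) \<partial>p)"
  proof (rule continuous_integral[where D="\<lambda>_. B"])
    show "continuous_map T euclideanreal (\<lambda>z. h (G t z))" if "t \<in> space p" for t
      using continuous_map_compose[OF cont_G[OF that] h] by (simp add: o_def)
  qed (use h B in \<open>auto intro: h_G_measurable G_in\<close>)
  then show ?thesis by (simp add: Q_def[abs_def])
qed

lemma Q_pow_cont: "continuous_map T euclideanreal h \<Longrightarrow> continuous_map T euclideanreal ((Q ^^ n) h)"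
  by (induction n) (auto intro: Q_cont)

lemma Q_mono:
  assumes "continuous_map T euclideanreal h" "continuous_map T euclideanreal k"
    and "\<And>z. z \<in> topspace T \<Longrightarrow> h z \<le> k z" and "z \<in> topspace T"
  shows "Q h z \<le> Q k z"
  unfolding Q_def using assms by (intro integral_mono h_G_integrable) (auto intro: G_in)

lemma Q_pow_mono:
  assumes "continuous_map T euclideanreal h" "continuous_map T euclideanreal k"
    and "\<And>z. z \<in> topspace T \<Longrightarrow> h z \<le> k z" and "z \<in> topspace T"
  shows "(Q ^^ n) h z \<le> (Q ^^ n) k z"
  using assms(4) by (induction n arbitrary: z) (use assms in \<open>auto intro!: Q_mono Q_pow_cont\<close>)

lemma Q_sum:
  assumes "\<And>i. i \<in> I \<Longrightarrow> continuous_map T euclideanreal (h i)" "z \<in> topspace T"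
  shows "Q (\<lambda>z. \<Sum>i\<in>I. h i z) z = (\<Sum>i\<in>I. Q (h i) z)"
  unfolding Q_def using assms by (intro Bochner_Integration.integral_sum h_G_integrable)

lemma Q_cong: "(\<And>z. z \<in> topspace T \<Longrightarrow> h z = k z) \<Longrightarrow> z \<in> topspace T \<Longrightarrow> Q h z = Q k z"
  unfolding Q_def by (intro Bochner_Integration.integral_cong) (auto intro: G_in)

lemma Q_pow_cong:
  "(\<And>z. z \<in> topspace T \<Longrightarrow> h z = k z) \<Longrightarrow> z \<in> topspace T \<Longrightarrow> (Q ^^ n) h z = (Q ^^ n) k z"
  by (induction n arbitrary: z) (auto intro!: Q_cong)

lemma Q_pow_sum:
  assumes "\<And>i. i \<in> I \<Longrightarrow> continuous_map T euclideanreal (h i)" "z \<in> topspace T"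
  shows "(Q ^^ n) (\<lambda>z. \<Sum>i\<in>I. h i z) z = (\<Sum>i\<in>I. (Q ^^ n) (h i) z)"
  using assms(2)
proof (induction n arbitrary: z)
  case (Suc n)
  have "(Q ^^ Suc n) (\<lambda>z. \<Sum>i\<in>I. h i z) z = Q (\<lambda>z. \<Sum>i\<in>I. (Q ^^ n) (h i) z) z"
    using Suc by (auto intro!: Q_cong)
  also have "\<dots> = (\<Sum>i\<in>I. (Q ^^ Suc n) (h i) z)"
    using Suc assms by (subst Q_sum) (auto intro!: Q_pow_cont)
  finally show ?case .
qed auto

section \<open>Iterates along a sequence of maps\<close>

primrec it :: "nat \<Rightarrow> (nat \<Rightarrow> 't) \<Rightarrow> 'y \<Rightarrow> 'y" where
  "it 0 w z = z"
| "it (Suc n) w z = G (w n) (it n w z)"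

text \<open>The recursion of \<open>it\<close> adds the last map; this one strips the first, which
  is the direction in which powers of \<open>Q\<close> and the decomposition of the product measure
  are unfolded.\<close>

lemma it_first: "it (Suc n) (case_nat t w) z = it n w (G t z)"
  by (induction n) auto

lemma it_add: "it (n + m) w z = it m (\<lambda>i. w (i + n)) (it n w z)"
  by (induction m) (auto simp: add.commute)

lemma W_comp: "w \<in> space W \<Longrightarrow> w n \<in> space p"
  by (auto simp: space_PiM PiE_def)

lemma it_cont: "w \<in> space W \<Longrightarrow> continuous_map T T (it n w)"
proof (induction n)
  case (Suc n)
  then show ?case
    using continuous_map_compose[OF _ cont_G[OF W_comp]] by (fastforce simp: o_def)
next
  case 0
  have "it 0 w = id" by auto
  then show ?case by simp
qed

lemma it_in: "w \<in> space W \<Longrightarrow> z \<in> topspace T \<Longrightarrow> it n w z \<in> topspace T"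
  using continuous_map_funspace[OF it_cont] by blast

lemma it_joint [measurable]: "(\<lambda>x. it n (fst x) (snd x)) \<in> W \<Otimes>\<^sub>M borel_top T \<rightarrow>\<^sub>M borel_top T"
proof (induction n)
  case (Suc n)
  have "(\<lambda>x. (fst x n, it n (fst x) (snd x))) \<in> W \<Otimes>\<^sub>M borel_top T \<rightarrow>\<^sub>M p \<Otimes>\<^sub>M borel_top T"
    by (intro measurable_Pair Suc) measurable
  from measurable_compose[OF this G_joint] show ?case by simp
qed auto

lemma shift_measurable [measurable]: "(\<lambda>w i. w (i + n)) \<in> W \<rightarrow>\<^sub>M W"
  by (rule measurable_PiM_single') (auto simp: space_PiM)

lemma distr_shift: "distr W W (\<lambda>w i. w (i + n)) = W"
  using distr_PiM_reindex[of UNIV "\<lambda>_. p" "\<lambda>i. i + n" UNIV] prob_space_axioms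
  by (simp add: restrict_def)

lemma integrable_shift:
  fixes D :: "(nat \<Rightarrow> 't) \<Rightarrow> real"
  assumes "integrable W D" shows "integrable W (\<lambda>w. D (\<lambda>i. w (i + n)))"
  using integrable_distr[OF shift_measurable, of n D] assms by (simp add: distr_shift)

lemma integrable_comp:
  fixes D :: "'t \<Rightarrow> real"
  assumes "integrable p D" shows "integrable W (\<lambda>w. D (w n))"
proof -
  have "distr W p (\<lambda>w. w n) = p"
    using distr_PiM_component[of UNIV "\<lambda>_. p" n] prob_space_axioms by simp
  then show ?thesis
    using integrable_distr[of "\<lambda>w. w n" W p D] assms by simp
qed

lemma integral_comp:
  fixes D :: "'t \<Rightarrow> real"
  assumes "D \<in> borel_measurable p" shows "(\<integral>w. D (w n) \<partial>W) = (\<integral>t. D t \<partial>p)"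
proof -
  have "(\<integral>t. D t \<partial>p) = (\<integral>t. D t \<partial>distr W p (\<lambda>w. w n))"
    by (subst distr_PiM_component) (auto intro: prob_space_axioms)
  also have "\<dots> = (\<integral>w. D (w n) \<partial>W)" using assms by (intro integral_distr) auto
  finally show ?thesis by simp
qed

lemma integral_first:
  fixes k :: "(nat \<Rightarrow> 't) \<Rightarrow> real"
  assumes "integrable W k"
  shows "(\<integral>w. k w \<partial>W) = (\<integral>t. (\<integral>w. k (case_nat t w) \<partial>W) \<partial>p)"
proof -
  interpret pair_prob_space p W ..
  have "integrable (p \<Otimes>\<^sub>M W) (\<lambda>x. k (case_nat (fst x) (snd x)))"
    using assms by (subst (asm) seq.PiM_iter[symmetric], subst (asm) integrable_distr_eq) (auto simp: case_prod_beta')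
  then have "(\<integral>t. (\<integral>w. k (case_nat t w) \<partial>W) \<partial>p) = (\<integral>x. k (case_nat (fst x) (snd x)) \<partial>(p \<Otimes>\<^sub>M W))"
    by (subst integral_fst'[symmetric]) auto
  also have "\<dots> = (\<integral>w. k w \<partial>distr (p \<Otimes>\<^sub>M W) W (\<lambda>(t, w). case_nat t w))"
    using assms by (subst integral_distr) (auto simp: case_prod_beta')
  finally show ?thesis by (simp add: seq.PiM_iter)
qed

text \<open>The Markov property: the sequence shifted by \<open>n\<close> is independent of the
  first \<open>n\<close> maps and has the law of the whole sequence. The induction strips one
  coordinate at a time, which turns into one factor \<open>Q\<close>.\<close>

lemma law_it:
  assumes m: "\<And>z. z \<in> topspace T \<Longrightarrow> (\<lambda>w. H w z) \<in> borel_measurable W"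
    and c: "\<And>w. w \<in> space W \<Longrightarrow> continuous_map T euclideanreal (H w)"
    and D: "integrable W D" "\<And>w z. w \<in> space W \<Longrightarrow> z \<in> topspace T \<Longrightarrow> \<bar>H w z\<bar> \<le> D w"
    and z: "z \<in> topspace T"
  shows "integrable W (\<lambda>w. H (\<lambda>i. w (i + n)) (it n w z))"
    and "(\<integral>w. H (\<lambda>i. w (i + n)) (it n w z) \<partial>W) = (Q ^^ n) (\<lambda>z. \<integral>w. H w z \<partial>W) z"
proof -
  have joint: "(\<lambda>x. H (fst x) (snd x)) \<in> borel_measurable (W \<Otimes>\<^sub>M borel_top T)"
    using measurable_Caratheodory[of H W, OF m c] by (simp add: case_prod_beta')
  have int: "integrable W (\<lambda>w. H (\<lambda>i. w (i + n)) (it n w z))" if z: "z \<in> topspace T" for n z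
  proof (rule Bochner_Integration.integrable_bound[OF integrable_shift[OF D(1), of n]])
    have "(\<lambda>w. (w, z)) \<in> W \<rightarrow>\<^sub>M W \<Otimes>\<^sub>M borel_top T" using z by (intro measurable_Pair) auto
    from measurable_compose[OF this it_joint[of n]]
    have "(\<lambda>w. it n w z) \<in> W \<rightarrow>\<^sub>M borel_top T" by simp
    then have "(\<lambda>w. (\<lambda>i. w (i + n), it n w z)) \<in> W \<rightarrow>\<^sub>M W \<Otimes>\<^sub>M borel_top T"
      by (intro measurable_Pair shift_measurable)
    from measurable_compose[OF this joint]
    show "(\<lambda>w. H (\<lambda>i. w (i + n)) (it n w z)) \<in> borel_measurable W" by simp
    show "AE w in W. norm (H (\<lambda>i. w (i + n)) (it n w z)) \<le> norm (D (\<lambda>i. w (i + n)))"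
    proof (rule AE_I2)
      fix w assume w: "w \<in> space W"
      have "(\<lambda>i. w (i + n)) \<in> space W" using measurable_space[OF shift_measurable w] .
      then show "norm (H (\<lambda>i. w (i + n)) (it n w z)) \<le> norm (D (\<lambda>i. w (i + n)))"
        using D(2)[OF _ it_in[OF w z]] by (metis abs_ge_self order_trans real_norm_def)
    qed
  qed
  show "integrable W (\<lambda>w. H (\<lambda>i. w (i + n)) (it n w z))" using int z .
  show "(\<integral>w. H (\<lambda>i. w (i + n)) (it n w z) \<partial>W) = (Q ^^ n) (\<lambda>z. \<integral>w. H w z \<partial>W) z"
    using z
  proof (induction n arbitrary: z)
    case (Suc n)
    have "(\<integral>w. H (\<lambda>i. w (i + Suc n)) (it (Suc n) w z) \<partial>W) =
        (\<integral>t. (\<integral>w. H (\<lambda>i. w (i + n)) (it n w (G t z)) \<partial>W) \<partial>p)"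
      by (subst integral_first[OF int[OF Suc.prems]]) (simp only: it_first add_Suc_right nat.case)
    also have "\<dots> = (\<integral>t. (Q ^^ n) (\<lambda>z. \<integral>w. H w z \<partial>W) (G t z) \<partial>p)"
      using Suc by (intro Bochner_Integration.integral_cong) (auto intro: G_in)
    finally show ?case by (simp add: Q_def[of "(Q ^^ n) k" for k])
  qed auto
qed

lemma law_it_const:
  assumes h: "continuous_map T euclideanreal h" and z: "z \<in> topspace T"
  shows "(\<integral>w. h (it n w z) \<partial>W) = (Q ^^ n) h z"
proof -
  obtain B where "\<And>z. z \<in> topspace T \<Longrightarrow> \<bar>h z\<bar> \<le> B" using bounded_continuous[OF h] by blast
  then have "(\<integral>w. h (it n w z) \<partial>W) = (Q ^^ n) (\<lambda>z. \<integral>w. h z \<partial>W) z"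
    using law_it(2)[of "\<lambda>w z. h z" "\<lambda>_. B" z n] h z by auto
  then show ?thesis by (simp add: seq.P.prob_space)
qed

text \<open>Stationarity with the integral taken over the one coordinate that matters;
  \<open>stationary_measures_iff\<close> identifies it with the given notion.\<close>

definition stat :: "'y measure \<Rightarrow> bool" where
  "stat \<mu> \<longleftrightarrow> prob_space \<mu> \<and> sets \<mu> = sets (borel_top T) \<and>
     (\<forall>B\<in>sets (borel_top T). emeasure \<mu> B = (\<integral>\<^sup>+t. emeasure \<mu> (G t -` B \<inter> topspace T) \<partial>p))"

text \<open>Both sides express that \<open>\<mu>\<close> equals the law \<open>\<nu>\<close> of
  \<open>G t z\<close> for independent \<open>t\<close> and \<open>z\<close>: one tests this on
  measurable sets, the other on continuous functions, which determine a finite measure. The second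
  form survives weak limits.\<close>

lemma stat_iff:
  assumes "prob_space \<mu>" "sets \<mu> = sets (borel_top T)"
  shows "stat \<mu> \<longleftrightarrow> (\<forall>h. continuous_map T euclideanreal h \<longrightarrow> (\<integral>z. Q h z \<partial>\<mu>) = (\<integral>z. h z \<partial>\<mu>))"
proof -
  interpret mu: prob_space \<mu> by fact
  interpret pp: pair_prob_space p \<mu> ..
  interpret pp': pair_prob_space \<mu> p ..
  note sm[measurable_cong] = assms(2)
  have sp: "space \<mu> = topspace T" using sets_eq_imp_space_eq[OF assms(2)] by simp
  define \<nu> where "\<nu> = distr (p \<Otimes>\<^sub>M \<mu>) (borel_top T) (\<lambda>x. G (fst x) (snd x))"
  have mG[measurable]: "(\<lambda>x. G (fst x) (snd x)) \<in> p \<Otimes>\<^sub>M \<mu> \<rightarrow>\<^sub>M borel_top T"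
    using G_joint by (simp cong: measurable_cong_sets)
  have pn: "prob_space \<nu>" unfolding \<nu>_def by (intro pp.prob_space_distr) auto
  have em: "emeasure \<nu> B = (\<integral>\<^sup>+t. emeasure \<mu> (G t -` B \<inter> topspace T) \<partial>p)" if B: "B \<in> sets (borel_top T)" for B
  proof -
    have "emeasure \<nu> B = emeasure (p \<Otimes>\<^sub>M \<mu>) ((\<lambda>x. G (fst x) (snd x)) -` B \<inter> space (p \<Otimes>\<^sub>M \<mu>))"
      unfolding \<nu>_def using B by (intro emeasure_distr) auto
    also have "\<dots> = (\<integral>\<^sup>+t. emeasure \<mu> (Pair t -` ((\<lambda>x. G (fst x) (snd x)) -` B \<inter> space (p \<Otimes>\<^sub>M \<mu>))) \<partial>p)"
      using B by (intro mu.emeasure_pair_measure_alt) (auto intro: measurable_sets[OF mG])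
    also have "\<dots> = (\<integral>\<^sup>+t. emeasure \<mu> (G t -` B \<inter> topspace T) \<partial>p)"
      by (intro nn_integral_cong arg_cong[where f="emeasure \<mu>"]) (auto simp: space_pair_measure sp)
    finally show ?thesis .
  qed
  have intQ: "(\<integral>z. h z \<partial>\<nu>) = (\<integral>z. Q h z \<partial>\<mu>)" if h: "continuous_map T euclideanreal h" for h
  proof -
    note [measurable] = continuous_map_measurable_real[OF h]
    obtain B where B: "\<And>z. z \<in> topspace T \<Longrightarrow> \<bar>h z\<bar> \<le> B" using bounded_continuous[OF h] by blast
    have i: "integrable (p \<Otimes>\<^sub>M \<mu>) (\<lambda>x. h (G (fst x) (snd x)))"
      by (rule pp.integrable_const_bound[where B=B]) (use B in \<open>auto intro!: AE_I2 simp: space_pair_measure sp G_in\<close>)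
    have "(\<integral>z. h z \<partial>\<nu>) = (\<integral>x. h (G (fst x) (snd x)) \<partial>(p \<Otimes>\<^sub>M \<mu>))"
      unfolding \<nu>_def by (intro integral_distr) auto
    also have "\<dots> = (\<integral>z. (\<integral>t. h (G t z) \<partial>p) \<partial>\<mu>)"
      using pp.integral_snd[of "\<lambda>t z. h (G t z)"] i by (simp add: case_prod_beta')
    finally show ?thesis by (simp add: Q_def)
  qed
  have "stat \<mu> \<longleftrightarrow> \<mu> = \<nu>"
  proof
    assume "stat \<mu>"
    then show "\<mu> = \<nu>"
      by (intro measure_eqI) (simp_all add: em stat_def, simp_all add: \<nu>_def)
  next
    assume "\<mu> = \<nu>"
    then show "stat \<mu>" using em assms by (simp add: stat_def)
  qed
  also have "\<dots> \<longleftrightarrow> (\<forall>h. continuous_map T euclideanreal h \<longrightarrow> (\<integral>z. Q h z \<partial>\<mu>) = (\<integral>z. h z \<partial>\<mu>))"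
  proof
    assume "\<mu> = \<nu>" then show "\<forall>h. continuous_map T euclideanreal h \<longrightarrow> (\<integral>z. Q h z \<partial>\<mu>) = (\<integral>z. h z \<partial>\<mu>)"
      using intQ by metis
  next
    assume "\<forall>h. continuous_map T euclideanreal h \<longrightarrow> (\<integral>z. Q h z \<partial>\<mu>) = (\<integral>z. h z \<partial>\<mu>)"
    then show "\<mu> = \<nu>"
      using assms pn intQ
      by (intro measure_eqI_continuous) (auto intro: prob_space.finite_measure simp: \<nu>_def)
  qed
  finally show ?thesis .
qed

lemma stat_Q_pow:
  assumes "stat \<mu>" "continuous_map T euclideanreal h"
  shows "(\<integral>z. (Q ^^ n) h z \<partial>\<mu>) = (\<integral>z. h z \<partial>\<mu>)"
  using assms stat_iff[of \<mu>] by (induction n) (auto simp: stat_def Q_pow_cont)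

end


section \<open>Cocycles over a fibred random map\<close>

text \<open>Fekete's lemma. The linear lower bound keeps the infimum of \<open>a n / n\<close>
  finite, and that the limit is this infimum gives the bound for each single
  \<open>n\<close>.\<close>

lemma subadditive_limit:
  fixes a :: "nat \<Rightarrow> real"
  assumes sub: "\<And>m n. a (m + n) \<le> a m + a n" and lower: "\<And>n. - c * n \<le> a n"
  obtains l where "(\<lambda>n. 1 / real n * a n) \<longlonglongrightarrow> l" "\<And>n. n > 0 \<Longrightarrow> l \<le> a n / n"
proof -
  define R where "R = (\<lambda>n. a n / n) ` {0<..}"
  define l where "l = Inf R"
  have bdd: "bdd_below R"
    unfolding R_def by (rule bdd_belowI2[of _ "- c"]) (use lower in \<open>auto simp: field_simps\<close>)
  have le: "l \<le> a n / n" if "n > 0" for n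
    unfolding l_def using bdd that by (intro cInf_lower) (auto simp: R_def)
  have mult: "a (k * N + r) \<le> k * a N + a r" for k N r
  proof (induction k)
    case (Suc k)
    have "a (Suc k * N + r) \<le> a N + a (k * N + r)"
      using sub[of N "k * N + r"] by (simp add: add.assoc)
    then show ?case using Suc by (simp add: algebra_simps)
  qed simp
  have up: "\<forall>\<^sub>F n in sequentially. 1 / real n * a n < l + e" if "e > 0" for e
  proof -
    have "R \<noteq> {}" by (auto simp: R_def)
    moreover have "Inf R < l + e / 2" using that by (simp add: l_def)
    ultimately obtain y where "y \<in> R" "y < l + e / 2"
      using cInf_lessD by blast
    then obtain N where N: "N > 0" "a N / N < l + e / 2"
      by (auto simp: R_def)
    define A where "A = a N / N"
    define M where "M = Max (a ` {..<N})"
    have M: "a r \<le> M" if "r < N" for r unfolding M_def using that by (intro Max_ge) auto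
    \<comment> \<open>Division of n by N with remainder r: the missing part r A costs at most N
      times the absolute value of A, and \<open>a r\<close> is bounded by the maximum
      \<open>M\<close> over finitely many remainders. Both errors disappear after division by
      n.\<close>
    have bound: "1 / real n * a n \<le> A + (N * \<bar>A\<bar> + M) * (1 / real n)" if "n > 0" for n
    proof -
      define k r where "k = n div N" and "r = n mod N"
      have n: "n = k * N + r" "r < N" using N by (auto simp: k_def r_def)
      have "a n \<le> k * a N + a r" using mult n by metis
      also have "real k * a N = (real n - r) * A"
        using N n(1) by (simp add: A_def)
      also have "\<dots> + a r \<le> n * A + (N * \<bar>A\<bar> + M)"
      proof -
        have "- (real r * A) \<le> real N * \<bar>A\<bar>"
        proof -
          have "- (real r * A) \<le> real r * \<bar>A\<bar>"
            by (metis abs_ge_minus_self abs_mult abs_of_nat)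
          also have "\<dots> \<le> real N * \<bar>A\<bar>" using n by (intro mult_right_mono) auto
          finally show ?thesis .
        qed
        then show ?thesis using M[OF n(2)] by (simp add: left_diff_distrib)
      qed
      finally show ?thesis using that by (simp add: field_simps)
    qed
    have "(\<lambda>n. A + (N * \<bar>A\<bar> + M) * (1 / real n)) \<longlonglongrightarrow> A + (N * \<bar>A\<bar> + M) * 0"
      by (intro tendsto_intros lim_1_over_n)
    moreover have "A + (N * \<bar>A\<bar> + M) * 0 < l + e" using N that by (simp add: A_def)
    ultimately have "\<forall>\<^sub>F n in sequentially. A + (N * \<bar>A\<bar> + M) * (1 / real n) < l + e"
      by (rule order_tendstoD)
    with eventually_gt_at_top[of 0] show ?thesis
      by eventually_elim (use bound le_less_trans in blast)
  qed
  have "(\<lambda>n. 1 / real n * a n) \<longlonglongrightarrow> l"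
  proof (rule order_tendstoI)
    fix x assume "x < l"
    show "\<forall>\<^sub>F n in sequentially. x < 1 / real n * a n"
      using eventually_gt_at_top[of 0]
    proof eventually_elim
      case (elim n)
      then show ?case using le[of n] \<open>x < l\<close> by simp
    qed
  next
    fix x assume "l < x"
    then show "\<forall>\<^sub>F n in sequentially. 1 / real n * a n < x" using up[of "x - l"] by simp
  qed
  then show ?thesis using that le by blast
qed

text \<open>By continuity the supremum over \<open>K\<close> can be compared with \<open>a\<close>
  on a countable dense subset.\<close>

lemma (in real_param) measurable_SUP:
  fixes H :: "'w \<Rightarrow> 'y \<Rightarrow> real"
  assumes K: "compact K" "K \<subseteq> C" "K \<noteq> {}"
    and m: "\<And>z. z \<in> topspace T \<Longrightarrow> (\<lambda>w. H w z) \<in> borel_measurable M"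
    and c: "\<And>w. w \<in> space M \<Longrightarrow> continuous_map T euclideanreal (H w)"
  shows "(\<lambda>w. SUP t\<in>K. H w (q t)) \<in> borel_measurable M"
proof (rule borel_measurableI_le)
  fix a
  obtain D where D: "countable D" "D \<subseteq> K" "K \<subseteq> closure D" using separable by blast
  have "(SUP t\<in>K. H w (q t)) \<le> a \<longleftrightarrow> (\<forall>d\<in>D. H w (q d) \<le> a)" if w: "w \<in> space M" for w
  proof
    have cK: "continuous_on K (\<lambda>t. H w (q t))"
      using continuous_comp_q[OF c[OF w]] K(2) continuous_on_subset by blast
    have bdd: "bdd_above ((\<lambda>t. H w (q t)) ` K)"
      by (intro bounded_imp_bdd_above compact_imp_bounded compact_continuous_image cK K)
    show "\<forall>d\<in>D. H w (q d) \<le> a" if "(SUP t\<in>K. H w (q t)) \<le> a"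
      using that bdd K D by (metis cSUP_le_iff subsetD)
    assume d: "\<forall>d\<in>D. H w (q d) \<le> a"
    have "closure D \<subseteq> K" using D K by (simp add: closure_minimal compact_imp_closed)
    then have "H w (q t) \<le> a" if "t \<in> K" for t
      using continuous_le_on_closure[of D "\<lambda>t. H w (q t)" t a] cK D d that
      by (metis (no_types, lifting) continuous_on_subset subsetD)
    then show "(SUP t\<in>K. H w (q t)) \<le> a" using K by (intro cSUP_least) auto
  qed
  then have "{w \<in> space M. (SUP t\<in>K. H w (q t)) \<le> a} = {w \<in> space M. \<forall>d\<in>D. H w (q d) \<le> a}" by auto
  also have "\<dots> \<in> sets M"
  proof -
    have [measurable]: "(\<lambda>w. H w (q d)) \<in> borel_measurable M" if "d \<in> D" for d
      using that D K by (intro m q_in) auto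
    have "D \<noteq> {}" using D K by auto
    then have "{w \<in> space M. \<forall>d\<in>D. H w (q d) \<le> a} = (\<Inter>d\<in>D. {w \<in> space M. H w (q d) \<le> a})" by auto
    also have "\<dots> \<in> sets M" using D(1) \<open>D \<noteq> {}\<close> by (intro sets.countable_INT') auto
    finally show ?thesis .
  qed
  finally show "{w \<in> space M. (SUP t\<in>K. H w (q t)) \<le> a} \<in> sets M" .
qed

text \<open>The abstract shape of a derivative cocycle: \<open>TY\<close> is the space of
  directions, \<open>TX\<close> the base, \<open>ph t\<close> the logarithmic growth of a direction
  under one step. Openness of \<open>pr\<close> expresses that a direction can be followed to all
  nearby base points; it is what makes fibrewise maxima lower semicontinuous.\<close>

locale random_system = Y: random_map TY C q p G
  for TY :: "'y topology" and C q and p :: "'t measure" and G +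
  fixes TX :: "'x topology" and pr :: "'y \<Rightarrow> 'x" and F :: "'t \<Rightarrow> 'x \<Rightarrow> 'x"
    and ph :: "'t \<Rightarrow> 'y \<Rightarrow> real" and L :: "'t \<Rightarrow> real"
  assumes Hausdorff_X: "Hausdorff_space TX"
    and cont_pr: "continuous_map TY TX pr" and open_pr: "open_map TY TX pr"
    and surj_pr: "pr ` topspace TY = topspace TX"
    and equiv: "t \<in> space p \<Longrightarrow> z \<in> topspace TY \<Longrightarrow> pr (G t z) = F t (pr z)"
    and cont_ph: "t \<in> space p \<Longrightarrow> continuous_map TY euclideanreal (ph t)"
    and meas_ph: "z \<in> topspace TY \<Longrightarrow> (\<lambda>t. ph t z) \<in> borel_measurable p"
    and ph_bound: "t \<in> space p \<Longrightarrow> z \<in> topspace TY \<Longrightarrow> \<bar>ph t z\<bar> \<le> L t"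
    and int_L: "integrable p L"
begin

lemma real_param_X: "real_param TX C (\<lambda>t. pr (q t))"
proof
  show "continuous_map (top_of_set C) TX (\<lambda>t. pr (q t))"
    using continuous_map_compose[OF Y.cont_q cont_pr] by (simp add: o_def)
  show "(\<lambda>t. pr (q t)) ` C = topspace TX"
    using Y.surj_q surj_pr by (simp flip: image_image)
qed (use Hausdorff_X Y.compact_C in auto)

lemma fiber_nonempty: "x \<in> topspace TX \<Longrightarrow> \<exists>z\<in>topspace TY. pr z = x"
  using surj_pr by (metis imageE)

lemma pr_in: "z \<in> topspace TY \<Longrightarrow> pr z \<in> topspace TX"
  using surj_pr by auto

text \<open>The base inherits its structure from the total space: \<open>pr \<circ> q\<close>
  parametrizes it by the same set \<open>C\<close>, continuity of \<open>F t\<close> descends along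
  this quotient map, and measurability is read off at any point of the fibre.\<close>

sublocale X: random_map TX C "\<lambda>t. pr (q t)" p F
proof -
  interpret X: real_param TX C "\<lambda>t. pr (q t)" by (rule real_param_X)
  show "random_map TX C (\<lambda>t. pr (q t)) p F"
  proof
    fix t assume t: "t \<in> space p"
    show "continuous_map TX TX (F t)"
    proof (rule X.continuous_mapI)
      have "continuous_map (top_of_set C) TX (\<lambda>s. pr (G t (q s)))"
        using continuous_map_compose[OF Y.cont_q continuous_map_compose[OF Y.cont_G[OF t] cont_pr]]
        by (simp add: o_def)
      then show "continuous_map (top_of_set C) TX (\<lambda>s. F t (pr (q s)))"
        by (rule continuous_map_eq) (use t in \<open>auto simp: equiv Y.q_in\<close>)
    qed
  next
    fix x assume "x \<in> topspace TX"
    then obtain z where z: "z \<in> topspace TY" "x = pr z" using fiber_nonempty by blast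
    have "(\<lambda>t. pr (G t z)) \<in> p \<rightarrow>\<^sub>M borel_top TX"
      using measurable_compose[OF Y.meas_G[OF z(1)] continuous_map_measurable_top[OF cont_pr]] .
    then show "(\<lambda>t. F t x) \<in> p \<rightarrow>\<^sub>M borel_top TX"
      by (rule measurable_cong[THEN iffD1, rotated]) (simp add: z equiv)
  qed
qed

lemma pr_it: "w \<in> space Y.W \<Longrightarrow> z \<in> topspace TY \<Longrightarrow> pr (Y.it n w z) = X.it n w (pr z)"
  by (induction n) (auto simp: equiv Y.it_in Y.W_comp)

lemma cont_comp_pr: "continuous_map TX euclideanreal h \<Longrightarrow> continuous_map TY euclideanreal (\<lambda>z. h (pr z))"
  using continuous_map_compose[OF cont_pr] by (auto simp: o_def)

lemma Q_pow_pr: "z \<in> topspace TY \<Longrightarrow> (Y.Q ^^ n) (\<lambda>z. h (pr z)) z = (X.Q ^^ n) h (pr z)"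
proof (induction n arbitrary: z)
  case (Suc n)
  then have "(Y.Q ^^ Suc n) (\<lambda>z. h (pr z)) z = (\<integral>t. (X.Q ^^ n) h (pr (G t z)) \<partial>p)"
    by (simp, subst Y.Q_def) (intro Bochner_Integration.integral_cong, auto simp: Y.G_in)
  also have "\<dots> = (\<integral>t. (X.Q ^^ n) h (F t (pr z)) \<partial>p)"
    using Suc by (intro Bochner_Integration.integral_cong) (auto simp: equiv)
  finally show ?case by (simp add: X.Q_def[of "(X.Q ^^ n) h"])
qed auto

section \<open>Maxima over fibres\<close>

definition fmax :: "('y \<Rightarrow> real) \<Rightarrow> 'x \<Rightarrow> real" where
  "fmax h x = Sup (h ` {z \<in> topspace TY. pr z = x})"

lemma fiber_eq: "x \<in> topspace TX \<Longrightarrow> {z \<in> topspace TY. pr z = x} = q ` {t \<in> C. pr (q t) = x}"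
  using Y.surj_q by (auto simp: Y.q_in image_iff)

lemma compact_fiber: "x \<in> topspace TX \<Longrightarrow> compact {t \<in> C. pr (q t) = x} \<and> {t \<in> C. pr (q t) = x} \<noteq> {}"
  using X.compact_preimage[of "{x}"] Hausdorff_X fiber_eq[of x] fiber_nonempty[of x]
  by (auto simp: closedin_Hausdorff_singleton)

lemma fmax_attained:
  assumes h: "continuous_map TY euclideanreal h" and x: "x \<in> topspace TX"
  obtains z where "z \<in> topspace TY" "pr z = x" "fmax h x = h z"
    "\<And>z'. z' \<in> topspace TY \<Longrightarrow> pr z' = x \<Longrightarrow> h z' \<le> h z"
proof -
  let ?K = "{t \<in> C. pr (q t) = x}"
  have "continuous_on ?K (\<lambda>t. h (q t))"
    using Y.continuous_comp_q[OF h] by (rule continuous_on_subset) auto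
  then obtain t where t: "t \<in> ?K" "\<And>s. s \<in> ?K \<Longrightarrow> h (q s) \<le> h (q t)"
    using continuous_attains_sup[of ?K "\<lambda>t. h (q t)"] compact_fiber[OF x] by blast
  have le: "h z' \<le> h (q t)" if "z' \<in> {z \<in> topspace TY. pr z = x}" for z'
    using that t(2) unfolding fiber_eq[OF x] by auto
  have "fmax h x = h (q t)"
    unfolding fmax_def by (rule cSup_eq_maximum) (use t le Y.q_in in auto)
  then show ?thesis using that[of "q t"] t le Y.q_in by auto
qed

lemma fmax_ge: "continuous_map TY euclideanreal h \<Longrightarrow> z \<in> topspace TY \<Longrightarrow> h z \<le> fmax h (pr z)"
  by (metis fmax_attained pr_in)

text \<open>The two halves have different reasons. The set where the maximum exceeds
  \<open>a\<close> is the image of an open set under the open map \<open>pr\<close>; the set where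
  it reaches \<open>a\<close> is the image of a compact set of parameters, hence closed.\<close>

lemma fmax_cont:
  assumes h: "continuous_map TY euclideanreal h" shows "continuous_map TX euclideanreal (fmax h)"
  unfolding continuous_map_upper_lower_semicontinuous_lt
proof (intro conjI allI)
  fix a
  have h1: "openin TY {z \<in> topspace TY. h z > a}" and h2: "openin TY {z \<in> topspace TY. h z < a}"
    using h unfolding continuous_map_upper_lower_semicontinuous_lt by blast+
  have att: "\<exists>z\<in>topspace TY. pr z = x \<and> fmax h x = h z" if "x \<in> topspace TX" for x
    using fmax_attained[OF h that] by metis
  have "{x \<in> topspace TX. a < fmax h x} = pr ` {z \<in> topspace TY. h z > a}"
  proof safe
    fix x assume x: "x \<in> topspace TX" "a < fmax h x"
    then show "x \<in> pr ` {z \<in> topspace TY. h z > a}" using att[OF x(1)] by force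
  next
    fix z assume "z \<in> topspace TY" "a < h z"
    then show "a < fmax h (pr z)" using fmax_ge[OF h, of z] by simp
  qed (use pr_in in auto)
  then show "openin TX {x \<in> topspace TX. a < fmax h x}"
    using h1 open_pr by (simp add: open_map_def)
  have cl: "closedin TY (topspace TY - {z \<in> topspace TY. h z < a})" using h2 by auto
  define K where "K = {t \<in> C. q t \<in> topspace TY - {z \<in> topspace TY. h z < a}}"
  have "closedin TX ((\<lambda>t. pr (q t)) ` K)"
    unfolding K_def by (intro X.closedin_image Y.compact_preimage cl) auto
  moreover have "{x \<in> topspace TX. fmax h x < a} = topspace TX - (\<lambda>t. pr (q t)) ` K"
  proof safe
    fix t assume "t \<in> K" "fmax h (pr (q t)) < a"
    then show False using fmax_ge[OF h, of "q t"] by (auto simp: K_def)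
  next
    fix x assume x: "x \<in> topspace TX" "x \<notin> (\<lambda>t. pr (q t)) ` K"
    obtain z where z: "z \<in> topspace TY" "pr z = x" "fmax h x = h z" using att x by blast
    obtain t where "t \<in> C" "q t = z" using z Y.surj_q by (metis imageE)
    then show "fmax h x < a" using z x by (auto simp: K_def)
  qed
  ultimately show "openin TX {x \<in> topspace TX. fmax h x < a}" by auto
qed

lemma fmax_measurable:
  assumes "\<And>z. z \<in> topspace TY \<Longrightarrow> (\<lambda>w. H w z) \<in> borel_measurable M"
    and "\<And>w. w \<in> space M \<Longrightarrow> continuous_map TY euclideanreal (H w)" and x: "x \<in> topspace TX"
  shows "(\<lambda>w. fmax (H w) x) \<in> borel_measurable M"
proof -
  have "(\<lambda>w. SUP t\<in>{t \<in> C. pr (q t) = x}. H w (q t)) \<in> borel_measurable M"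
    using compact_fiber[OF x] assms by (intro Y.measurable_SUP) auto
  then show ?thesis unfolding fmax_def fiber_eq[OF x] by (simp add: image_image)
qed

definition phi :: "'y \<Rightarrow> real" where "phi z = (\<integral>t. ph t z \<partial>p)"

definition S :: "nat \<Rightarrow> 'y \<Rightarrow> real" where "S n z = (\<Sum>j<n. (Y.Q ^^ j) phi z)"

text \<open>In the application \<open>Phi n w\<close> is the logarithmic growth of tangent vectors under the \<open>n\<close>-th
  iterate, and its fibrewise maximum \<open>Psi n w\<close> is the logarithm of the norm of the derivative.\<close>

definition Phi :: "nat \<Rightarrow> (nat \<Rightarrow> 't) \<Rightarrow> 'y \<Rightarrow> real" where
  "Phi n w z = (\<Sum>j<n. ph (w j) (Y.it j w z))"

definition Psi :: "nat \<Rightarrow> (nat \<Rightarrow> 't) \<Rightarrow> 'x \<Rightarrow> real" where "Psi n w = fmax (Phi n w)"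

definition b :: "nat \<Rightarrow> 'x \<Rightarrow> real" where "b n x = (\<integral>w. Psi n w x \<partial>Y.W)"

definition LS :: "nat \<Rightarrow> (nat \<Rightarrow> 't) \<Rightarrow> real" where "LS n w = (\<Sum>j<n. L (w j))"

lemma phi_cont: "continuous_map TY euclideanreal phi"
proof -
  have "continuous_map TY euclideanreal (\<lambda>z. \<integral>t. ph t z \<partial>p)"
    by (rule Y.continuous_integral[OF meas_ph cont_ph int_L ph_bound])
  then show ?thesis by (simp add: phi_def[abs_def])
qed

lemma S_cont: "continuous_map TY euclideanreal (S n)"
  unfolding S_def[abs_def] by (intro continuous_map_sum Y.Q_pow_cont phi_cont) auto

text \<open>The j-th summand of the growth is the first-step growth of the shifted sequence at the
  point reached after j steps, so the Markov property applies with
  \<open>H w = ph (w 0)\<close>.\<close>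

lemma ph_term:
  assumes z: "z \<in> topspace TY"
  shows "integrable Y.W (\<lambda>w. ph (w j) (Y.it j w z))"
    and "(\<integral>w. ph (w j) (Y.it j w z) \<partial>Y.W) = (Y.Q ^^ j) phi z"
proof -
  have m: "(\<lambda>w. ph (w 0) z) \<in> borel_measurable Y.W" if "z \<in> topspace TY" for z
    using measurable_compose[OF measurable_component_singleton[of 0 UNIV "\<lambda>_. p"] meas_ph[OF that]] by simp
  have c: "continuous_map TY euclideanreal (ph (w 0))" if "w \<in> space Y.W" for w
    using cont_ph Y.W_comp[OF that] by blast
  have bd: "\<bar>ph (w 0) z\<bar> \<le> L (w 0)" if "w \<in> space Y.W" "z \<in> topspace TY" for w z
    using ph_bound Y.W_comp that by blast
  have "integrable Y.W (\<lambda>w. ph (w (0 + j)) (Y.it j w z))"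
    by (rule Y.law_it(1)[where H="\<lambda>w. ph (w 0)" and D="\<lambda>w. L (w 0)" and n=j])
       (fact m c bd z Y.integrable_comp[OF int_L, of 0])+
  then show "integrable Y.W (\<lambda>w. ph (w j) (Y.it j w z))" by simp
  have "(\<integral>w. ph (w (0 + j)) (Y.it j w z) \<partial>Y.W) = (Y.Q ^^ j) (\<lambda>z. \<integral>w. ph (w 0) z \<partial>Y.W) z"
    by (rule Y.law_it(2)[where H="\<lambda>w. ph (w 0)" and D="\<lambda>w. L (w 0)" and n=j])
       (fact m c bd z Y.integrable_comp[OF int_L, of 0])+
  then have "(\<integral>w. ph (w j) (Y.it j w z) \<partial>Y.W) = (Y.Q ^^ j) (\<lambda>z. \<integral>w. ph (w 0) z \<partial>Y.W) z" by simp
  also have "\<dots> = (Y.Q ^^ j) phi z"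
    using Y.integral_comp[OF meas_ph] z by (intro Y.Q_pow_cong) (auto simp: phi_def)
  finally show "(\<integral>w. ph (w j) (Y.it j w z) \<partial>Y.W) = (Y.Q ^^ j) phi z" .
qed

lemma Phi_integrable: "z \<in> topspace TY \<Longrightarrow> integrable Y.W (\<lambda>w. Phi n w z)"
  unfolding Phi_def by (intro Bochner_Integration.integrable_sum ph_term)

lemma Phi_integral: "z \<in> topspace TY \<Longrightarrow> (\<integral>w. Phi n w z \<partial>Y.W) = S n z"
  unfolding Phi_def S_def by (subst Bochner_Integration.integral_sum) (auto simp: ph_term)

lemma Phi_cont: "w \<in> space Y.W \<Longrightarrow> continuous_map TY euclideanreal (Phi n w)"
  unfolding Phi_def[abs_def]
proof (intro continuous_map_sum)
  fix j assume w: "w \<in> space Y.W"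
  show "continuous_map TY euclideanreal (\<lambda>z. ph (w j) (Y.it j w z))"
    using continuous_map_compose[OF Y.it_cont[OF w] cont_ph[OF Y.W_comp[OF w]]] by (simp add: o_def)
qed auto

lemma Phi_bound: "w \<in> space Y.W \<Longrightarrow> z \<in> topspace TY \<Longrightarrow> \<bar>Phi n w z\<bar> \<le> LS n w"
  unfolding Phi_def LS_def
  by (rule order_trans[OF sum_abs], rule sum_mono) (auto intro!: ph_bound Y.W_comp Y.it_in)

lemma LS_integrable: "integrable Y.W (LS n)"
  unfolding LS_def[abs_def] by (intro Bochner_Integration.integrable_sum Y.integrable_comp int_L)

lemma LS_integral: "(\<integral>w. LS n w \<partial>Y.W) = n * (\<integral>t. L t \<partial>p)"
  unfolding LS_def using int_L
  by (subst Bochner_Integration.integral_sum) (auto intro: Y.integrable_comp simp: Y.integral_comp)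

lemma Phi_add: "Phi (n + m) w z = Phi n w z + Phi m (\<lambda>i. w (i + n)) (Y.it n w z)"
  by (induction m) (auto simp: Phi_def Y.it_add[symmetric] add.commute)

lemma Psi_measurable: "x \<in> topspace TX \<Longrightarrow> (\<lambda>w. Psi n w x) \<in> borel_measurable Y.W"
  unfolding Psi_def by (intro fmax_measurable Phi_cont borel_measurable_integrable Phi_integrable)

lemma Psi_cont: "w \<in> space Y.W \<Longrightarrow> continuous_map TX euclideanreal (Psi n w)"
  unfolding Psi_def by (intro fmax_cont Phi_cont)

lemma Psi_bound: "w \<in> space Y.W \<Longrightarrow> x \<in> topspace TX \<Longrightarrow> \<bar>Psi n w x\<bar> \<le> LS n w"
  unfolding Psi_def by (metis fmax_attained[OF Phi_cont] Phi_bound)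

lemma Psi_integrable: "x \<in> topspace TX \<Longrightarrow> integrable Y.W (\<lambda>w. Psi n w x)"
  by (rule Bochner_Integration.integrable_bound[OF LS_integrable[of n]])
     (auto intro!: Psi_measurable AE_I2 intro: order_trans[OF Psi_bound])

lemma b_cont: "continuous_map TX euclideanreal (b n)"
proof -
  have "continuous_map TX euclideanreal (\<lambda>x. \<integral>w. Psi n w x \<partial>Y.W)"
    by (rule X.continuous_integral[OF Psi_measurable Psi_cont LS_integrable Psi_bound])
  then show ?thesis by (simp add: b_def[abs_def])
qed

lemma b_ge_S: "z \<in> topspace TY \<Longrightarrow> S n z \<le> b n (pr z)"
  unfolding b_def Phi_integral[symmetric]
  by (intro integral_mono Phi_integrable Psi_integrable pr_in) (auto simp: Psi_def intro!: fmax_ge Phi_cont)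

lemma b_lower: "x \<in> topspace TX \<Longrightarrow> - (n * (\<integral>t. L t \<partial>p)) \<le> b n x"
proof -
  assume x: "x \<in> topspace TX"
  have "(\<integral>w. - LS n w \<partial>Y.W) \<le> b n x"
    unfolding b_def
    by (intro integral_mono Psi_integrable x Bochner_Integration.integrable_minus LS_integrable)
       (metis Psi_bound[OF _ x] abs_le_D2 minus_le_iff)
  then show ?thesis by (simp add: LS_integral)
qed

text \<open>A direction maximizing the growth over \<open>n + m\<close> steps competes in both
  blocks. The second block starts at the random point reached after \<open>n\<close> steps, hence
  the factor \<open>Q ^^ n\<close>, which disappears on integration against a stationary
  measure.\<close>

lemma b_subadditive:
  assumes x: "x \<in> topspace TX"
  shows "b (n + m) x \<le> b n x + (X.Q ^^ n) (b m) x"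
proof -
  note law = X.law_it[where H="Psi m" and D="LS m" and n=n, OF Psi_measurable Psi_cont LS_integrable Psi_bound x]
  have "b (n + m) x \<le> (\<integral>w. Psi n w x + Psi m (\<lambda>i. w (i + n)) (X.it n w x) \<partial>Y.W)"
    unfolding b_def
  proof (intro integral_mono Psi_integrable x Bochner_Integration.integrable_add law(1))
    fix w assume w: "w \<in> space Y.W"
    have w': "(\<lambda>i. w (i + n)) \<in> space Y.W" using measurable_space[OF Y.shift_measurable w] .
    obtain z where z: "z \<in> topspace TY" "pr z = x" "Psi (n + m) w x = Phi (n + m) w z"
      using fmax_attained[OF Phi_cont[OF w] x] unfolding Psi_def by metis
    have "Phi n w z \<le> Psi n w x" using fmax_ge[OF Phi_cont[OF w] z(1)] z(2) by (simp add: Psi_def)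
    moreover have "Phi m (\<lambda>i. w (i + n)) (Y.it n w z) \<le> Psi m (\<lambda>i. w (i + n)) (X.it n w x)"
      using fmax_ge[OF Phi_cont[OF w'] Y.it_in[OF w z(1)]] pr_it[OF w z(1)] z(2) by (simp add: Psi_def)
    ultimately show "Psi (n + m) w x \<le> Psi n w x + Psi m (\<lambda>i. w (i + n)) (X.it n w x)"
      unfolding z(3) Phi_add by simp
  qed
  also have "\<dots> = b n x + (X.Q ^^ n) (b m) x"
    by (subst Bochner_Integration.integral_add)
       (use law x in \<open>auto intro: Psi_integrable simp: b_def[abs_def]\<close>)
  finally show ?thesis .
qed

end


lemma (in real_param) integrable_continuous:
  assumes "finite_measure M" "sets M = sets (borel_top T)" "continuous_map T euclideanreal h"
  shows "integrable M h"
proof -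
  interpret finite_measure M by fact
  obtain B where B: "\<And>z. z \<in> topspace T \<Longrightarrow> \<bar>h z\<bar> \<le> B" using bounded_continuous[OF assms(3)] by blast
  have "h \<in> borel_measurable M"
    using continuous_map_measurable_real[OF assms(3)] by (simp cong: measurable_cong_sets add: assms(2))
  then show ?thesis
    using B sets_eq_imp_space_eq[OF assms(2)] by (intro integrable_const_bound[where B=B]) (auto intro!: AE_I2)
qed

section \<open>The exponent and its bounds from both sides\<close>

context random_system
begin

definition lam :: "'x measure \<Rightarrow> real" where
  "lam \<mu> = lim (\<lambda>n. 1 / real n * (\<integral>x. b n x \<partial>\<mu>))"

text \<open>Stationarity removes the power of \<open>Q\<close> in \<open>b_subadditive\<close>, so
  the integrals of \<open>b n\<close> form a subadditive sequence and Fekete's lemma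
  applies.\<close>

lemma lam_props:
  assumes st: "X.stat \<mu>"
  shows "(\<lambda>n. 1 / real n * (\<integral>x. b n x \<partial>\<mu>)) \<longlonglongrightarrow> lam \<mu>"
    and "n > 0 \<Longrightarrow> lam \<mu> \<le> (\<integral>x. b n x / n \<partial>\<mu>)"
proof -
  interpret mu: prob_space \<mu> using st by (simp add: X.stat_def)
  have se: "sets \<mu> = sets (borel_top TX)" using st by (simp add: X.stat_def)
  have sp: "space \<mu> = topspace TX" using sets_eq_imp_space_eq[OF se] by simp
  note int = X.integrable_continuous[OF mu.finite_measure_axioms se]
  define a where "a n = (\<integral>x. b n x \<partial>\<mu>)" for n
  have "a (n + m) \<le> a n + a m" for n m
  proof -
    have "a (n + m) \<le> (\<integral>x. b n x + (X.Q ^^ n) (b m) x \<partial>\<mu>)"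
      unfolding a_def
      by (intro integral_mono int Bochner_Integration.integrable_add X.Q_pow_cont b_cont)
         (auto simp: sp intro: b_subadditive)
    also have "\<dots> = a n + a m"
      unfolding a_def X.stat_Q_pow[OF st b_cont, symmetric, of m n]
      by (intro Bochner_Integration.integral_add int X.Q_pow_cont b_cont)
    finally show ?thesis .
  qed
  moreover have "- (\<integral>t. L t \<partial>p) * n \<le> a n" for n
  proof -
    have "(\<integral>x. - (n * (\<integral>t. L t \<partial>p)) \<partial>\<mu>) \<le> a n"
      unfolding a_def by (intro integral_mono int b_cont) (auto simp: sp b_lower)
    then show ?thesis by (simp add: mu.prob_space mult.commute)
  qed
  ultimately obtain l where l: "(\<lambda>n. 1 / real n * a n) \<longlonglongrightarrow> l" "\<And>n. n > 0 \<Longrightarrow> l \<le> a n / n"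
    using subadditive_limit[of a] by metis
  have "lam \<mu> = l" unfolding lam_def using l(1) by (intro limI) (simp add: a_def)
  then show "(\<lambda>n. 1 / real n * (\<integral>x. b n x \<partial>\<mu>)) \<longlonglongrightarrow> lam \<mu>"
    "n > 0 \<Longrightarrow> lam \<mu> \<le> (\<integral>x. b n x / n \<partial>\<mu>)"
    using l by (auto simp: a_def)
qed

text \<open>The minimum is expressed through \<open>fmax\<close> of the negated function so that
  attainment and continuity carry over from the maximum.\<close>

definition psi :: "nat \<Rightarrow> 'x \<Rightarrow> real" where
  "psi n x = - fmax (\<lambda>z. - S n z) x / n"

lemma neg_S_cont: "continuous_map TY euclideanreal (\<lambda>z. - S n z)"
  using continuous_map_real_mult_left[OF S_cont, of "-1"] by simp

lemma psi_cont: "continuous_map TX euclideanreal (psi n)"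
proof -
  have "continuous_map TX euclideanreal (\<lambda>x. (- 1 / n) * fmax (\<lambda>z. - S n z) x)"
    by (intro continuous_map_real_mult_left fmax_cont neg_S_cont)
  then show ?thesis by (simp add: psi_def[abs_def])
qed

lemma psi_le: "n > 0 \<Longrightarrow> z \<in> topspace TY \<Longrightarrow> n * psi n (pr z) \<le> S n z"
  using fmax_ge[OF neg_S_cont, of z n] by (simp add: psi_def)

lemma psi_attained:
  assumes "n > 0" "x \<in> topspace TX"
  shows "\<exists>z\<in>topspace TY. pr z = x \<and> S n z \<le> n * psi n x"
proof -
  obtain z where "z \<in> topspace TY" "pr z = x" "fmax (\<lambda>z. - S n z) x = - S n z"
    using fmax_attained[OF neg_S_cont assms(2)] by metis
  then show ?thesis using assms by (auto simp: psi_def)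
qed

lemma S_add: "z \<in> topspace TY \<Longrightarrow> S (n + m) z = S n z + (Y.Q ^^ n) (S m) z"
proof -
  assume z: "z \<in> topspace TY"
  have "(Y.Q ^^ n) (S m) z = (\<Sum>j<m. (Y.Q ^^ n) ((Y.Q ^^ j) phi) z)"
    unfolding S_def[abs_def] using z by (intro Y.Q_pow_sum Y.Q_pow_cont phi_cont)
  also have "\<dots> = (\<Sum>j<m. (Y.Q ^^ (n + j)) phi z)" by (simp add: funpow_add)
  moreover have "(\<Sum>j<n + m. f j) = (\<Sum>j<n. f j) + (\<Sum>j<m. f (n + j))" for f :: "nat \<Rightarrow> real"
    by (induction m) (auto simp: add.assoc)
  ultimately show ?thesis by (simp add: S_def)
qed

text \<open>The block decomposition: the growth over each block of length \<open>n\<close> is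
  bounded below by its minimum over the fibre where the block starts, a quantity that depends on the
  base orbit alone.\<close>

lemma S_mult_lower:
  assumes n: "n > 0" and z: "z \<in> topspace TY"
  shows "(\<Sum>i<k. (X.Q ^^ (i * n)) (\<lambda>x. n * psi n x) (pr z)) \<le> S (k * n) z"
proof (induction k)
  case (Suc k)
  have c: "continuous_map TX euclideanreal (\<lambda>x. n * psi n x)"
    by (intro continuous_map_real_mult_left psi_cont)
  have "(X.Q ^^ (k * n)) (\<lambda>x. n * psi n x) (pr z) = (Y.Q ^^ (k * n)) (\<lambda>z. n * psi n (pr z)) z"
    using Q_pow_pr[OF z, of "k * n" "\<lambda>x. n * psi n x"] by simp
  also have "\<dots> \<le> (Y.Q ^^ (k * n)) (S n) z"
    using n z by (intro Y.Q_pow_mono S_cont cont_comp_pr[OF c] psi_le)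
  finally show ?case
    using Suc S_add[OF z, of "k * n" n] by (simp add: add.commute)
qed (simp add: S_def)

lemma lam_ge_psi:
  assumes st: "X.stat \<mu>" and n: "n > 0"
  shows "(\<integral>x. psi n x \<partial>\<mu>) \<le> lam \<mu>"
proof -
  interpret mu: prob_space \<mu> using st by (simp add: X.stat_def)
  have se: "sets \<mu> = sets (borel_top TX)" using st by (simp add: X.stat_def)
  have sp: "space \<mu> = topspace TX" using sets_eq_imp_space_eq[OF se] by simp
  note int = X.integrable_continuous[OF mu.finite_measure_axioms se]
  have c: "continuous_map TX euclideanreal (\<lambda>x. n * psi n x)"
    by (intro continuous_map_real_mult_left psi_cont)
  \<comment> \<open>All blocks have the same mean by stationarity, and some direction over each
    point grows at least as the blocks do, so the norm growth \<open>b\<close> dominates. Counting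
    from \<open>Suc k\<close> keeps the divisor positive.\<close>
  have "(\<integral>x. psi n x \<partial>\<mu>) \<le> 1 / real (Suc k * n) * (\<integral>x. b (Suc k * n) x \<partial>\<mu>)" for k
  proof -
    have "Suc k * (n * (\<integral>x. psi n x \<partial>\<mu>)) = (\<Sum>i<Suc k. \<integral>x. (X.Q ^^ (i * n)) (\<lambda>x. n * psi n x) x \<partial>\<mu>)"
      using X.stat_Q_pow[OF st c] by simp
    also have "\<dots> = (\<integral>x. (\<Sum>i<Suc k. (X.Q ^^ (i * n)) (\<lambda>x. n * psi n x) x) \<partial>\<mu>)"
      by (intro Bochner_Integration.integral_sum[symmetric] int X.Q_pow_cont c)
    also have "\<dots> \<le> (\<integral>x. b (Suc k * n) x \<partial>\<mu>)"
    proof (intro integral_mono int b_cont continuous_map_sum X.Q_pow_cont c)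
      fix x assume "x \<in> space \<mu>"
      then obtain z where "z \<in> topspace TY" "x = pr z" using fiber_nonempty sp by blast
      then show "(\<Sum>i<Suc k. (X.Q ^^ (i * n)) (\<lambda>x. n * psi n x) x) \<le> b (Suc k * n) x"
        using S_mult_lower[OF n, of z "Suc k"] b_ge_S[of z "Suc k * n"] by simp
    qed auto
    finally have "(\<integral>x. psi n x \<partial>\<mu>) * real (Suc k * n) \<le> (\<integral>x. b (Suc k * n) x \<partial>\<mu>)"
      by (simp only: of_nat_mult mult_ac)
    moreover have "real (Suc k * n) > 0" using n by (simp only: of_nat_0_less_iff) simp
    ultimately show ?thesis by (simp only: pos_le_divide_eq[symmetric]) simp
  qed
  moreover have "(\<lambda>k. 1 / real (Suc k * n) * (\<integral>x. b (Suc k * n) x \<partial>\<mu>)) \<longlonglongrightarrow> lam \<mu>"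
  proof -
    have "strict_mono (\<lambda>k. Suc k * n)" using n by (auto simp: strict_mono_def)
    from LIMSEQ_subseq_LIMSEQ[OF lam_props(1)[OF st] this] show ?thesis by (simp add: o_def)
  qed
  ultimately show ?thesis by (intro LIMSEQ_le_const) auto
qed

text \<open>The parameters at which the minimum over the fibre is attained form a compact set
  \<open>K\<close> that still maps onto the base. The selection by least preimages, applied to
  \<open>K\<close> in place of \<open>C\<close>, therefore picks minimizers measurably.\<close>

lemma minimizing_section:
  assumes n: "n > 0"
  obtains V where "V \<in> borel_top TX \<rightarrow>\<^sub>M borel_top TY" "\<And>x. x \<in> topspace TX \<Longrightarrow> pr (V x) = x"
    "\<And>x. x \<in> topspace TX \<Longrightarrow> S n (V x) = n * psi n x"
proof -
  define K where "K = {t \<in> C. S n (q t) \<le> n * psi n (pr (q t))}"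
  have "closedin TY {z \<in> topspace TY. n * psi n (pr z) - S n z \<in> {0..}}"
    by (rule closedin_continuous_map_preimage[of _ euclideanreal])
       (auto intro!: continuous_map_diff continuous_map_real_mult_left cont_comp_pr[OF psi_cont] S_cont)
  then have "compact {t \<in> C. q t \<in> {z \<in> topspace TY. n * psi n (pr z) - S n z \<in> {0..}}}"
    by (rule Y.compact_preimage)
  moreover have "{t \<in> C. q t \<in> {z \<in> topspace TY. n * psi n (pr z) - S n z \<in> {0..}}} = K"
    using Y.q_in by (auto simp: K_def)
  ultimately have K: "compact K" by simp
  interpret K: real_param TX K "\<lambda>t. pr (q t)"
  proof
    show "continuous_map (top_of_set K) TX (\<lambda>t. pr (q t))"
      using X.cont_q by (rule continuous_map_from_subtopology_mono) (auto simp: K_def)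
    show "(\<lambda>t. pr (q t)) ` K = topspace TX"
    proof
      show "topspace TX \<subseteq> (\<lambda>t. pr (q t)) ` K"
      proof
        fix x assume x: "x \<in> topspace TX"
        obtain z where z: "z \<in> topspace TY" "pr z = x" "S n z \<le> n * psi n x"
          using psi_attained[OF n x] by blast
        obtain t where "t \<in> C" "q t = z" using z(1) Y.surj_q by (metis imageE)
        then show "x \<in> (\<lambda>t. pr (q t)) ` K" using z by (intro image_eqI[of _ _ t]) (auto simp: K_def)
      qed
    qed (use pr_in Y.q_in in \<open>auto simp: K_def\<close>)
  qed (use Hausdorff_X K in auto)
  obtain s where s: "s \<in> borel_top TX \<rightarrow>\<^sub>M borel" "\<And>x. x \<in> topspace TX \<Longrightarrow> s x \<in> K"
    "\<And>x. x \<in> topspace TX \<Longrightarrow> pr (q (s x)) = x"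
    using K.measurable_section by blast
  have sC: "s x \<in> C \<and> S n (q (s x)) \<le> n * psi n x" if "x \<in> topspace TX" for x
    using s(2,3)[OF that] by (simp add: K_def)
  show ?thesis
  proof (rule that[of "\<lambda>x. q (s x)"])
    show "(\<lambda>x. q (s x)) \<in> borel_top TX \<rightarrow>\<^sub>M borel_top TY"
      using s(1) sC by (intro Y.measurable_q_comp) auto
    show "S n (q (s x)) = n * psi n x" if "x \<in> topspace TX" for x
      using sC[OF that] psi_le[OF n, of "q (s x)"] s(3)[OF that] Y.q_in by (intro antisym) auto
  qed (use s in auto)
qed

text \<open>The average over \<open>n\<close> steps is realized as a single image measure: the law
  of the orbit of \<open>V x\<close> observed at an independent uniformly distributed time below
  \<open>n\<close>.\<close>

lemma cesaro_measure:
  assumes mu: "prob_space \<mu>" "sets \<mu> = sets (borel_top TX)"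
    and V: "V \<in> borel_top TX \<rightarrow>\<^sub>M borel_top TY" and n: "n > 0"
  obtains \<nu> where "prob_space \<nu>" "sets \<nu> = sets (borel_top TY)"
    "\<And>h. continuous_map TY euclideanreal h \<Longrightarrow>
       (\<integral>z. h z \<partial>\<nu>) = (\<Sum>j<n. \<integral>x. (Y.Q ^^ j) h (V x) \<partial>\<mu>) / n"
proof -
  define U where "U = measure_pmf (pmf_of_set {..<n})"
  interpret mu: prob_space \<mu> by fact
  interpret U: prob_space U unfolding U_def by (rule measure_pmf.prob_space_axioms)
  interpret A: pair_prob_space \<mu> Y.W ..
  interpret B: pair_prob_space U "\<mu> \<Otimes>\<^sub>M Y.W" ..
  note [measurable_cong] = mu(2)
  have sp: "space \<mu> = topspace TX" using sets_eq_imp_space_eq[OF mu(2)] by simp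
  have Vin: "V x \<in> topspace TY" if "x \<in> topspace TX" for x
    using measurable_space[OF V, of x] that by simp
  note V[measurable]
  define k where "k = (\<lambda>(j, x, w). Y.it j w (V x))"
  have kj: "(\<lambda>y. k (j, y)) \<in> \<mu> \<Otimes>\<^sub>M Y.W \<rightarrow>\<^sub>M borel_top TY" for j
  proof -
    have "(\<lambda>y. (snd y, V (fst y))) \<in> \<mu> \<Otimes>\<^sub>M Y.W \<rightarrow>\<^sub>M Y.W \<Otimes>\<^sub>M borel_top TY" by measurable
    from measurable_compose[OF this Y.it_joint[of j]] show ?thesis
      by (simp add: k_def case_prod_beta')
  qed
  have "k \<in> count_space UNIV \<Otimes>\<^sub>M (\<mu> \<Otimes>\<^sub>M Y.W) \<rightarrow>\<^sub>M borel_top TY"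
    by (rule measurable_pair_measure_countable1) (auto intro: kj)
  moreover have "sets (U \<Otimes>\<^sub>M (\<mu> \<Otimes>\<^sub>M Y.W)) = sets (count_space UNIV \<Otimes>\<^sub>M (\<mu> \<Otimes>\<^sub>M Y.W))"
    by (intro sets_pair_measure_cong) (auto simp: U_def)
  ultimately have k[measurable]: "k \<in> U \<Otimes>\<^sub>M (\<mu> \<Otimes>\<^sub>M Y.W) \<rightarrow>\<^sub>M borel_top TY"
    by (simp cong: measurable_cong_sets)
  define \<nu> where "\<nu> = distr (U \<Otimes>\<^sub>M (\<mu> \<Otimes>\<^sub>M Y.W)) (borel_top TY) k"
  show ?thesis
  proof (rule that[of \<nu>])
    show "prob_space \<nu>" unfolding \<nu>_def by (intro B.prob_space_distr k)
    show "sets \<nu> = sets (borel_top TY)" by (simp add: \<nu>_def)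
    fix h assume h: "continuous_map TY euclideanreal h"
    note hm[measurable] = continuous_map_measurable_real[OF h]
    obtain b where b: "\<And>z. z \<in> topspace TY \<Longrightarrow> \<bar>h z\<bar> \<le> b" using Y.bounded_continuous[OF h] by blast
    have ib: "integrable (U \<Otimes>\<^sub>M (\<mu> \<Otimes>\<^sub>M Y.W)) (\<lambda>y. h (k y))"
    proof (rule B.integrable_const_bound[where B=b])
      show "AE y in U \<Otimes>\<^sub>M (\<mu> \<Otimes>\<^sub>M Y.W). norm (h (k y)) \<le> b"
        using b measurable_space[OF k] by (intro AE_I2) auto
    qed measurable
    have ij: "integrable (\<mu> \<Otimes>\<^sub>M Y.W) (\<lambda>y. h (k (j, y)))" for j
    proof (rule A.integrable_const_bound[where B=b])
      show "AE y in \<mu> \<Otimes>\<^sub>M Y.W. norm (h (k (j, y))) \<le> b"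
        using b measurable_space[OF kj] by (intro AE_I2) auto
      show "(\<lambda>y. h (k (j, y))) \<in> borel_measurable (\<mu> \<Otimes>\<^sub>M Y.W)"
        using measurable_compose[OF kj hm] .
    qed
    have "(\<integral>z. h z \<partial>\<nu>) = (\<integral>y. h (k y) \<partial>(U \<Otimes>\<^sub>M (\<mu> \<Otimes>\<^sub>M Y.W)))"
      unfolding \<nu>_def by (intro integral_distr k hm)
    also have "\<dots> = (\<integral>j. (\<integral>y. h (k (j, y)) \<partial>(\<mu> \<Otimes>\<^sub>M Y.W)) \<partial>U)"
      using B.integral_fst'[OF ib] by simp
    also have "\<dots> = (\<Sum>j<n. \<integral>y. h (k (j, y)) \<partial>(\<mu> \<Otimes>\<^sub>M Y.W)) / n"
      unfolding U_def using n by (subst integral_pmf_of_set) auto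
    also have "(\<lambda>j. \<integral>y. h (k (j, y)) \<partial>(\<mu> \<Otimes>\<^sub>M Y.W)) = (\<lambda>j. \<integral>x. (Y.Q ^^ j) h (V x) \<partial>\<mu>)"
    proof
      fix j
      have "(\<integral>y. h (k (j, y)) \<partial>(\<mu> \<Otimes>\<^sub>M Y.W)) = (\<integral>x. (\<integral>w. h (k (j, x, w)) \<partial>Y.W) \<partial>\<mu>)"
        using A.integral_fst'[OF ij[of j]] by simp
      also have "\<dots> = (\<integral>x. (Y.Q ^^ j) h (V x) \<partial>\<mu>)"
        by (intro Bochner_Integration.integral_cong) (auto simp: k_def sp Vin Y.law_it_const[OF h])
      finally show "(\<integral>y. h (k (j, y)) \<partial>(\<mu> \<Otimes>\<^sub>M Y.W)) = (\<integral>x. (Y.Q ^^ j) h (V x) \<partial>\<mu>)" .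
    qed
    finally show "(\<integral>z. h z \<partial>\<nu>) = (\<Sum>j<n. \<integral>x. (Y.Q ^^ j) h (V x) \<partial>\<mu>) / n" .
  qed
qed

text \<open>The Krylov-Bogolyubov argument with a starting section that changes with
  \<open>n\<close>. The change does no harm, because the defect of stationarity of the averages is
  bounded uniformly in the starting measure. Indices are shifted by \<open>Suc\<close> to exclude
  averages over zero steps.\<close>

lemma minimizing_lift:
  assumes st: "X.stat \<mu>"
  obtains r \<nu> where "strict_mono (r :: nat \<Rightarrow> nat)" "Y.stat \<nu>" "distr \<nu> (borel_top TX) pr = \<mu>"
    "(\<lambda>n. \<integral>x. psi (Suc (r n)) x \<partial>\<mu>) \<longlonglongrightarrow> (\<integral>z. phi z \<partial>\<nu>)"
proof -
  interpret mu: prob_space \<mu> using st by (simp add: X.stat_def)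
  have se: "sets \<mu> = sets (borel_top TX)" using st by (simp add: X.stat_def)
  have sp: "space \<mu> = topspace TX" using sets_eq_imp_space_eq[OF se] by simp
  note int = X.integrable_continuous[OF mu.finite_measure_axioms se]
  have "\<exists>V. V \<in> borel_top TX \<rightarrow>\<^sub>M borel_top TY \<and> (\<forall>x\<in>topspace TX. pr (V x) = x) \<and>
     (\<forall>x\<in>topspace TX. S (Suc n) (V x) = Suc n * psi (Suc n) x)" for n
    using minimizing_section[of "Suc n"] by (metis zero_less_Suc)
  then obtain V where V: "\<And>n. V n \<in> borel_top TX \<rightarrow>\<^sub>M borel_top TY"
    "\<And>n x. x \<in> topspace TX \<Longrightarrow> pr (V n x) = x"
    "\<And>n x. x \<in> topspace TX \<Longrightarrow> S (Suc n) (V n x) = Suc n * psi (Suc n) x" by metis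
  have Vin: "V n x \<in> topspace TY" if "x \<in> topspace TX" for n x
    using measurable_space[OF V(1), of x] that by simp
  have "\<exists>\<nu>. prob_space \<nu> \<and> sets \<nu> = sets (borel_top TY) \<and>
    (\<forall>h. continuous_map TY euclideanreal h \<longrightarrow>
       (\<integral>z. h z \<partial>\<nu>) = (\<Sum>j<Suc n. \<integral>x. (Y.Q ^^ j) h (V n x) \<partial>\<mu>) / Suc n)" for n
    using cesaro_measure[OF mu.prob_space_axioms se V(1), of "Suc n" n] by (metis zero_less_Suc)
  then obtain \<nu>s where ns: "\<And>n. prob_space (\<nu>s n)" "\<And>n. sets (\<nu>s n) = sets (borel_top TY)"
    "\<And>n h. continuous_map TY euclideanreal h \<Longrightarrow>
       (\<integral>z. h z \<partial>\<nu>s n) = (\<Sum>j<Suc n. \<integral>x. (Y.Q ^^ j) h (V n x) \<partial>\<mu>) / Suc n" by metis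
  obtain r \<nu> where r: "strict_mono (r :: nat \<Rightarrow> nat)" and nu: "prob_space \<nu>" "sets \<nu> = sets (borel_top TY)"
    and conv: "\<And>h. continuous_map TY euclideanreal h \<Longrightarrow> (\<lambda>n. \<integral>z. h z \<partial>\<nu>s (r n)) \<longlonglongrightarrow> (\<integral>z. h z \<partial>\<nu>)"
    using Y.weak_compactness[of \<nu>s] ns by metis
  interpret nu: prob_space \<nu> by fact
  have intV: "integrable \<mu> (\<lambda>x. h (V n x))" if h: "continuous_map TY euclideanreal h" for h n
  proof -
    obtain B where B: "\<And>z. z \<in> topspace TY \<Longrightarrow> \<bar>h z\<bar> \<le> B" using Y.bounded_continuous[OF h] by blast
    have "(\<lambda>x. h (V n x)) \<in> borel_measurable \<mu>"
      using measurable_compose[OF V(1) continuous_map_measurable_real[OF h]]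
      by (simp cong: measurable_cong_sets add: se)
    then show ?thesis
      using B Vin by (intro mu.integrable_const_bound[where B=B]) (auto intro!: AE_I2 simp: sp)
  qed
  have "(\<integral>z. Y.Q h z \<partial>\<nu>) = (\<integral>z. h z \<partial>\<nu>)" if h: "continuous_map TY euclideanreal h" for h
  proof -
    obtain B where B: "\<And>z. z \<in> topspace TY \<Longrightarrow> \<bar>h z\<bar> \<le> B" using Y.bounded_continuous[OF h] by blast
    \<comment> \<open>\<open>Q\<close> fixes constants and is monotone, so its powers preserve the
      bounds of \<open>h\<close>.\<close>
    have Bn: "\<bar>(Y.Q ^^ n) h z\<bar> \<le> B" if "z \<in> topspace TY" for n z
    proof -
      have "(Y.Q ^^ n) (\<lambda>_. c) z = c" if "z \<in> topspace TY" for c z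
        using that by (induction n arbitrary: z) (auto simp: Y.Q_def Y.G_in Y.prob_space cong: Bochner_Integration.integral_cong)
      moreover have "(Y.Q ^^ n) (\<lambda>_. - B) z \<le> (Y.Q ^^ n) h z" "(Y.Q ^^ n) h z \<le> (Y.Q ^^ n) (\<lambda>_. B) z"
        using that B h by (intro Y.Q_pow_mono; fastforce simp: abs_le_iff)+
      ultimately show ?thesis using that by (simp add: abs_le_iff)
    qed
    \<comment> \<open>Applying \<open>Q\<close> shifts the average by one step, so all but its first
      and last terms cancel. Both are bounded by \<open>B\<close>, and the defect is of order
      \<open>2 * B / Suc n\<close>.\<close>
    have diff: "(\<integral>z. Y.Q h z \<partial>\<nu>s n) - (\<integral>z. h z \<partial>\<nu>s n) =
        ((\<integral>x. (Y.Q ^^ Suc n) h (V n x) \<partial>\<mu>) - (\<integral>x. h (V n x) \<partial>\<mu>)) / Suc n" for n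
    proof -
      have "(\<Sum>j<Suc n. \<integral>x. (Y.Q ^^ j) (Y.Q h) (V n x) \<partial>\<mu>) = (\<Sum>j<Suc n. \<integral>x. (Y.Q ^^ Suc j) h (V n x) \<partial>\<mu>)"
        by (simp add: funpow_swap1)
      also have "\<dots> - (\<Sum>j<Suc n. \<integral>x. (Y.Q ^^ j) h (V n x) \<partial>\<mu>) =
         (\<integral>x. (Y.Q ^^ Suc n) h (V n x) \<partial>\<mu>) - (\<integral>x. (Y.Q ^^ 0) h (V n x) \<partial>\<mu>)"
        unfolding sum_subtractf[symmetric] by (rule sum_lessThan_telescope)
      finally show ?thesis
        unfolding ns(3)[OF Y.Q_cont[OF h]] ns(3)[OF h] by (simp add: diff_divide_distrib[symmetric])
    qed
    have bound: "\<bar>\<integral>x. (Y.Q ^^ m) h (V n x) \<partial>\<mu>\<bar> \<le> B" for m n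
    proof -
      have "\<bar>\<integral>x. (Y.Q ^^ m) h (V n x) \<partial>\<mu>\<bar> \<le> (\<integral>x. \<bar>(Y.Q ^^ m) h (V n x)\<bar> \<partial>\<mu>)"
        by (rule integral_abs_bound)
      also have "\<dots> \<le> (\<integral>x. B \<partial>\<mu>)"
        using Bn Vin by (intro integral_mono integrable_abs intV Y.Q_pow_cont h) (auto simp: sp)
      finally show ?thesis by (simp add: mu.prob_space)
    qed
    have "(\<lambda>n. (\<integral>z. Y.Q h z \<partial>\<nu>s n) - (\<integral>z. h z \<partial>\<nu>s n)) \<longlonglongrightarrow> 0"
    proof (rule Lim_null_comparison)
      show "\<forall>\<^sub>F n in sequentially. norm ((\<integral>z. Y.Q h z \<partial>\<nu>s n) - (\<integral>z. h z \<partial>\<nu>s n)) \<le> 2 * B * (1 / Suc n)"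
      proof (intro always_eventually allI)
        fix n
        have "\<bar>(\<integral>x. (Y.Q ^^ Suc n) h (V n x) \<partial>\<mu>) - (\<integral>x. h (V n x) \<partial>\<mu>)\<bar> \<le> 2 * B"
          using bound[of "Suc n" n] bound[of 0 n] unfolding funpow_0 by linarith
        then show "norm ((\<integral>z. Y.Q h z \<partial>\<nu>s n) - (\<integral>z. h z \<partial>\<nu>s n)) \<le> 2 * B * (1 / Suc n)"
          unfolding diff by (simp add: divide_right_mono)
      qed
      show "(\<lambda>n. 2 * B * (1 / Suc n)) \<longlonglongrightarrow> 0"
        using tendsto_mult[OF tendsto_const[of "2 * B"] LIMSEQ_Suc[OF lim_1_over_n]] by simp
    qed
    from LIMSEQ_subseq_LIMSEQ[OF this r]
    have "(\<lambda>n. (\<integral>z. Y.Q h z \<partial>\<nu>s (r n)) - (\<integral>z. h z \<partial>\<nu>s (r n))) \<longlonglongrightarrow> 0" by (simp add: o_def)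
    moreover have "(\<lambda>n. (\<integral>z. Y.Q h z \<partial>\<nu>s (r n)) - (\<integral>z. h z \<partial>\<nu>s (r n))) \<longlonglongrightarrow> (\<integral>z. Y.Q h z \<partial>\<nu>) - (\<integral>z. h z \<partial>\<nu>)"
      by (intro tendsto_diff conv h Y.Q_cont)
    ultimately show ?thesis using LIMSEQ_unique by fastforce
  qed
  then have stn: "Y.stat \<nu>" using Y.stat_iff[OF nu] by blast
  have prm: "pr \<in> \<nu> \<rightarrow>\<^sub>M borel_top TX"
    using continuous_map_measurable_top[OF cont_pr] by (simp cong: measurable_cong_sets add: nu(2))
  have proj: "distr \<nu> (borel_top TX) pr = \<mu>"
  proof (rule X.measure_eqI_continuous)
    show "finite_measure (distr \<nu> (borel_top TX) pr)"
      using nu.prob_space_distr[OF prm] by (rule prob_space.finite_measure)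
    show "finite_measure \<mu>" by (rule mu.finite_measure_axioms)
    fix h assume h: "continuous_map TX euclideanreal h"
    \<comment> \<open>Every average projects exactly to \<open>\<mu>\<close>: \<open>V n\<close> is
      a section and \<open>\<mu>\<close> is stationary under each power of \<open>Q\<close>. The
      limit therefore projects to \<open>\<mu>\<close> as well.\<close>
    have "(\<integral>z. h (pr z) \<partial>\<nu>s n) = (\<integral>x. h x \<partial>\<mu>)" for n
    proof -
      have "(\<integral>x. (Y.Q ^^ j) (\<lambda>z. h (pr z)) (V n x) \<partial>\<mu>) = (\<integral>x. h x \<partial>\<mu>)" for j
      proof -
        have "(\<integral>x. (Y.Q ^^ j) (\<lambda>z. h (pr z)) (V n x) \<partial>\<mu>) = (\<integral>x. (X.Q ^^ j) h x \<partial>\<mu>)"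
          using V Vin by (intro Bochner_Integration.integral_cong) (auto simp: sp Q_pow_pr)
        then show ?thesis using X.stat_Q_pow[OF st h] by simp
      qed
      then show ?thesis unfolding ns(3)[OF cont_comp_pr[OF h]] by simp
    qed
    then have "(\<integral>z. h (pr z) \<partial>\<nu>) = (\<integral>x. h x \<partial>\<mu>)"
      using conv[OF cont_comp_pr[OF h]] by (simp add: LIMSEQ_const_iff)
    then show "(\<integral>x. h x \<partial>distr \<nu> (borel_top TX) pr) = (\<integral>x. h x \<partial>\<mu>)"
      by (subst integral_distr[OF prm continuous_map_measurable_real[OF h]])
  qed (use se in auto)
  have "(\<integral>z. phi z \<partial>\<nu>s n) = (\<integral>x. psi (Suc n) x \<partial>\<mu>)" for n
  proof -
    have "(\<integral>z. phi z \<partial>\<nu>s n) = (\<integral>x. S (Suc n) (V n x) \<partial>\<mu>) / Suc n"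
      unfolding ns(3)[OF phi_cont] S_def
      by (subst Bochner_Integration.integral_sum) (auto intro!: intV Y.Q_pow_cont Y.Q_cont phi_cont)
    also have "(\<integral>x. S (Suc n) (V n x) \<partial>\<mu>) = (\<integral>x. Suc n * psi (Suc n) x \<partial>\<mu>)"
      using V(3) by (intro Bochner_Integration.integral_cong) (auto simp: sp)
    finally show ?thesis by simp
  qed
  then have "(\<lambda>n. \<integral>x. psi (Suc (r n)) x \<partial>\<mu>) \<longlonglongrightarrow> (\<integral>z. phi z \<partial>\<nu>)"
    using conv[OF phi_cont] by simp
  then show ?thesis using that r stn proj by blast
qed

text \<open>The conclusion supplies one continuous function on each side, valid for all stationary
  measures at once, since inequalities between integrals of single functions are what describes a
  weak* neighbourhood.\<close>

theorem lam_bounds_at_quasi_irreducible: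
  assumes st: "X.stat \<mu>" and e: "e > 0"
    and qi: "\<And>\<nu>. Y.stat \<nu> \<Longrightarrow> distr \<nu> (borel_top TX) pr = \<mu> \<Longrightarrow> (\<integral>z. phi z \<partial>\<nu>) = lam \<mu>"
  obtains u v where "continuous_map TX euclideanreal u" "continuous_map TX euclideanreal v"
    "\<And>\<mu>'. X.stat \<mu>' \<Longrightarrow> (\<integral>x. v x \<partial>\<mu>') \<le> lam \<mu>' \<and> lam \<mu>' \<le> (\<integral>x. u x \<partial>\<mu>')"
    "lam \<mu> - e < (\<integral>x. v x \<partial>\<mu>)" "(\<integral>x. u x \<partial>\<mu>) < lam \<mu> + e"
proof -
  obtain r \<nu> where "Y.stat \<nu>" "distr \<nu> (borel_top TX) pr = \<mu>"
    "(\<lambda>n. \<integral>x. psi (Suc (r n)) x \<partial>\<mu>) \<longlonglongrightarrow> (\<integral>z. phi z \<partial>\<nu>)"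
    using minimizing_lift[OF st] by metis
  then have "(\<lambda>n. \<integral>x. psi (Suc (r n)) x \<partial>\<mu>) \<longlonglongrightarrow> lam \<mu>" using qi by simp
  then have "\<forall>\<^sub>F n in sequentially. lam \<mu> - e < (\<integral>x. psi (Suc (r n)) x \<partial>\<mu>)"
    using e by (intro order_tendstoD(1)) auto
  then obtain n where n: "lam \<mu> - e < (\<integral>x. psi (Suc (r n)) x \<partial>\<mu>)"
    by (auto simp: eventually_sequentially)
  have "\<forall>\<^sub>F m in sequentially. 1 / real m * (\<integral>x. b m x \<partial>\<mu>) < lam \<mu> + e"
    using e by (intro order_tendstoD(2)[OF lam_props(1)[OF st]]) auto
  then have "\<forall>\<^sub>F m in sequentially. m > 0 \<and> (\<integral>x. b m x / m \<partial>\<mu>) < lam \<mu> + e"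
    using eventually_gt_at_top[of 0] by eventually_elim simp
  then obtain m :: nat where m: "m > 0" "(\<integral>x. b m x / m \<partial>\<mu>) < lam \<mu> + e"
    by (auto simp: eventually_sequentially)
  have "continuous_map TX euclideanreal (\<lambda>x. (1 / m) * b m x)"
    by (intro continuous_map_real_mult_left b_cont)
  then have "continuous_map TX euclideanreal (\<lambda>x. b m x / m)" by simp
  then show ?thesis
    using that[of "\<lambda>x. b m x / m" "psi (Suc (r n))"] psi_cont lam_ge_psi lam_props(2) m n by simp
qed

end


section \<open>Tangent maps in charts\<close>

text \<open>Expanding the linear argument in a basis reduces joint continuity to finitely many fixed
  directions.\<close>

lemma continuous_on_joint_linear:
  fixes D :: "'b::t2_space \<Rightarrow> 'e::euclidean_space \<Rightarrow> 'f::real_normed_vector"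
  assumes lin: "\<And>y. y \<in> S \<Longrightarrow> linear (D y)" and c: "\<And>v. continuous_on S (\<lambda>y. D y v)"
  shows "continuous_on (S \<times> UNIV) (\<lambda>z. D (fst z) (snd z))"
proof -
  have "continuous_on (S \<times> UNIV) (\<lambda>z. \<Sum>b\<in>Basis. (snd z \<bullet> b) *\<^sub>R D (fst z) b)"
    by (intro continuous_intros continuous_on_compose2[OF c]) auto
  then show ?thesis
  proof (rule continuous_on_eq)
    fix z assume "z \<in> S \<times> (UNIV :: 'e set)"
    then have l: "linear (D (fst z))" using lin by auto
    have "D (fst z) (snd z) = D (fst z) (\<Sum>b\<in>Basis. (snd z \<bullet> b) *\<^sub>R b)"
      by (simp add: euclidean_representation)
    also have "\<dots> = (\<Sum>b\<in>Basis. (snd z \<bullet> b) *\<^sub>R D (fst z) b)"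
      using l by (simp add: linear_sum linear_scale)
    finally show "(\<Sum>b\<in>Basis. (snd z \<bullet> b) *\<^sub>R D (fst z) b) = D (fst z) (snd z)" by simp
  qed
qed

section \<open>Charts, tangent vectors and the chain rule\<close>

context smooth_manifold
begin

lemma cinv_cmap: "c \<in> A \<Longrightarrow> x \<in> cdom c \<Longrightarrow> cinv c (cmap c x) = x"
  using homeomorphism_chart[of c] by (auto simp: homeomorphism_def)

lemma cmap_cinv: "y \<in> cimage c \<Longrightarrow> cmap c (cinv c y) = y"
  by (simp add: f_inv_into_f)

lemma cinv_in: "y \<in> cimage c \<Longrightarrow> cinv c y \<in> cdom c"
  by (rule inv_into_into)

lemma continuous_cmap: "c \<in> A \<Longrightarrow> continuous_on (cdom c) (cmap c)"
  using homeomorphism_chart[of c] by (auto simp: homeomorphism_def)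

lemma continuous_cinv: "c \<in> A \<Longrightarrow> continuous_on (cimage c) (cinv c)"
  using homeomorphism_chart[of c] by (auto simp: homeomorphism_def)

lemma chart_image_eq: "c \<in> A \<Longrightarrow> cmap c ` (cdom c \<inter> U) = cimage c \<inter> cinv c -` U"
  by (auto simp: cinv_cmap cmap_cinv cinv_in intro!: image_eqI[of _ "cmap c"])

lemma open_chart_image: "c \<in> A \<Longrightarrow> open U \<Longrightarrow> open (cmap c ` (cdom c \<inter> U))"
  unfolding chart_image_eq
  using continuous_open_preimage[OF continuous_cinv open_cimage] by blast

lemma in_charts_at [simp]: "c \<in> charts_at A x \<longleftrightarrow> c \<in> A \<and> x \<in> cdom c"
  by (simp add: charts_at_def)

lemma chart_exists: "\<exists>c\<in>A. x \<in> cdom c"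
  using charts_cover by blast

text \<open>Weaker than \<open>C\<^sup>1\<close>, but enough for the chain rule and visibly inherited by the iterates.\<close>

definition diff_map :: "('a \<Rightarrow> 'a) \<Rightarrow> bool" where
  "diff_map h \<longleftrightarrow> continuous_on UNIV h \<and>
     (\<forall>c\<in>A. \<forall>d\<in>A. \<forall>x\<in>cdom c. h x \<in> cdom d \<longrightarrow> (cmap d \<circ> h \<circ> cinv c) differentiable (at (cmap c x)))"

abbreviation chart_deriv :: "('a \<Rightarrow> 'a) \<Rightarrow> ('a, 'e) chart \<Rightarrow> ('a, 'e) chart \<Rightarrow> 'e \<Rightarrow> 'e \<Rightarrow> 'e" where
  "chart_deriv h c d y \<equiv> frechet_derivative (cmap d \<circ> h \<circ> cinv c) (at y)"

lemma diff_map_deriv: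
  assumes "diff_map h" "c \<in> A" "d \<in> A" "x \<in> cdom c" "h x \<in> cdom d"
  shows "((cmap d \<circ> h \<circ> cinv c) has_derivative chart_deriv h c d (cmap c x)) (at (cmap c x))"
  using assms unfolding diff_map_def by (metis frechet_derivative_works)

lemma linear_chart_deriv:
  "diff_map h \<Longrightarrow> c \<in> A \<Longrightarrow> d \<in> A \<Longrightarrow> x \<in> cdom c \<Longrightarrow> h x \<in> cdom d \<Longrightarrow> linear (chart_deriv h c d (cmap c x))"
  using has_derivative_linear[OF diff_map_deriv] by blast

lemma diff_map_id: "diff_map id"
proof -
  have "(cmap d \<circ> cinv c) differentiable (at (cmap c x))"
    if "c \<in> A" "d \<in> A" "x \<in> cdom c" "x \<in> cdom d" for c d x
  proof -
    have "Ck_on (Suc 0) (cmap c ` (cdom c \<inter> cdom d)) (cmap d \<circ> cinv c)"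
      using smooth_transition[of c d] that by (simp only: smooth_on_def)
    then show ?thesis using that by auto
  qed
  then show ?thesis by (auto simp: diff_map_def)
qed

lemma chain_rule:
  assumes h: "diff_map h" "diff_map k" and cde: "c \<in> A" "d \<in> A" "e \<in> A"
    and x: "x \<in> cdom c" "h x \<in> cdom d" "k (h x) \<in> cdom e"
  shows "((cmap e \<circ> (k \<circ> h) \<circ> cinv c) has_derivative
          (chart_deriv k d e (cmap d (h x)) \<circ> chart_deriv h c d (cmap c x))) (at (cmap c x))"
proof -
  have 1: "((cmap e \<circ> k \<circ> cinv d) \<circ> (cmap d \<circ> h \<circ> cinv c) has_derivative
          (chart_deriv k d e (cmap d (h x)) \<circ> chart_deriv h c d (cmap c x))) (at (cmap c x))"
    using diff_map_deriv[OF h(1) cde(1,2) x(1,2)] diff_map_deriv[OF h(2) cde(2,3) x(2,3)]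
    by (intro diff_chain_at) (auto simp: cinv_cmap cde x)
  \<comment> \<open>The coordinate map and its inverse cancel between \<open>h\<close> and
    \<open>k\<close> only where \<open>h\<close> stays in the domain of \<open>d\<close>; the
    derivative is transferred on this neighbourhood.\<close>
  let ?U = "cmap c ` (cdom c \<inter> h -` cdom d)"
  have "open (h -` cdom d)"
    using h(1) open_cdom[OF cde(2)] by (auto simp: diff_map_def intro: open_vimage)
  with cde(1) have "open ?U" by (rule open_chart_image)
  moreover have "cmap c x \<in> ?U" using x by auto
  ultimately show ?thesis
    by (rule has_derivative_transform_within_open[OF 1]) (auto simp: cinv_cmap cde)
qed

lemma diff_map_comp:
  assumes "diff_map h" "diff_map k" shows "diff_map (k \<circ> h)"
  unfolding diff_map_def
proof (intro conjI ballI impI)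
  show "continuous_on UNIV (k \<circ> h)"
    using assms unfolding diff_map_def by (intro continuous_on_compose) (auto intro: continuous_on_subset)
  fix c d x assume *: "c \<in> A" "d \<in> A" "x \<in> cdom c" "(k \<circ> h) x \<in> cdom d"
  obtain e where "e \<in> A" "h x \<in> cdom e" using chart_exists by blast
  then show "(cmap d \<circ> (k \<circ> h) \<circ> cinv c) differentiable (at (cmap c x))"
    using chain_rule[OF assms *(1) _ *(2,3)] *(4) unfolding differentiable_def comp_apply by blast
qed

lemma chart_deriv_comp:
  assumes h: "diff_map h" "diff_map k" and cde: "c \<in> A" "d \<in> A" "e \<in> A"
    and x: "x \<in> cdom c" "h x \<in> cdom d" "k (h x) \<in> cdom e"
  shows "chart_deriv (k \<circ> h) c e (cmap c x) v = chart_deriv k d e (cmap d (h x)) (chart_deriv h c d (cmap c x) v)"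
  using frechet_derivative_at[OF chain_rule[OF assms]] by (metis comp_apply)

text \<open>A coordinate change is the chart derivative of \<open>id\<close>, so its cocycle rule is
  the chain rule for \<open>id \<circ> id\<close>.\<close>

lemma coord_change_comp:
  "c \<in> A \<Longrightarrow> d \<in> A \<Longrightarrow> e \<in> A \<Longrightarrow> x \<in> cdom c \<Longrightarrow> x \<in> cdom d \<Longrightarrow> x \<in> cdom e \<Longrightarrow>
    coord_change d e x (coord_change c d x v) = coord_change c e x v"
  using chart_deriv_comp[OF diff_map_id diff_map_id, of c d e x v] by (simp add: coord_change_def)

lemma coord_change_refl:
  assumes "c \<in> A" "x \<in> cdom c" shows "coord_change c c x v = v"
proof -
  have "((cmap c \<circ> cinv c) has_derivative id) (at (cmap c x))"
    by (rule has_derivative_transform_within_open[OF has_derivative_ident open_cimage[OF assms(1)], unfolded id_def[symmetric]])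
       (use assms in \<open>auto simp: cinv_cmap\<close>)
  from frechet_derivative_at[OF this, symmetric] show ?thesis by (simp add: coord_change_def)
qed

lemma linear_coord_change:
  "c \<in> A \<Longrightarrow> d \<in> A \<Longrightarrow> x \<in> cdom c \<Longrightarrow> x \<in> cdom d \<Longrightarrow> linear (coord_change c d x)"
  using linear_chart_deriv[OF diff_map_id, of c d x] by (simp add: coord_change_def)

lemma tvec_of_apply: "c \<in> A \<Longrightarrow> x \<in> cdom c \<Longrightarrow> tvec_of A x c v c = v"
  by (simp add: tvec_of_def coord_change_refl)

lemma tvec_of_in: "c \<in> A \<Longrightarrow> x \<in> cdom c \<Longrightarrow> tvec_of A x c v \<in> tangent_space A x"
  by (auto simp: tangent_space_def tvec_of_def coord_change_comp)

lemma tangent_spaceD: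
  "\<xi> \<in> tangent_space A x \<Longrightarrow> c \<in> charts_at A x \<Longrightarrow> d \<in> charts_at A x \<Longrightarrow> \<xi> d = coord_change c d x (\<xi> c)"
  unfolding tangent_space_def by blast

lemma tangent_space_outside: "\<xi> \<in> tangent_space A x \<Longrightarrow> c \<notin> charts_at A x \<Longrightarrow> \<xi> c = 0"
  unfolding tangent_space_def by blast

lemma tangent_space_eq:
  assumes "\<xi> \<in> tangent_space A x" "c \<in> A" "x \<in> cdom c"
  shows "\<xi> = tvec_of A x c (\<xi> c)"
proof
  fix d
  show "\<xi> d = tvec_of A x c (\<xi> c) d"
    using tangent_spaceD[OF assms(1), of c d] tangent_space_outside[OF assms(1), of d] assms(2,3)
    unfolding tvec_of_def in_charts_at by presburger
qed

lemma tangent_space_eqI: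
  assumes "\<xi> \<in> tangent_space A x" "\<eta> \<in> tangent_space A x" "c \<in> A" "x \<in> cdom c" "\<xi> c = \<eta> c"
  shows "\<xi> = \<eta>"
  using tangent_space_eq[OF assms(1,3,4)] tangent_space_eq[OF assms(2,3,4)] assms(5) by simp

lemma tangent_space_add:
  assumes "\<xi> \<in> tangent_space A x" "\<eta> \<in> tangent_space A x"
  shows "(\<lambda>c. \<xi> c + \<eta> c) \<in> tangent_space A x"
  unfolding tangent_space_def
proof (intro CollectI conjI ballI)
  fix c d assume *: "c \<in> charts_at A x" "d \<in> charts_at A x"
  then have "linear (coord_change c d x)" using linear_coord_change by auto
  moreover have "\<xi> d = coord_change c d x (\<xi> c)" "\<eta> d = coord_change c d x (\<eta> c)"
    using assms * by (blast intro: tangent_spaceD)+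
  ultimately show "\<xi> d + \<eta> d = coord_change c d x (\<xi> c + \<eta> c)" by (simp add: linear_add)
qed (simp add: tangent_space_outside[OF assms(1)] tangent_space_outside[OF assms(2)])

lemma tangent_space_scale:
  assumes "\<xi> \<in> tangent_space A x"
  shows "(\<lambda>c. r *\<^sub>R \<xi> c) \<in> tangent_space A x"
  unfolding tangent_space_def
proof (intro CollectI conjI ballI)
  fix c d assume *: "c \<in> charts_at A x" "d \<in> charts_at A x"
  then have "linear (coord_change c d x)" using linear_coord_change by auto
  moreover have "\<xi> d = coord_change c d x (\<xi> c)"
    using assms * by (rule tangent_spaceD)
  ultimately show "r *\<^sub>R \<xi> d = coord_change c d x (r *\<^sub>R \<xi> c)" by (simp add: linear_scale)
qed (simp add: tangent_space_outside[OF assms])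

lemma tvec_of_scale:
  "c \<in> A \<Longrightarrow> x \<in> cdom c \<Longrightarrow> tvec_of A x c (r *\<^sub>R v) = (\<lambda>d. r *\<^sub>R tvec_of A x c v d)"
  by (rule tangent_space_eqI[of _ x _ c]) (auto simp: tvec_of_in tangent_space_scale tvec_of_apply)

lemma tvec_of_add:
  "c \<in> A \<Longrightarrow> x \<in> cdom c \<Longrightarrow> tvec_of A x c (v + w) = (\<lambda>d. tvec_of A x c v d + tvec_of A x c w d)"
  by (rule tangent_space_eqI[of _ x _ c]) (auto simp: tvec_of_in tangent_space_add tvec_of_apply)

lemma tvec_of_nonzero: "c \<in> A \<Longrightarrow> x \<in> cdom c \<Longrightarrow> tvec_of A x c v = (\<lambda>_. 0) \<longleftrightarrow> v = 0"
proof
  assume "c \<in> A" "x \<in> cdom c" "v = 0"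
  then show "tvec_of A x c v = (\<lambda>_. 0)" using tvec_of_scale[of c x 0 0] by simp
qed (metis tvec_of_apply)

lemma tvec_of_change:
  "c \<in> A \<Longrightarrow> x \<in> cdom c \<Longrightarrow> d \<in> A \<Longrightarrow> x \<in> cdom d \<Longrightarrow>
    tvec_of A x c v = tvec_of A x d (coord_change c d x v)"
  by (rule tangent_space_eqI[of _ x _ d]) (auto simp: tvec_of_in tvec_of_apply, simp add: tvec_of_def)

text \<open>Frees the derivative from the chart chosen by \<open>SOME\<close>: composing with
  \<open>id\<close> before and after \<open>h\<close> and applying the chain rule compares any two
  choices of charts.\<close>

lemma tangent_map_eq:
  assumes h: "diff_map h" and c: "c \<in> A" "x \<in> cdom c" and d: "d \<in> A" "h x \<in> cdom d"
    and \<xi>: "\<xi> \<in> tangent_space A x"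
  shows "tangent_map A h x \<xi> = tvec_of A (h x) d (chart_deriv h c d (cmap c x) (\<xi> c))"
proof -
  define c' where "c' = (SOME c. c \<in> charts_at A x)"
  have "c' \<in> charts_at A x" unfolding c'_def using someI[of "\<lambda>c. c \<in> charts_at A x" c] c by simp
  then have c': "c' \<in> A" "x \<in> cdom c'" by auto
  have "chart_deriv h c' e (cmap c' x) (\<xi> c') =
      coord_change d e (h x) (chart_deriv h c d (cmap c x) (\<xi> c))"
    if e: "e \<in> A" "h x \<in> cdom e" for e
  proof -
    have "\<xi> c = coord_change c' c x (\<xi> c')"
      using \<xi> c c' by (intro tangent_spaceD) auto
    moreover have "chart_deriv h c' e (cmap c' x) (\<xi> c') = chart_deriv h c e (cmap c x) (coord_change c' c x (\<xi> c'))"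
      using chart_deriv_comp[OF diff_map_id h c'(1) c(1) e(1), of x "\<xi> c'"] c c' e by (simp add: coord_change_def)
    moreover have "chart_deriv h c e (cmap c x) (\<xi> c) = coord_change d e (h x) (chart_deriv h c d (cmap c x) (\<xi> c))"
      using chart_deriv_comp[OF h diff_map_id c(1) d(1) e(1), of x "\<xi> c"] c d e by (simp add: coord_change_def)
    ultimately show ?thesis by simp
  qed
  then show ?thesis
    unfolding tangent_map_def tvec_of_def Let_def c'_def[symmetric] by (auto simp: fun_eq_iff)
qed

lemma tangent_map_tvec_of:
  assumes "diff_map h" "c \<in> A" "x \<in> cdom c" "d \<in> A" "h x \<in> cdom d"
  shows "tangent_map A h x (tvec_of A x c v) = tvec_of A (h x) d (chart_deriv h c d (cmap c x) v)"
  using tangent_map_eq[OF assms tvec_of_in[OF assms(2,3)]] by (simp add: tvec_of_apply assms)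

lemma tangent_map_in: "diff_map h \<Longrightarrow> \<xi> \<in> tangent_space A x \<Longrightarrow> tangent_map A h x \<xi> \<in> tangent_space A (h x)"
  by (metis chart_exists tangent_map_eq tvec_of_in)

lemma tangent_map_comp:
  assumes "diff_map h" "diff_map k" "\<xi> \<in> tangent_space A x"
  shows "tangent_map A (k \<circ> h) x \<xi> = tangent_map A k (h x) (tangent_map A h x \<xi>)"
proof -
  obtain c where c: "c \<in> A" "x \<in> cdom c" using chart_exists by blast
  obtain d where d: "d \<in> A" "h x \<in> cdom d" using chart_exists by blast
  obtain e where e: "e \<in> A" "k (h x) \<in> cdom e" using chart_exists by blast
  have "tangent_map A k (h x) (tangent_map A h x \<xi>) =
     tvec_of A (k (h x)) e (chart_deriv k d e (cmap d (h x)) (chart_deriv h c d (cmap c x) (\<xi> c)))"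
    unfolding tangent_map_eq[OF assms(1) c d assms(3)] using assms(2) d e by (rule tangent_map_tvec_of)
  then show ?thesis
    using tangent_map_eq[OF diff_map_comp[OF assms(1,2)] c e(1) _ assms(3)]
      chart_deriv_comp[OF assms(1,2) c(1) d(1) e(1) c(2) d(2) e(2)] e by simp
qed

lemma tangent_map_id: "\<xi> \<in> tangent_space A x \<Longrightarrow> tangent_map A id x \<xi> = \<xi>"
proof -
  assume \<xi>: "\<xi> \<in> tangent_space A x"
  obtain c where c: "c \<in> A" "x \<in> cdom c" using chart_exists by blast
  show ?thesis
    using tangent_map_eq[OF diff_map_id c c(1) _ \<xi>] c tangent_space_eq[OF \<xi> c] coord_change_refl[OF c]
    by (simp add: coord_change_def)
qed

lemma tangent_map_scale:
  assumes "diff_map h" "\<xi> \<in> tangent_space A x"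
  shows "tangent_map A h x (\<lambda>c. r *\<^sub>R \<xi> c) = (\<lambda>c. r *\<^sub>R tangent_map A h x \<xi> c)"
proof -
  obtain c where c: "c \<in> A" "x \<in> cdom c" using chart_exists by blast
  obtain d where d: "d \<in> A" "h x \<in> cdom d" using chart_exists by blast
  show ?thesis
    using tangent_map_eq[OF assms(1) c d assms(2)] tangent_map_eq[OF assms(1) c d tangent_space_scale[OF assms(2)], of r]
    by (simp add: tvec_of_scale d linear_scale[OF linear_chart_deriv[OF assms(1) c(1) d(1) c(2) d(2)]])
qed

end


section \<open>The projectivized tangent bundle\<close>

lemma tangent_line_scale: "t \<noteq> 0 \<Longrightarrow> tangent_line (\<lambda>c. t *\<^sub>R \<xi> c) = tangent_line \<xi>"
proof -
  assume t: "t \<noteq> 0"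
  have "(\<lambda>s c. s *\<^sub>R t *\<^sub>R \<xi> c) ` UNIV = (\<lambda>s c. s *\<^sub>R \<xi> c) ` ((\<lambda>s. s * t) ` UNIV)"
    by (simp add: image_image)
  also have "(\<lambda>s. s * t) ` UNIV = UNIV"
    using t by (auto intro!: image_eqI[of _ _ "_ / t"])
  finally show ?thesis by (simp add: tangent_line_def)
qed

lemma tangent_line_eqD:
  assumes "tangent_line \<xi> = tangent_line \<eta>" "\<eta> \<noteq> (\<lambda>_. 0)"
  shows "\<exists>t. t \<noteq> 0 \<and> \<eta> = (\<lambda>c. t *\<^sub>R \<xi> c)"
proof -
  have "\<eta> \<in> tangent_line \<eta>" unfolding tangent_line_def by (auto intro!: image_eqI[of _ _ 1])
  then obtain t where "\<eta> = (\<lambda>c. t *\<^sub>R \<xi> c)" using assms(1) by (auto simp: tangent_line_def)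
  then show ?thesis using assms(2) by (intro exI[of _ t]) auto
qed

context smooth_manifold
begin

text \<open>The part of being a local diffeomorphism that acts on directions: the derivative is
  continuous in charts, and it kills no vector, so that it maps lines to lines. The conditions are
  on whole chart overlaps instead of the unspecified neighbourhoods of
  \<open>C1_local_diffeo\<close>.\<close>

definition regular_map :: "('a \<Rightarrow> 'a) \<Rightarrow> bool" where
  "regular_map h \<longleftrightarrow> diff_map h \<and> (\<forall>c\<in>A. \<forall>d\<in>A.
     (\<forall>v. continuous_on (cmap c ` (cdom c \<inter> h -` cdom d)) (\<lambda>y. chart_deriv h c d y v)) \<and>
     (\<forall>x\<in>cdom c. h x \<in> cdom d \<longrightarrow> (\<forall>v. chart_deriv h c d (cmap c x) v = 0 \<longrightarrow> v = 0)))"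

lemma regular_map_id: "regular_map id"
  unfolding regular_map_def
proof (intro conjI ballI allI impI diff_map_id)
  fix c d v assume "c \<in> A" "d \<in> A"
  then have "Ck_on (Suc 0) (cmap c ` (cdom c \<inter> cdom d)) (cmap d \<circ> cinv c)"
    using smooth_transition[of c d] by (simp only: smooth_on_def)
  then show "continuous_on (cmap c ` (cdom c \<inter> id -` cdom d)) (\<lambda>y. chart_deriv id c d y v)"
    by (simp add: vimage_def)
next
  fix c d x v assume *: "c \<in> A" "d \<in> A" "x \<in> cdom c" "id x \<in> cdom d" "chart_deriv id c d (cmap c x) v = 0"
  then have "coord_change c d x v = 0" by (simp add: coord_change_def)
  moreover have "coord_change d c x 0 = 0"
    using linear_coord_change[of d c x] * by (simp add: linear_0)
  ultimately show "v = 0"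
    using coord_change_comp[of c d c x v] coord_change_refl[of c x v] * by simp
qed

lemma regular_map_C1_local_diffeo:
  assumes "C1_local_diffeo A h" shows "regular_map h"
proof -
  have loc: "\<exists>U. open U \<and> x \<in> U \<and> inj_on h U \<and> open (h ` U) \<and> C1_map_on A U h \<and> C1_map_on A (h ` U) (inv_into U h)" for x
    using assms by (simp add: C1_local_diffeo_def)
  have cont: "continuous_on UNIV h"
    unfolding continuous_on_eq_continuous_at[OF open_UNIV]
    using loc by (metis C1_map_on_def continuous_on_eq_continuous_at)
  have Ck: "\<exists>S. open S \<and> cmap c x \<in> S \<and> Ck_on (Suc 0) S (cmap d \<circ> h \<circ> cinv c)"
    if "c \<in> A" "d \<in> A" "x \<in> cdom c" "h x \<in> cdom d" for c d x
  proof -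
    obtain U where U: "open U" "x \<in> U" "C1_map_on A U h" using loc by blast
    have o: "open (h -` cdom d)" using open_vimage[OF open_cdom[OF that(2)] cont] .
    have "open (cmap c ` (cdom c \<inter> (U \<inter> h -` cdom d)))"
      using that U o by (intro open_chart_image) auto
    moreover have "Ck_on (Suc 0) (cmap c ` (cdom c \<inter> (U \<inter> h -` cdom d))) (cmap d \<circ> h \<circ> cinv c)"
      using U(3) that unfolding C1_map_on_def One_nat_def Int_assoc by blast
    ultimately show ?thesis using that U by blast
  qed
  have dm: "diff_map h"
    unfolding diff_map_def using cont Ck by (fastforce simp del: comp_apply)
  show ?thesis
    unfolding regular_map_def
  proof (intro conjI ballI allI impI dm)
    fix c d v assume cd: "c \<in> A" "d \<in> A"
    have o: "open (h -` cdom d)" using open_vimage[OF open_cdom[OF cd(2)] cont] .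
    show "continuous_on (cmap c ` (cdom c \<inter> h -` cdom d)) (\<lambda>y. chart_deriv h c d y v)"
      unfolding continuous_on_eq_continuous_at[OF open_chart_image[OF cd(1) o]]
    proof clarify
      fix x assume "x \<in> cdom c" "h x \<in> cdom d"
      then obtain S where S: "open S" "cmap c x \<in> S" "Ck_on (Suc 0) S (cmap d \<circ> h \<circ> cinv c)"
        using Ck cd by blast
      then have "continuous_on S (\<lambda>y. chart_deriv h c d y v)" by simp
      then show "isCont (\<lambda>y. chart_deriv h c d y v) (cmap c x)"
        using S continuous_on_eq_continuous_at by blast
    qed
  next
    fix c d x v assume cd: "c \<in> A" "d \<in> A" and x: "x \<in> cdom c" "h x \<in> cdom d"
      and 0: "chart_deriv h c d (cmap c x) v = 0"
    obtain U where U: "open U" "x \<in> U" "inj_on h U" "open (h ` U)" "C1_map_on A (h ` U) (inv_into U h)"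
      using loc by blast
    let ?i = "cmap c \<circ> inv_into U h \<circ> cinv d"
    have ih: "inv_into U h (h x) = x" if "x \<in> U" for x using U(3) that by simp
    have "Ck_on (Suc 0) (cmap d ` (cdom d \<inter> h ` U \<inter> inv_into U h -` cdom c)) ?i"
      using U(5) cd unfolding C1_map_on_def One_nat_def by blast
    moreover have "cmap d (h x) \<in> cmap d ` (cdom d \<inter> h ` U \<inter> inv_into U h -` cdom c)"
      using x U(2) ih[OF U(2)] by auto
    ultimately have "?i differentiable (at (cmap d (h x)))" unfolding Ck_on.simps by blast
    then obtain D where D: "(?i has_derivative D) (at (cmap d (h x)))" by (auto simp: differentiable_def)
    \<comment> \<open>Injectivity of the derivative comes from the local inverse: the chain rule
      makes its derivative a left inverse, because the composition is the identity near the
      point.\<close>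
    have "((?i \<circ> (cmap d \<circ> h \<circ> cinv c)) has_derivative (D \<circ> chart_deriv h c d (cmap c x))) (at (cmap c x))"
      using D diff_map_deriv[OF dm cd x] by (intro diff_chain_at) (auto simp: cinv_cmap cd x)
    moreover have "((?i \<circ> (cmap d \<circ> h \<circ> cinv c)) has_derivative id) (at (cmap c x))"
    proof (rule has_derivative_transform_within_open[OF has_derivative_ident[unfolded id_def[symmetric]]])
      have "open (h -` cdom d)" using open_vimage[OF open_cdom[OF cd(2)] cont] .
      then have "open (U \<inter> h -` cdom d)" using U(1) by (rule open_Int[rotated])
      then show "open (cmap c ` (cdom c \<inter> (U \<inter> h -` cdom d)))" using cd(1) by (rule open_chart_image[rotated])
      show "cmap c x \<in> cmap c ` (cdom c \<inter> (U \<inter> h -` cdom d))" using x U(2) by auto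
      fix y assume "y \<in> cmap c ` (cdom c \<inter> (U \<inter> h -` cdom d))"
      then obtain x' where "x' \<in> cdom c" "x' \<in> U" "h x' \<in> cdom d" "y = cmap c x'" by auto
      then show "id y = (?i \<circ> (cmap d \<circ> h \<circ> cinv c)) y" using cd by (simp add: cinv_cmap ih)
    qed
    ultimately have "D \<circ> chart_deriv h c d (cmap c x) = id" by (rule has_derivative_unique)
    then have "D (chart_deriv h c d (cmap c x) v) = v" by (metis comp_apply id_apply)
    moreover have "D 0 = 0" using has_derivative_linear[OF D] by (rule linear_0)
    ultimately show "v = 0" using 0 by simp
  qed
qed

section \<open>Bundle charts and maps between lines\<close>

definition bundle_dom :: "('a, 'e) chart \<Rightarrow> ('e \<times> 'e) set" where
  "bundle_dom c = {z. fst z \<in> cimage c \<and> snd z \<noteq> 0}"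

text \<open>Not a chart of the projective bundle but a quotient map onto a part of it: nonzero
  multiples of a vector give the same point. Working with vectors avoids affine charts of projective
  space.\<close>

definition bundle_pt :: "('a, 'e) chart \<Rightarrow> 'e \<times> 'e \<Rightarrow> ('a, 'e) pvec" where
  "bundle_pt c z = (cinv c (fst z), tangent_line (tvec_of A (cinv c (fst z)) c (snd z)))"

definition bundle_rep :: "('a \<Rightarrow> 'a) \<Rightarrow> ('a, 'e) chart \<Rightarrow> ('a, 'e) chart \<Rightarrow> 'e \<times> 'e \<Rightarrow> 'e \<times> 'e" where
  "bundle_rep h c d z = (cmap d (h (cinv c (fst z))), chart_deriv h c d (fst z) (snd z))"

definition rep_dom :: "('a \<Rightarrow> 'a) \<Rightarrow> ('a, 'e) chart \<Rightarrow> ('a, 'e) chart \<Rightarrow> ('e \<times> 'e) set" where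
  "rep_dom h c d = {z. fst z \<in> cmap c ` (cdom c \<inter> h -` cdom d)}"

lemma fst_bundle_pt [simp]: "fst (bundle_pt c z) = cinv c (fst z)"
  by (simp add: bundle_pt_def)

lemma proj_open_iff:
  "proj_open A U \<longleftrightarrow> U \<subseteq> proj_bundle A UNIV \<and> (\<forall>c\<in>A. open {z \<in> bundle_dom c. bundle_pt c z \<in> U})"
  unfolding proj_open_def bundle_dom_def bundle_pt_def by (simp add: case_prod_beta' conj_assoc)

lemma open_bundle_dom: "c \<in> A \<Longrightarrow> open (bundle_dom c)"
proof -
  assume c: "c \<in> A"
  have "bundle_dom c = cimage c \<times> (- {0})" by (auto simp: bundle_dom_def)
  then show ?thesis using open_cimage[OF c] by (auto intro: open_Times)
qed

lemma open_rep_dom: "regular_map h \<Longrightarrow> c \<in> A \<Longrightarrow> d \<in> A \<Longrightarrow> open (rep_dom h c d)"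
proof -
  assume *: "regular_map h" "c \<in> A" "d \<in> A"
  then have "continuous_on UNIV h" by (simp add: regular_map_def diff_map_def)
  with open_cdom[OF *(3)] have "open (h -` cdom d)" by (rule open_vimage)
  with *(2) have "open (cmap c ` (cdom c \<inter> h -` cdom d))" by (rule open_chart_image)
  then show ?thesis unfolding rep_dom_def by (intro open_vimage_fst[unfolded vimage_def])
qed

lemma rep_domD:
  assumes "c \<in> A" "z \<in> rep_dom h c d"
  shows "cinv c (fst z) \<in> cdom c" "h (cinv c (fst z)) \<in> cdom d" "cmap c (cinv c (fst z)) = fst z" "fst z \<in> cimage c"
  using assms by (auto simp: rep_dom_def cinv_cmap)

lemma rep_domI: "fst z \<in> cimage c \<Longrightarrow> h (cinv c (fst z)) \<in> cdom d \<Longrightarrow> z \<in> rep_dom h c d"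
  unfolding rep_dom_def mem_Collect_eq
  by (rule image_eqI[of _ _ "cinv c (fst z)"]) (auto simp: cmap_cinv cinv_in)

lemma bundle_rep_cont:
  assumes h: "regular_map h" and cd: "c \<in> A" "d \<in> A"
  shows "continuous_on (rep_dom h c d) (bundle_rep h c d)"
proof -
  let ?S = "cmap c ` (cdom c \<inter> h -` cdom d)"
  have dm: "diff_map h" using h by (simp add: regular_map_def)
  have S: "rep_dom h c d = ?S \<times> UNIV" by (auto simp: rep_dom_def)
  have "continuous_on ?S (cmap d \<circ> h \<circ> cinv c)"
    by (rule continuous_at_imp_continuous_on) (auto intro!: has_derivative_continuous[OF diff_map_deriv[OF dm cd]])
  then have 1: "continuous_on (?S \<times> UNIV) (\<lambda>z. (cmap d \<circ> h \<circ> cinv c) (fst z))"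
    by (rule continuous_on_compose2) (auto intro!: continuous_intros)
  have 2: "continuous_on (?S \<times> UNIV) (\<lambda>z. chart_deriv h c d (fst z) (snd z))"
  proof (rule continuous_on_joint_linear)
    show "linear (chart_deriv h c d y)" if "y \<in> ?S" for y
      using that linear_chart_deriv[OF dm cd] by blast
    show "continuous_on ?S (\<lambda>y. chart_deriv h c d y v)" for v
      using h cd unfolding regular_map_def by blast
  qed
  show ?thesis unfolding S bundle_rep_def[abs_def] using continuous_on_Pair[OF 1 2] by simp
qed

lemma bundle_rep_in:
  assumes h: "regular_map h" and cd: "c \<in> A" "d \<in> A" and z: "z \<in> rep_dom h c d" "z \<in> bundle_dom c"
  shows "bundle_rep h c d z \<in> bundle_dom d"
proof -
  note D = rep_domD[OF cd(1) z(1)]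
  have "chart_deriv h c d (cmap c (cinv c (fst z))) (snd z) \<noteq> 0"
    using h cd D(1,2) z(2) unfolding regular_map_def bundle_dom_def by blast
  then show ?thesis using D by (simp add: bundle_rep_def bundle_dom_def)
qed

lemma proj_map_pt:
  assumes h: "diff_map h" and cd: "c \<in> A" "d \<in> A" and z: "z \<in> rep_dom h c d"
  shows "proj_map A h (bundle_pt c z) = bundle_pt d (bundle_rep h c d z)"
proof -
  note D = rep_domD[OF cd(1) z(1)]
  let ?x = "cinv c (fst z)"
  have "tangent_map A h ?x ` tangent_line (tvec_of A ?x c (snd z)) =
      tangent_line (tangent_map A h ?x (tvec_of A ?x c (snd z)))"
    unfolding tangent_line_def image_image
    by (simp add: tangent_map_scale[OF h tvec_of_in[OF cd(1) D(1)]])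
  then show ?thesis
    using tangent_map_tvec_of[OF h cd(1) D(1) cd(2) D(2)] D
    by (simp add: proj_map_def bundle_pt_def bundle_rep_def cinv_cmap cd)
qed

lemma bundle_pt_change:
  assumes cd: "c \<in> A" "d \<in> A" and z: "z \<in> rep_dom id c d"
  shows "bundle_pt c z = bundle_pt d (bundle_rep id c d z)"
proof -
  note D = rep_domD[OF cd(1) z(1), simplified]
  show ?thesis
    using tvec_of_change[OF cd(1) D(1) cd(2) D(2), of "snd z"] D
    by (simp add: bundle_pt_def bundle_rep_def cinv_cmap cd coord_change_def)
qed

lemma bundle_pt_eq_iff:
  assumes c: "c \<in> A" and z: "z \<in> bundle_dom c" "z' \<in> bundle_dom c"
  shows "bundle_pt c z = bundle_pt c z' \<longleftrightarrow> fst z = fst z' \<and> (\<exists>t. t \<noteq> 0 \<and> snd z' = t *\<^sub>R snd z)"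
proof
  let ?x = "cinv c (fst z)"
  have x: "?x \<in> cdom c" using z by (simp add: bundle_dom_def cinv_in)
  {
    assume eq: "bundle_pt c z = bundle_pt c z'"
    then have "cinv c (fst z) = cinv c (fst z')" by (simp add: bundle_pt_def)
    then have f: "fst z = fst z'" using z cmap_cinv unfolding bundle_dom_def by (metis (mono_tags, lifting) mem_Collect_eq)
    have "tangent_line (tvec_of A ?x c (snd z)) = tangent_line (tvec_of A ?x c (snd z'))"
      using eq f by (simp add: bundle_pt_def)
    moreover have "tvec_of A ?x c (snd z') \<noteq> (\<lambda>_. 0)"
      using tvec_of_nonzero[OF c x] z by (simp add: bundle_dom_def)
    ultimately obtain t where t: "t \<noteq> 0" "tvec_of A ?x c (snd z') = (\<lambda>d. t *\<^sub>R tvec_of A ?x c (snd z) d)"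
      using tangent_line_eqD by blast
    from fun_cong[OF t(2), of c] have "snd z' = t *\<^sub>R snd z" by (simp add: tvec_of_apply c x)
    then show "fst z = fst z' \<and> (\<exists>t. t \<noteq> 0 \<and> snd z' = t *\<^sub>R snd z)" using t f by blast
  }
  assume "fst z = fst z' \<and> (\<exists>t. t \<noteq> 0 \<and> snd z' = t *\<^sub>R snd z)"
  then obtain t where "fst z' = fst z" "t \<noteq> 0" "snd z' = t *\<^sub>R snd z" by auto
  then show "bundle_pt c z = bundle_pt c z'"
    by (simp add: bundle_pt_def tvec_of_scale[OF c x] tangent_line_scale)
qed

lemma bundle_pt_in:
  assumes "c \<in> A" "z \<in> bundle_dom c" shows "bundle_pt c z \<in> proj_bundle A UNIV"
proof -
  have "cinv c (fst z) \<in> cdom c" "snd z \<noteq> 0" using assms(2) by (auto simp: bundle_dom_def cinv_in)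
  then have "tvec_of A (cinv c (fst z)) c (snd z) \<in> tangent_space A (cinv c (fst z))"
    "tvec_of A (cinv c (fst z)) c (snd z) \<noteq> (\<lambda>_. 0)"
    using tvec_of_in tvec_of_nonzero assms(1) by blast+
  then show ?thesis unfolding proj_bundle_def bundle_pt_def by blast
qed

lemma bundle_pt_ex:
  assumes "w \<in> proj_bundle A UNIV" "c \<in> A" "fst w \<in> cdom c"
  obtains z where "z \<in> bundle_dom c" "w = bundle_pt c z" "fst z = cmap c (fst w)"
proof -
  obtain x \<xi> where w: "w = (x, tangent_line \<xi>)" "\<xi> \<in> tangent_space A x" "\<xi> \<noteq> (\<lambda>_. 0)"
    using assms(1) by (auto simp: proj_bundle_def)
  have x: "x \<in> cdom c" using assms(3) w by simp
  have "\<xi> = tvec_of A x c (\<xi> c)" using tangent_space_eq w(2) assms(2) x by blast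
  then have "\<xi> c \<noteq> 0" using w(3) tvec_of_nonzero[OF assms(2) x] by metis
  then show ?thesis
    using that[of "(cmap c x, \<xi> c)"] x \<open>\<xi> = _\<close> w(1) assms(2)
    by (simp add: bundle_dom_def bundle_pt_def cinv_cmap)
qed

lemma topspace_proj: "topspace (proj_topology A) = proj_bundle A UNIV"
proof -
  have "proj_open A (proj_bundle A UNIV)"
    unfolding proj_open_iff
  proof (intro conjI ballI)
    fix c assume c: "c \<in> A"
    have "{z \<in> bundle_dom c. bundle_pt c z \<in> proj_bundle A UNIV} = bundle_dom c"
      using bundle_pt_in[OF c] by auto
    then show "open {z \<in> bundle_dom c. bundle_pt c z \<in> proj_bundle A UNIV}"
      using open_bundle_dom[OF c] by simp
  qed auto
  then have "openin (proj_topology A) (proj_bundle A UNIV)" by (simp add: openin_proj_topology)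
  moreover have "topspace (proj_topology A) \<subseteq> proj_bundle A UNIV"
    using openin_topspace[of "proj_topology A"] by (simp add: openin_proj_topology proj_open_def)
  ultimately show ?thesis using openin_subset by blast
qed

lemma bundle_pt_cont: "c \<in> A \<Longrightarrow> continuous_map (top_of_set (bundle_dom c)) (proj_topology A) (bundle_pt c)"
  unfolding continuous_map_def
proof (intro conjI allI impI)
  assume c: "c \<in> A"
  show "bundle_pt c \<in> topspace (top_of_set (bundle_dom c)) \<rightarrow> topspace (proj_topology A)"
    using bundle_pt_in[OF c] by (auto simp: topspace_proj)
  fix U assume "openin (proj_topology A) U"
  then have "open {z \<in> bundle_dom c. bundle_pt c z \<in> U}"
    using c by (simp add: openin_proj_topology proj_open_iff)
  then show "openin (top_of_set (bundle_dom c)) {z \<in> topspace (top_of_set (bundle_dom c)). bundle_pt c z \<in> U}"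
    using openin_open_eq[OF open_bundle_dom[OF c]] by auto
qed

text \<open>The universal property of the quotient topology, tested in bundle charts.\<close>

lemma continuous_map_projI:
  assumes "\<And>c. c \<in> A \<Longrightarrow> continuous_map (top_of_set (bundle_dom c)) Z (\<lambda>z. H (bundle_pt c z))"
  shows "continuous_map (proj_topology A) Z H"
  unfolding continuous_map_def
proof (intro conjI allI impI)
  show "H \<in> topspace (proj_topology A) \<rightarrow> topspace Z"
  proof
    fix w assume w: "w \<in> topspace (proj_topology A)"
    obtain c where c: "c \<in> A" "fst w \<in> cdom c" using chart_exists by blast
    obtain z where "z \<in> bundle_dom c" "w = bundle_pt c z"
      using bundle_pt_ex w c unfolding topspace_proj by metis
    then show "H w \<in> topspace Z" using continuous_map_funspace[OF assms[OF c(1)]] by auto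
  qed
  fix V assume V: "openin Z V"
  show "openin (proj_topology A) {w \<in> topspace (proj_topology A). H w \<in> V}"
    unfolding openin_proj_topology proj_open_iff topspace_proj
  proof (intro conjI ballI)
    fix c assume c: "c \<in> A"
    have "openin (top_of_set (bundle_dom c)) {z \<in> topspace (top_of_set (bundle_dom c)). H (bundle_pt c z) \<in> V}"
      using assms[OF c] V unfolding continuous_map_def by blast
    then have "open {z \<in> bundle_dom c. H (bundle_pt c z) \<in> V}"
      using openin_open_eq[OF open_bundle_dom[OF c]] by auto
    moreover have "{z \<in> bundle_dom c. bundle_pt c z \<in> {w \<in> proj_bundle A UNIV. H w \<in> V}} = {z \<in> bundle_dom c. H (bundle_pt c z) \<in> V}"
      using bundle_pt_in[OF c] by auto
    ultimately show "open {z \<in> bundle_dom c. bundle_pt c z \<in> {w \<in> proj_bundle A UNIV. H w \<in> V}}" by simp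
  qed auto
qed

text \<open>The vectors spanning a line in the image of \<open>W\<close> are the nonzero multiples
  of the vectors in \<open>W\<close>. In another chart they form a union, over all nonzero factors,
  of preimages of \<open>W\<close> under continuous maps.\<close>

lemma bundle_pt_open:
  assumes c: "c \<in> A" and W: "open W" "W \<subseteq> bundle_dom c"
  shows "openin (proj_topology A) (bundle_pt c ` W)"
  unfolding openin_proj_topology proj_open_iff
proof (intro conjI ballI)
  show "bundle_pt c ` W \<subseteq> proj_bundle A UNIV" using W bundle_pt_in[OF c] by auto
  fix d assume d: "d \<in> A"
  let ?sc = "\<lambda>t z. (fst z, t *\<^sub>R snd z)"
  have "{z \<in> bundle_dom d. bundle_pt d z \<in> bundle_pt c ` W} =
     (\<Union>t\<in>-{0}. (rep_dom id d c \<inter> (\<lambda>z. ?sc t (bundle_rep id d c z)) -` W) \<inter> bundle_dom d)"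
  proof (intro equalityI subsetI)
    fix z assume "z \<in> {z \<in> bundle_dom d. bundle_pt d z \<in> bundle_pt c ` W}"
    then obtain w where z: "z \<in> bundle_dom d" and w: "w \<in> W" "bundle_pt d z = bundle_pt c w" by auto
    have wd: "w \<in> bundle_dom c" using w W by auto
    have "cinv d (fst z) = cinv c (fst w)" using w(2) by (simp add: bundle_pt_def)
    then have zr: "z \<in> rep_dom id d c"
      using z wd by (intro rep_domI) (auto simp: bundle_dom_def cinv_in)
    have "bundle_pt c (bundle_rep id d c z) = bundle_pt c w"
      using bundle_pt_change[OF d c zr] w by simp
    then obtain t where "t \<noteq> 0" "w = ?sc t (bundle_rep id d c z)"
      using bundle_pt_eq_iff[OF c bundle_rep_in[OF regular_map_id d c zr z] wd] by (auto simp: prod_eq_iff)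
    then show "z \<in> (\<Union>t\<in>-{0}. (rep_dom id d c \<inter> (\<lambda>z. ?sc t (bundle_rep id d c z)) -` W) \<inter> bundle_dom d)"
      using zr z w by auto
  next
    fix z assume "z \<in> (\<Union>t\<in>-{0}. (rep_dom id d c \<inter> (\<lambda>z. ?sc t (bundle_rep id d c z)) -` W) \<inter> bundle_dom d)"
    then obtain t where t: "t \<noteq> 0" "z \<in> rep_dom id d c" "?sc t (bundle_rep id d c z) \<in> W" "z \<in> bundle_dom d" by auto
    have "bundle_pt c (bundle_rep id d c z) = bundle_pt c (?sc t (bundle_rep id d c z))"
      using t W by (subst bundle_pt_eq_iff[OF c bundle_rep_in[OF regular_map_id d c]]) auto
    then show "z \<in> {z \<in> bundle_dom d. bundle_pt d z \<in> bundle_pt c ` W}"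
      using t bundle_pt_change[OF d c t(2)] by auto
  qed
  also have "open \<dots>"
  proof (intro open_UN ballI open_Int[OF _ open_bundle_dom[OF d]])
    fix t
    show "open (rep_dom id d c \<inter> (\<lambda>z. ?sc t (bundle_rep id d c z)) -` W)"
      by (intro continuous_open_preimage continuous_on_Pair continuous_on_fst continuous_on_snd continuous_on_scaleR
        continuous_on_const bundle_rep_cont regular_map_id d c open_rep_dom W)
  qed
  finally show "open {z \<in> bundle_dom d. bundle_pt d z \<in> bundle_pt c ` W}" .
qed

lemma proj_map_cont:
  assumes h: "regular_map h"
  shows "continuous_map (proj_topology A) (proj_topology A) (proj_map A h)"
proof (rule continuous_map_projI)
  fix c assume c: "c \<in> A"
  have dm: "diff_map h" using h by (simp add: regular_map_def)
  have ex: "\<exists>d\<in>A. z \<in> rep_dom h c d" if "z \<in> bundle_dom c" for z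
    using that chart_exists[of "h (cinv c (fst z))"] by (auto intro: rep_domI simp: bundle_dom_def)
  have pm: "proj_map A h (bundle_pt c z) = bundle_pt d (bundle_rep h c d z)" if "d \<in> A" "z \<in> rep_dom h c d" for d z
    using proj_map_pt[OF dm c that] .
  show "continuous_map (top_of_set (bundle_dom c)) (proj_topology A) (\<lambda>z. proj_map A h (bundle_pt c z))"
    unfolding continuous_map_def
  proof (intro conjI allI impI)
    show "(\<lambda>z. proj_map A h (bundle_pt c z)) \<in> topspace (top_of_set (bundle_dom c)) \<rightarrow> topspace (proj_topology A)"
    proof
      fix z assume "z \<in> topspace (top_of_set (bundle_dom c))"
      then have z: "z \<in> bundle_dom c" by simp
      obtain d where d: "d \<in> A" "z \<in> rep_dom h c d" using ex[OF z] by blast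
      show "proj_map A h (bundle_pt c z) \<in> topspace (proj_topology A)"
        unfolding pm[OF d] topspace_proj by (rule bundle_pt_in[OF d(1) bundle_rep_in[OF h c d z]])
    qed
    fix U assume U: "openin (proj_topology A) U"
    let ?V = "\<lambda>d. {z \<in> bundle_dom d. bundle_pt d z \<in> U}"
    have V: "open (?V d)" if "d \<in> A" for d using U that by (simp add: openin_proj_topology proj_open_iff)
    have "{z \<in> bundle_dom c. proj_map A h (bundle_pt c z) \<in> U} =
       (\<Union>d\<in>A. (rep_dom h c d \<inter> bundle_rep h c d -` ?V d) \<inter> bundle_dom c)"
    proof (intro equalityI subsetI)
      fix z assume "z \<in> {z \<in> bundle_dom c. proj_map A h (bundle_pt c z) \<in> U}"
      then have z: "z \<in> bundle_dom c" "proj_map A h (bundle_pt c z) \<in> U" by auto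
      obtain d where d: "d \<in> A" "z \<in> rep_dom h c d" using ex[OF z(1)] by blast
      then show "z \<in> (\<Union>d\<in>A. (rep_dom h c d \<inter> bundle_rep h c d -` ?V d) \<inter> bundle_dom c)"
        using z pm[OF d] bundle_rep_in[OF h c d z(1)] by auto
    next
      fix z assume "z \<in> (\<Union>d\<in>A. (rep_dom h c d \<inter> bundle_rep h c d -` ?V d) \<inter> bundle_dom c)"
      then obtain d where d: "d \<in> A" "z \<in> rep_dom h c d" "bundle_pt d (bundle_rep h c d z) \<in> U" "z \<in> bundle_dom c"
        by auto
      then show "z \<in> {z \<in> bundle_dom c. proj_map A h (bundle_pt c z) \<in> U}"
        using pm[OF d(1,2)] by simp
    qed
    also have "open \<dots>"
      by (intro open_UN ballI open_Int continuous_open_preimage bundle_rep_cont open_rep_dom h c V open_bundle_dom)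
    finally show "openin (top_of_set (bundle_dom c)) {z \<in> topspace (top_of_set (bundle_dom c)). proj_map A h (bundle_pt c z) \<in> U}"
      using openin_open_eq[OF open_bundle_dom[OF c]] by auto
  qed
qed

lemma proj_map_bundle:
  assumes "regular_map h" "h ` X \<subseteq> X" "w \<in> proj_bundle A X"
  shows "proj_map A h w \<in> proj_bundle A X"
proof -
  have "w \<in> proj_bundle A UNIV" using assms(3) by (auto simp: proj_bundle_def)
  then have "proj_map A h w \<in> proj_bundle A UNIV"
    using continuous_map_funspace[OF proj_map_cont[OF assms(1)]] by (auto simp: topspace_proj)
  moreover have "fst (proj_map A h w) \<in> X" using assms(2,3) by (auto simp: proj_bundle_def proj_map_def)
  ultimately show ?thesis by (auto simp: proj_bundle_def)
qed

end


section \<open>Topology of the bundle and its compact parts\<close>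

context smooth_manifold
begin

lemma fst_proj_cont: "continuous_map (proj_topology A) euclidean fst"
proof (rule continuous_map_projI)
  fix c assume c: "c \<in> A"
  have "continuous_on (bundle_dom c) (\<lambda>z. cinv c (fst z))"
    by (rule continuous_on_compose2[OF continuous_cinv[OF c]])
       (auto simp: bundle_dom_def intro!: continuous_intros)
  then show "continuous_map (top_of_set (bundle_dom c)) euclidean (\<lambda>z. fst (bundle_pt c z))"
    by simp
qed

lemma open_cinv_image: 
  assumes "c \<in> A" "open V" "V \<subseteq> cimage c" shows "open (cinv c ` V)"
proof -
  have "cinv c ` V = cdom c \<inter> cmap c -` V"
  proof (intro equalityI subsetI)
    fix x assume "x \<in> cinv c ` V"
    then obtain y where y: "y \<in> V" "x = cinv c y" by auto
    then have "y \<in> cimage c" using assms(3) by blast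
    then show "x \<in> cdom c \<inter> cmap c -` V" using y cinv_in[of y c] cmap_cinv[of y c] by auto
  next
    fix x assume "x \<in> cdom c \<inter> cmap c -` V"
    then show "x \<in> cinv c ` V" using cinv_cmap[OF assms(1), of x] by (intro image_eqI[of _ _ "cmap c x"]) auto
  qed
  then show ?thesis
    using continuous_open_preimage[OF continuous_cmap[OF assms(1)] open_cdom[OF assms(1)] assms(2)] by simp
qed

text \<open>In a bundle chart the projection forgets the vector component of an open set in a
  product, and such a projection is open.\<close>

lemma proj_open_base: "proj_open A U \<Longrightarrow> open (fst ` U)"
proof -
  assume U: "proj_open A U"
  let ?V = "\<lambda>c. {z \<in> bundle_dom c. bundle_pt c z \<in> U}"
  have "fst ` U = (\<Union>c\<in>A. cinv c ` fst ` ?V c)"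
  proof (intro equalityI subsetI)
    fix x assume "x \<in> fst ` U"
    then obtain w where w: "w \<in> U" "x = fst w" by auto
    obtain c where c: "c \<in> A" "fst w \<in> cdom c" using chart_exists by blast
    have "w \<in> proj_bundle A UNIV" using U w by (auto simp: proj_open_def)
    then obtain z where "z \<in> bundle_dom c" "w = bundle_pt c z" using bundle_pt_ex c by metis
    then have "z \<in> ?V c" "x = cinv c (fst z)" using w by auto
    then show "x \<in> (\<Union>c\<in>A. cinv c ` fst ` ?V c)" using c by blast
  next
    fix x assume "x \<in> (\<Union>c\<in>A. cinv c ` fst ` ?V c)"
    then obtain c z where "c \<in> A" "z \<in> ?V c" "x = cinv c (fst z)" by blast
    then have "bundle_pt c z \<in> U" "x = fst (bundle_pt c z)" by auto
    then show "x \<in> fst ` U" by blast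
  qed
  also have "open \<dots>"
  proof (intro open_UN ballI)
    fix c assume c: "c \<in> A"
    have "open (?V c)" using U c by (simp add: proj_open_iff)
    then show "open (cinv c ` fst ` ?V c)"
      by (intro open_cinv_image c open_image_fst) (auto simp: bundle_dom_def)
  qed
  finally show ?thesis .
qed

lemma proj_bundle_Int: "proj_bundle A X = proj_bundle A UNIV \<inter> fst -` X"
  by (auto simp: proj_bundle_def)

lemma topspace_proj_sub: "topspace (subtopology (proj_topology A) (proj_bundle A X)) = proj_bundle A X"
  by (auto simp: topspace_proj proj_bundle_def)

lemma fst_proj_sub_cont:
  "continuous_map (subtopology (proj_topology A) (proj_bundle A X)) (top_of_set X) fst"
  using fst_proj_cont
  by (auto simp: continuous_map_in_subtopology continuous_map_from_subtopology topspace_proj proj_bundle_def)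

lemma fst_proj_sub_open:
  "open_map (subtopology (proj_topology A) (proj_bundle A X)) (top_of_set X) fst"
  unfolding open_map_def
proof (intro allI impI)
  fix U assume "openin (subtopology (proj_topology A) (proj_bundle A X)) U"
  then obtain V where V: "proj_open A V" "U = V \<inter> proj_bundle A X"
    by (auto simp: openin_subtopology openin_proj_topology)
  have "V \<subseteq> proj_bundle A UNIV" using V by (simp add: proj_open_def)
  then have "fst ` U = fst ` V \<inter> X" unfolding V(2) proj_bundle_Int[of X] by auto
  then show "openin (top_of_set X) (fst ` U)"
    using proj_open_base[OF V(1)] by (auto simp: openin_open)
qed

text \<open>Every fibre contains a line because a Euclidean space has a nonempty basis, so the
  dimension is at least one.\<close>

lemma fst_proj_bundle: "fst ` proj_bundle A X = X"
proof
  show "X \<subseteq> fst ` proj_bundle A X"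
  proof
    fix x assume x: "x \<in> X"
    obtain c where c: "c \<in> A" "x \<in> cdom c" using chart_exists by blast
    obtain v :: 'e where "v \<noteq> 0" using nonzero_Basis SOME_Basis by blast
    then have "(x, tangent_line (tvec_of A x c v)) \<in> proj_bundle A X"
      using tvec_of_in[OF c] tvec_of_nonzero[OF c] x unfolding proj_bundle_def by blast
    then show "x \<in> fst ` proj_bundle A X" by force
  qed
qed (auto simp: proj_bundle_def)

lemma Hausdorff_proj: "Hausdorff_space (proj_topology A)"
  unfolding Hausdorff_space_def
proof (intro allI impI)
  fix w1 w2 assume w: "w1 \<in> topspace (proj_topology A) \<and> w2 \<in> topspace (proj_topology A) \<and> w1 \<noteq> w2"
  show "\<exists>U V. openin (proj_topology A) U \<and> openin (proj_topology A) V \<and> w1 \<in> U \<and> w2 \<in> V \<and> disjnt U V"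
  proof (cases "fst w1 = fst w2")
    case False
    then obtain U V where UV: "open U" "open V" "fst w1 \<in> U" "fst w2 \<in> V" "U \<inter> V = {}"
      using hausdorff[OF False] by blast
    let ?W = "\<lambda>U. {w \<in> topspace (proj_topology A). fst w \<in> U}"
    have o: "openin (proj_topology A) (?W U)" if "open U" for U
      using openin_continuous_map_preimage[OF fst_proj_cont] that by simp
    show ?thesis
      using o[OF UV(1)] o[OF UV(2)] UV(3-5) w by (intro exI[of _ "?W U"] exI[of _ "?W V"]) (auto simp: disjnt_def)
  next
    case True
    obtain c where c: "c \<in> A" "fst w1 \<in> cdom c" using chart_exists by blast
    have w': "w1 \<in> proj_bundle A UNIV" "w2 \<in> proj_bundle A UNIV" using w by (auto simp: topspace_proj)
    obtain z1 where z1: "z1 \<in> bundle_dom c" "w1 = bundle_pt c z1" "fst z1 = cmap c (fst w1)"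
      using bundle_pt_ex[OF w'(1) c] by blast
    obtain z2 where z2: "z2 \<in> bundle_dom c" "w2 = bundle_pt c z2" "fst z2 = cmap c (fst w2)"
      using bundle_pt_ex[OF w'(2) c(1)] c(2) True by metis
    define v1 v2 where "v1 = snd z1" and "v2 = snd z2"
    have v: "v1 \<noteq> 0" "v2 \<noteq> 0" using z1(1) z2(1) by (auto simp: v1_def v2_def bundle_dom_def)
    have np: "v2 \<noteq> t *\<^sub>R v1" for t
    proof
      assume t: "v2 = t *\<^sub>R v1"
      then have "t \<noteq> 0" using v by auto
      moreover have "fst z1 = fst z2" using z1(3) z2(3) True by simp
      ultimately have "bundle_pt c z1 = bundle_pt c z2"
        using bundle_pt_eq_iff[OF c(1) z1(1) z2(1)] t unfolding v1_def v2_def by blast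
      then show False using w z1(2) z2(2) by blast
    qed
    \<comment> \<open>\<open>k v / n v\<close> is the squared cosine of the angle between
      \<open>v\<close> and \<open>v1\<close>. Both functions are homogeneous of degree two, so
      comparing \<open>k\<close> with a multiple of \<open>n\<close> is a condition on
      lines.\<close>
    define n where "n v = (v \<bullet> v) * (v1 \<bullet> v1)" for v :: 'e
    define k where "k v = (v \<bullet> v1)\<^sup>2" for v
    have "\<bar>v2 \<bullet> v1\<bar> \<noteq> norm v2 * norm v1"
    proof
      assume "\<bar>v2 \<bullet> v1\<bar> = norm v2 * norm v1"
      then have "collinear {0, v1, v2}"
        by (simp add: norm_cauchy_schwarz_equal[symmetric] inner_commute mult.commute)
      then show False using np v by (auto simp: collinear_lemma)
    qed
    then have "\<bar>v2 \<bullet> v1\<bar> < norm v2 * norm v1" using Cauchy_Schwarz_ineq2[of v2 v1] by simp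
    then have "\<bar>v2 \<bullet> v1\<bar>\<^sup>2 < (norm v2 * norm v1)\<^sup>2" by (intro power_strict_mono) auto
    then have k2: "k v2 < n v2" by (simp add: k_def n_def power_mult_distrib dot_square_norm)
    have k1: "k v1 = n v1" by (simp add: k_def n_def power2_eq_square)
    have npos: "n v > 0" if "v \<noteq> 0" for v using that v by (simp add: n_def)
    \<comment> \<open>The threshold lies midway between the squared cosine at \<open>v2\<close>,
      which is below 1 by strict Cauchy-Schwarz, and its value 1 at \<open>v1\<close>.\<close>
    define m where "m = (1 + k v2 / n v2) / 2"
    have m: "k v2 < m * n v2" "m * n v1 < k v1"
      using k2 npos[OF v(2)] npos[OF v(1)] by (auto simp: m_def k1 field_simps)
    define W1 where "W1 = bundle_dom c \<inter> {z. m * n (snd z) < k (snd z)}"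
    define W2 where "W2 = bundle_dom c \<inter> {z. k (snd z) < m * n (snd z)}"
    have "open W1" "open W2"
      unfolding W1_def W2_def n_def k_def
      by (intro open_Int open_bundle_dom c open_Collect_less continuous_intros)+
    then have "openin (proj_topology A) (bundle_pt c ` W1)" "openin (proj_topology A) (bundle_pt c ` W2)"
      by (auto intro!: bundle_pt_open c simp: W1_def W2_def)
    moreover have "w1 \<in> bundle_pt c ` W1" "w2 \<in> bundle_pt c ` W2"
      unfolding z1(2) z2(2) using z1(1) z2(1) m
      by (auto simp: W1_def W2_def v1_def v2_def intro!: imageI)
    moreover have "disjnt (bundle_pt c ` W1) (bundle_pt c ` W2)"
    proof -
      have False if z: "z \<in> W1" "z' \<in> W2" "bundle_pt c z = bundle_pt c z'" for z z'
      proof -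
        obtain t where t: "t \<noteq> 0" "snd z' = t *\<^sub>R snd z"
          using z bundle_pt_eq_iff[OF c(1)] by (auto simp: W1_def W2_def)
        have "k (snd z') = t\<^sup>2 * k (snd z)" "n (snd z') = t\<^sup>2 * n (snd z)"
          unfolding k_def n_def t(2) by (auto simp: power_mult_distrib power2_eq_square)
        then have "t\<^sup>2 * k (snd z) < t\<^sup>2 * (m * n (snd z))" using z(2) by (simp add: W2_def mult_ac)
        moreover have "t\<^sup>2 > 0" using t by simp
        ultimately have "k (snd z) < m * n (snd z)" by (simp only: mult_less_cancel_left_pos)
        then show False using z(1) by (simp add: W1_def)
      qed
      then show ?thesis unfolding disjnt_iff by blast
    qed
    ultimately show ?thesis by blast
  qed
qed

text \<open>Finitely many coordinate balls cover \<open>X\<close>, and over each of them the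
  directions are the image of a compact set in Euclidean space, namely part of a closed ball times
  the unit sphere of the coordinate norm.\<close>

lemma real_image_proj_bundle:
  assumes X: "compact X" shows "real_image (proj_topology A) (proj_bundle A X)"
proof -
  have "\<exists>c r. c \<in> A \<and> x \<in> cdom c \<and> r > 0 \<and> cball (cmap c x) r \<subseteq> cimage c" for x
  proof -
    obtain c where c: "c \<in> A" "x \<in> cdom c" using chart_exists by blast
    then show ?thesis using open_cimage[OF c(1)] open_contains_cball[of "cimage c"] by blast
  qed
  then obtain c r where cr: "\<And>x. c x \<in> A" "\<And>x. x \<in> cdom (c x)" "\<And>x. r x > (0::real)"
    "\<And>x. cball (cmap (c x) x) (r x) \<subseteq> cimage (c x)" by metis
  define B where "B x = cinv (c x) ` ball (cmap (c x) x) (r x)" for x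
  have "open (B x)" for x
    unfolding B_def using cr(4)[of x] ball_subset_cball by (intro open_cinv_image cr) blast+
  moreover have "x \<in> B x" for x
    unfolding B_def using cr by (intro image_eqI[of _ _ "cmap (c x) x"]) (auto simp: cinv_cmap)
  ultimately obtain I where I: "finite I" "X \<subseteq> (\<Union>x\<in>I. B x)"
    using compactE_image[OF X, of UNIV B] by (metis UNIV_I UN_I subsetI)
  \<comment> \<open>Closed balls give compact pieces, whereas the cover is extracted from the open
    balls inside them.\<close>
  define Y where "Y x = cball (cmap (c x) x) (r x) \<inter> cinv (c x) -` X" for x
  define D where "D x = Y x \<times> sphere (0::'e) 1" for x
  have Ysub: "Y x \<subseteq> cimage (c x)" for x using cr(4) by (auto simp: Y_def)
  have "compact (D x)" for x
  proof -
    have "continuous_on (cball (cmap (c x) x) (r x)) (cinv (c x))"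
      using continuous_cinv[OF cr(1)] cr(4) by (rule continuous_on_subset)
    then have "closed (Y x)"
      unfolding Y_def by (intro continuous_closed_preimage closed_cball compact_imp_closed X)
    then have "compact (cball (cmap (c x) x) (r x) \<inter> Y x)" by (intro compact_Int_closed compact_cball)
    moreover have "cball (cmap (c x) x) (r x) \<inter> Y x = Y x" by (auto simp: Y_def)
    ultimately show ?thesis unfolding D_def by (intro compact_Times compact_sphere) simp
  qed
  then have "real_image euclidean (D x)" for x by (rule real_image_compact)
  moreover have Dsub: "D x \<subseteq> bundle_dom (c x)" for x
  proof
    fix z assume "z \<in> D x"
    then have "fst z \<in> Y x" "norm (snd z) = 1" by (auto simp: D_def)
    then show "z \<in> bundle_dom (c x)" using Ysub unfolding bundle_dom_def by fastforce
  qed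
  moreover have "continuous_map (subtopology euclidean (D x)) (proj_topology A) (bundle_pt (c x))" for x
    using bundle_pt_cont[OF cr(1)] Dsub by (rule continuous_map_from_subtopology_mono)
  ultimately have "real_image (proj_topology A) (bundle_pt (c x) ` D x)" for x
    by (intro real_image_compose)
  then have "real_image (proj_topology A) (\<Union>x\<in>I. bundle_pt (c x) ` D x)"
    using I(1) by (intro real_image_UN)
  moreover have "(\<Union>x\<in>I. bundle_pt (c x) ` D x) = proj_bundle A X"
  proof (intro equalityI subsetI)
    fix w assume "w \<in> (\<Union>x\<in>I. bundle_pt (c x) ` D x)"
    then obtain x z where z: "z \<in> D x" "w = bundle_pt (c x) z" by auto
    then have "w \<in> proj_bundle A UNIV" using bundle_pt_in[OF cr(1)] Dsub by blast
    moreover have "fst w \<in> X" using z by (auto simp: D_def Y_def)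
    ultimately show "w \<in> proj_bundle A X" unfolding proj_bundle_Int[of X] by simp
  next
    fix w assume w: "w \<in> proj_bundle A X"
    then have w': "w \<in> proj_bundle A UNIV" "fst w \<in> X" unfolding proj_bundle_Int[of X] by auto
    then obtain x where x: "x \<in> I" "fst w \<in> B x" using I by blast
    then obtain y where y: "y \<in> ball (cmap (c x) x) (r x)" "fst w = cinv (c x) y" by (auto simp: B_def)
    have yi: "y \<in> cimage (c x)" using y(1) cr(4)[of x] ball_subset_cball by blast
    have "fst w \<in> cdom (c x)" using y(2) cinv_in[OF yi] by simp
    then obtain z where z: "z \<in> bundle_dom (c x)" "w = bundle_pt (c x) z" "fst z = cmap (c x) (fst w)"
      using bundle_pt_ex[OF w'(1) cr(1)] by blast
    have fz: "fst z = y" using z(3) y(2) cmap_cinv[OF yi] by simp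
    have nz: "snd z \<noteq> 0" using z(1) by (simp add: bundle_dom_def)
    let ?z = "(y, (1 / norm (snd z)) *\<^sub>R snd z)"
    have "?z \<in> D x" using y w'(2) nz by (auto simp: D_def Y_def)
    moreover have "w = bundle_pt (c x) ?z"
      unfolding z(2)
      by (subst bundle_pt_eq_iff[OF cr(1) z(1)])
         (use nz fz in \<open>auto simp: bundle_dom_def yi intro!: exI[of _ "1 / norm (snd z)"]\<close>)
    ultimately show "w \<in> (\<Union>x\<in>I. bundle_pt (c x) ` D x)" using x by blast
  qed
  ultimately show ?thesis by simp
qed

end

section \<open>Norms and logarithmic growth of tangent vectors\<close>

context riemannian_manifold
begin

lemma tnorm_pos: "\<xi> \<in> tangent_space A x \<Longrightarrow> \<xi> \<noteq> (\<lambda>_. 0) \<Longrightarrow> tnorm g x \<xi> > 0"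
  using metric_pos by (simp add: tnorm_def)

lemma metric_scale_both:
  assumes "\<xi> \<in> tangent_space A x"
  shows "g x (\<lambda>c. r *\<^sub>R \<xi> c) (\<lambda>c. r *\<^sub>R \<xi> c) = r\<^sup>2 * g x \<xi> \<xi>"
  using metric_scale[OF assms tangent_space_scale[OF assms], of r r]
    metric_sym[OF assms tangent_space_scale[OF assms], of r] metric_scale[OF assms assms, of r]
  by (simp add: power2_eq_square mult.assoc)

lemma tnorm_scale: "\<xi> \<in> tangent_space A x \<Longrightarrow> tnorm g x (\<lambda>c. r *\<^sub>R \<xi> c) = \<bar>r\<bar> * tnorm g x \<xi>"
  by (simp add: tnorm_def metric_scale_both real_sqrt_mult)

definition chart_metric :: "('a, 'e) chart \<Rightarrow> 'e \<Rightarrow> 'e \<Rightarrow> 'e \<Rightarrow> real" where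
  "chart_metric c y v w = g (cinv c y) (tvec_of A (cinv c y) c v) (tvec_of A (cinv c y) c w)"

lemma chart_metric_cont: "c \<in> A \<Longrightarrow> continuous_on (cimage c) (\<lambda>y. chart_metric c y v w)"
proof -
  assume "c \<in> A"
  then have "Ck_on 0 (cimage c) (\<lambda>y. g (cinv c y) (tvec_of A (cinv c y) c v) (tvec_of A (cinv c y) c w))"
    using metric_smooth unfolding smooth_on_def by blast
  then show ?thesis by (simp add: chart_metric_def)
qed

lemma linear_chart_metric:
  assumes "c \<in> A" "y \<in> cimage c"
  shows "linear (\<lambda>v. chart_metric c y v w)" "linear (\<lambda>w. chart_metric c y v w)"
proof -
  have x: "cinv c y \<in> cdom c" using assms by (rule_tac cinv_in)
  note t = tvec_of_in[OF assms(1) x]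
  have l: "linear (\<lambda>v. chart_metric c y v w)" for w
    unfolding chart_metric_def
    by (rule linearI) (simp_all add: tvec_of_add[OF assms(1) x] tvec_of_scale[OF assms(1) x] metric_add[OF t t t] metric_scale[OF t t])
  then show "linear (\<lambda>v. chart_metric c y v w)" .
  have "(\<lambda>w. chart_metric c y v w) = (\<lambda>w. chart_metric c y w v)"
    unfolding chart_metric_def using metric_sym[OF t t] by auto
  then show "linear (\<lambda>w. chart_metric c y v w)" using l by simp
qed

text \<open>The smoothness axiom fixes both vector arguments of the metric. Joint linearity is used
  once for each argument, and the result is restricted to the diagonal.\<close>

lemma tnorm_chart_cont:
  assumes c: "c \<in> A"
  shows "continuous_on (cimage c \<times> UNIV) (\<lambda>z. tnorm g (cinv c (fst z)) (tvec_of A (cinv c (fst z)) c (snd z)))"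
proof -
  have "continuous_on ((cimage c \<times> UNIV) \<times> UNIV) (\<lambda>z. chart_metric c (fst (fst z)) (snd (fst z)) (snd z))"
  proof (rule continuous_on_joint_linear[where D="\<lambda>y. chart_metric c (fst y) (snd y)"])
    show "linear (chart_metric c (fst y) (snd y))" if "y \<in> cimage c \<times> UNIV" for y
      using linear_chart_metric(2)[OF c] that by auto
    show "continuous_on (cimage c \<times> UNIV) (\<lambda>y. chart_metric c (fst y) (snd y) w)" for w
      by (rule continuous_on_joint_linear[where D="\<lambda>y v. chart_metric c y v w"])
         (use linear_chart_metric(1)[OF c] chart_metric_cont[OF c] in blast)+
  qed
  moreover have "continuous_on (cimage c \<times> UNIV) (\<lambda>z :: 'e \<times> 'e. (z, snd z))"
    by (intro continuous_intros)
  ultimately have "continuous_on (cimage c \<times> UNIV) (\<lambda>z. chart_metric c (fst (fst (z, snd z))) (snd (fst (z, snd z))) (snd (z, snd z)))"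
    by (rule continuous_on_compose2) auto
  then have "continuous_on (cimage c \<times> UNIV) (\<lambda>z. chart_metric c (fst z) (snd z) (snd z))"
    by simp
  then show ?thesis
    unfolding tnorm_def chart_metric_def by (intro continuous_on_real_sqrt)
qed

text \<open>The integrand in the definition of \<open>phi\<close>.\<close>

definition log_growth :: "('a \<Rightarrow> 'a) \<Rightarrow> ('a, 'e) pvec \<Rightarrow> real" where
  "log_growth h = (\<lambda>(x, l). let v = (SOME v. v \<in> l \<and> tnorm g x v = 1) in
     ln (tnorm g (h x) (tangent_map A h x v)))"

lemma tangent_map_nonzero:
  assumes h: "regular_map h" and \<xi>: "\<xi> \<in> tangent_space A x" "\<xi> \<noteq> (\<lambda>_. 0)"
  shows "tangent_map A h x \<xi> \<noteq> (\<lambda>_. 0)"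
proof -
  obtain c where c: "c \<in> A" "x \<in> cdom c" using chart_exists by blast
  obtain d where d: "d \<in> A" "h x \<in> cdom d" using chart_exists by blast
  have dm: "diff_map h" using h by (simp add: regular_map_def)
  have "\<xi> c \<noteq> 0" using tangent_space_eq[OF \<xi>(1) c] tvec_of_nonzero[OF c] \<xi>(2) by metis
  then have "chart_deriv h c d (cmap c x) (\<xi> c) \<noteq> 0"
    using h c d unfolding regular_map_def by blast
  then show ?thesis using tangent_map_eq[OF dm c d \<xi>(1)] tvec_of_nonzero[OF d] by simp
qed

lemma unit_vector_ex:
  assumes "\<xi> \<in> tangent_space A x" "\<xi> \<noteq> (\<lambda>_. 0)"
  shows "\<exists>v. v \<in> tangent_line \<xi> \<and> tnorm g x v = 1"
  using tnorm_pos[OF assms] tnorm_scale[OF assms(1), of "1 / tnorm g x \<xi>"]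
  by (intro exI[of _ "\<lambda>c. (1 / tnorm g x \<xi>) *\<^sub>R \<xi> c"]) (auto simp: tangent_line_def)

text \<open>The chosen unit vector is a multiple of \<open>\<xi>\<close>, and the quotient of the
  two norms does not change under nonzero scaling.\<close>

lemma log_growth_eq:
  assumes h: "regular_map h" and \<xi>: "\<xi> \<in> tangent_space A x" "\<xi> \<noteq> (\<lambda>_. 0)"
  shows "log_growth h (x, tangent_line \<xi>) = ln (tnorm g (h x) (tangent_map A h x \<xi>) / tnorm g x \<xi>)"
proof -
  have dm: "diff_map h" using h by (simp add: regular_map_def)
  define v where "v = (SOME v. v \<in> tangent_line \<xi> \<and> tnorm g x v = 1)"
  have v: "v \<in> tangent_line \<xi> \<and> tnorm g x v = 1"
    unfolding v_def using unit_vector_ex[OF \<xi>] by (rule someI_ex)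
  then obtain t where t: "v = (\<lambda>c. t *\<^sub>R \<xi> c)" by (auto simp: tangent_line_def)
  have "\<bar>t\<bar> * tnorm g x \<xi> = 1" using v tnorm_scale[OF \<xi>(1)] t by simp
  then have "\<bar>t\<bar> = 1 / tnorm g x \<xi>" using tnorm_pos[OF \<xi>] by (simp add: field_simps)
  then have "tnorm g (h x) (tangent_map A h x v) = tnorm g (h x) (tangent_map A h x \<xi>) / tnorm g x \<xi>"
    unfolding t tangent_map_scale[OF dm \<xi>(1)] tnorm_scale[OF tangent_map_in[OF dm \<xi>(1)]] by simp
  then show ?thesis by (simp add: log_growth_def v_def[symmetric])
qed

lemma log_growth_cont:
  assumes h: "regular_map h"
  shows "continuous_map (proj_topology A) euclideanreal (log_growth h)"
proof (rule continuous_map_projI)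
  fix c assume c: "c \<in> A"
  have dm: "diff_map h" using h by (simp add: regular_map_def)
  define N where "N c z = tnorm g (cinv c (fst z)) (tvec_of A (cinv c (fst z)) c (snd z))" for c :: "('a, 'e) chart" and z
  have N: "continuous_on (cimage c \<times> UNIV) (N c)" if "c \<in> A" for c
    using tnorm_chart_cont[OF that] by (simp add: N_def[abs_def])
  have Npos: "N c z > 0" if "c \<in> A" "z \<in> bundle_dom c" for c z
    unfolding N_def using that tvec_of_nonzero tvec_of_in
    by (intro tnorm_pos) (auto simp: bundle_dom_def cinv_in)
  have eq: "log_growth h (bundle_pt c z) = ln (N d (bundle_rep h c d z) / N c z)"
    if d: "d \<in> A" "z \<in> rep_dom h c d" "z \<in> bundle_dom c" for d z
  proof -
    note D = rep_domD[OF c d(2)]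
    have "tvec_of A (cinv c (fst z)) c (snd z) \<noteq> (\<lambda>_. 0)"
      using tvec_of_nonzero[OF c D(1)] d(3) by (simp add: bundle_dom_def)
    then show ?thesis
      unfolding bundle_pt_def
      using log_growth_eq[OF h tvec_of_in[OF c D(1)]] tangent_map_tvec_of[OF dm c D(1) d(1) D(2)] D
      by (simp add: N_def bundle_rep_def cinv_cmap d(1))
  qed
  have "continuous_on (bundle_dom c \<inter> rep_dom h c d) (\<lambda>z. log_growth h (bundle_pt c z))" if d: "d \<in> A" for d
  proof -
    let ?S = "bundle_dom c \<inter> rep_dom h c d"
    have rc: "continuous_on ?S (bundle_rep h c d)"
      using bundle_rep_cont[OF h c d] by (rule continuous_on_subset) auto
    have rin: "bundle_rep h c d z \<in> bundle_dom d" if "z \<in> ?S" for z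
      using bundle_rep_in[OF h c d] that by auto
    have 1: "continuous_on ?S (\<lambda>z. N d (bundle_rep h c d z))"
    proof (rule continuous_on_compose2[OF N[OF d] rc])
      have "bundle_dom d \<subseteq> cimage d \<times> UNIV" by (auto simp: bundle_dom_def mem_Times_iff)
      then show "bundle_rep h c d ` ?S \<subseteq> cimage d \<times> UNIV" using rin by blast
    qed
    have 2: "continuous_on ?S (N c)"
      using N[OF c] by (rule continuous_on_subset) (auto simp: bundle_dom_def)
    have "continuous_on ?S (\<lambda>z. ln (N d (bundle_rep h c d z) / N c z))"
    proof (intro continuous_on_ln continuous_on_divide 1 2 ballI)
      fix z assume z: "z \<in> ?S"
      have "N c z > 0" "N d (bundle_rep h c d z) > 0"
        using Npos[OF c] Npos[OF d] rin[OF z] z by blast+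
      then show "N c z \<noteq> 0" "N d (bundle_rep h c d z) / N c z \<noteq> 0" by auto
    qed
    then show ?thesis by (rule continuous_on_eq) (use eq d in auto)
  qed
  then have "continuous_on (\<Union>d\<in>A. bundle_dom c \<inter> rep_dom h c d) (\<lambda>z. log_growth h (bundle_pt c z))"
    by (intro continuous_on_open_UN open_Int open_bundle_dom open_rep_dom c h)
  moreover have "(\<Union>d\<in>A. bundle_dom c \<inter> rep_dom h c d) = bundle_dom c"
  proof -
    have "\<exists>d\<in>A. z \<in> rep_dom h c d" if "z \<in> bundle_dom c" for z
      using that chart_exists[of "h (cinv c (fst z))"] by (auto intro: rep_domI simp: bundle_dom_def)
    then show ?thesis by auto
  qed
  ultimately show "continuous_map (top_of_set (bundle_dom c)) euclideanreal (\<lambda>z. log_growth h (bundle_pt c z))"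
    by simp
qed

end


section \<open>Measurability of the derivative\<close>

text \<open>The left integrand need not be measurable for \<open>M\<close>; agreeing with a
  measurable function outside a null set makes it measurable for the completion.\<close>

lemma integral_completion_AE:
  fixes k k' :: "'w \<Rightarrow> real"
  assumes ae: "AE w in M. k w = k' w" and k': "k' \<in> borel_measurable M"
  shows "(\<integral>w. k w \<partial>completion M) = (\<integral>w. k' w \<partial>M)"
proof -
  obtain N where N: "N \<in> null_sets M" "{w \<in> space M. k w \<noteq> k' w} \<subseteq> N"
    using ae unfolding eventually_ae_filter by auto
  have "k \<in> borel_measurable (completion M)"
  proof (rule measurableI)
    fix B :: "real set" assume B: "B \<in> sets borel"
    have "k -` B \<inter> space M = ((k' -` B \<inter> space M) - N) \<union> (k -` B \<inter> space M \<inter> N)"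
      using N(2) by auto
    moreover have "(k' -` B \<inter> space M) - N \<in> sets (completion M)"
      using measurable_sets[OF k' B] N(1) by auto
    moreover have "k -` B \<inter> space M \<inter> N \<in> sets (completion M)"
      by (rule null_sets_completion[OF N(1)]) auto
    ultimately show "k -` B \<inter> space (completion M) \<in> sets (completion M)"
      by (metis sets.Un space_completion)
  qed auto
  then have "(\<integral>w. k w \<partial>completion M) = (\<integral>w. k' w \<partial>completion M)"
    by (rule integral_cong_AE[OF _ measurable_completion[OF k'] AE_completion[OF ae]])
  then show ?thesis using integral_completion[OF k'] by simp
qed

text \<open>Writes the derivative as the limit of a sequence of difference quotients, so that
  measurability in a parameter is inherited from the function values.\<close>

lemma has_derivative_directional_limit:
  fixes f :: "'b::real_normed_vector \<Rightarrow> 'c::real_normed_vector"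
  assumes "(f has_derivative D) (at y)"
  shows "(\<lambda>n. real (Suc n) *\<^sub>R (f (y + (1 / real (Suc n)) *\<^sub>R v) - f y)) \<longlonglongrightarrow> D v"
proof (cases "v = 0")
  case True
  have "D 0 = 0" using has_derivative_linear[OF assms] by (rule linear_0)
  then show ?thesis using True by simp
next
  case False
  define h where "h n = (1 / real (Suc n)) *\<^sub>R v" for n
  have lin: "linear D" using has_derivative_linear[OF assms] .
  have lim: "(\<lambda>h. norm (f (y + h) - f y - D h) / norm h) \<midarrow>0\<rightarrow> 0"
    using assms by (simp add: has_derivative_at)
  have "h \<longlonglongrightarrow> 0 *\<^sub>R v"
    unfolding h_def by (intro tendsto_scaleR LIMSEQ_Suc[OF lim_1_over_n] tendsto_const)
  moreover have "h n \<noteq> 0" for n using False by (simp add: h_def)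
  ultimately have "filterlim h (at 0) sequentially"
    by (auto simp: filterlim_at)
  from filterlim_compose[OF lim this]
  have "(\<lambda>n. norm (f (y + h n) - f y - D (h n)) / norm (h n)) \<longlonglongrightarrow> 0" .
  then have "(\<lambda>n. norm v * (norm (f (y + h n) - f y - D (h n)) / norm (h n))) \<longlonglongrightarrow> norm v * 0"
    by (intro tendsto_mult tendsto_const)
  moreover have "norm v * (norm (f (y + h n) - f y - D (h n)) / norm (h n)) =
      norm (real (Suc n) *\<^sub>R (f (y + h n) - f y) - D v)" for n
  proof -
    have "D (h n) = (1 / real (Suc n)) *\<^sub>R D v" by (simp only: h_def linear_scale[OF lin])
    then have "real (Suc n) *\<^sub>R (f (y + h n) - f y) - D v = real (Suc n) *\<^sub>R (f (y + h n) - f y - D (h n))"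
      by (simp add: scaleR_diff_right)
    then have "norm (real (Suc n) *\<^sub>R (f (y + h n) - f y) - D v) = real (Suc n) * norm (f (y + h n) - f y - D (h n))"
      by (simp only: norm_scaleR abs_of_nat)
    moreover have "norm v = real (Suc n) * norm (h n)" by (simp add: h_def)
    ultimately show ?thesis using False by (simp add: h_def)
  qed
  ultimately have "(\<lambda>n. real (Suc n) *\<^sub>R (f (y + h n) - f y) - D v) \<longlonglongrightarrow> 0"
    by (simp add: tendsto_norm_zero_iff)
  then show ?thesis unfolding h_def by (rule LIM_zero_cancel)
qed

context smooth_manifold
begin

text \<open>Case distinctions over charts preserve measurability only if countably many charts
  suffice, which is the Lindelof property.\<close>

lemma countable_subatlas: "\<exists>A0\<subseteq>A. countable A0 \<and> (\<forall>x. \<exists>c\<in>A0. x \<in> cdom c)"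
proof -
  obtain F where F: "F \<subseteq> cdom ` A" "countable F" "\<Union>F = \<Union>(cdom ` A)"
    using Lindelof[of "cdom ` A"] open_cdom by (metis (no_types, lifting) imageE)
  then obtain A0 where A0: "countable A0" "A0 \<subseteq> A" "F = cdom ` A0"
    using countable_subset_image[of F cdom A] by auto
  have "\<exists>c\<in>A0. x \<in> cdom c" for x
  proof -
    have "x \<in> \<Union>F" unfolding F(3) using chart_exists[of x] by blast
    then show ?thesis unfolding A0(3) by blast
  qed
  then show ?thesis using A0(1,2) by (intro exI[of _ A0] conjI allI)
qed

lemma borel_measurable_chart:
  "c \<in> A \<Longrightarrow> (\<lambda>x. indicator (cdom c) x *\<^sub>R cmap c x) \<in> borel_measurable borel"
  by (intro borel_measurable_continuous_on_indicator borel_open open_cdom continuous_cmap)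

text \<open>Each difference quotient involves only values of \<open>F t\<close> at fixed points,
  which are measurable in \<open>t\<close>. The indicators replace the uncontrolled coordinate
  values outside the chart domain by 0.\<close>

lemma chart_deriv_measurable:
  assumes dm: "\<And>t. t \<in> space p \<Longrightarrow> diff_map (F t)" and F: "\<And>x. (\<lambda>t. F t x) \<in> p \<rightarrow>\<^sub>M borel"
    and c: "c \<in> A" "x \<in> cdom c" and d: "d \<in> A"
  shows "(\<lambda>t. indicator (cdom d) (F t x) *\<^sub>R chart_deriv (F t) c d (cmap c x) v) \<in> borel_measurable p"
proof (rule borel_measurable_LIMSEQ_metric)
  define k where "k x = indicator (cdom d) x *\<^sub>R cmap d x" for x
  define s where "s n = cmap c x + (1 / real (Suc n)) *\<^sub>R v" for n
  define D where "D n t = indicator (cdom d) (F t x) *\<^sub>R (real (Suc n) *\<^sub>R (k (F t (cinv c (s n))) - k (F t x)))" for n t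
  have k: "(\<lambda>t. k (F t x)) \<in> borel_measurable p" for x
    using measurable_compose[OF F borel_measurable_chart[OF d]] by (simp add: k_def)
  have i: "(\<lambda>t. indicator (cdom d) (F t x) :: real) \<in> borel_measurable p"
    using measurable_compose[OF F borel_measurable_indicator[of "cdom d" borel]] open_cdom[OF d] by simp
  show "D n \<in> borel_measurable p" for n
    unfolding D_def[abs_def] by (intro borel_measurable_scaleR borel_measurable_const borel_measurable_diff k i)
  fix t assume t: "t \<in> space p"
  show "(\<lambda>n. D n t) \<longlonglongrightarrow> indicator (cdom d) (F t x) *\<^sub>R chart_deriv (F t) c d (cmap c x) v"
  proof (cases "F t x \<in> cdom d")
    case True
    let ?h = "cmap d \<circ> F t \<circ> cinv c"
    have lim: "(\<lambda>n. real (Suc n) *\<^sub>R (?h (s n) - ?h (cmap c x))) \<longlonglongrightarrow> chart_deriv (F t) c d (cmap c x) v"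
      unfolding s_def by (rule has_derivative_directional_limit[OF diff_map_deriv[OF dm[OF t] c(1) d c(2) True]])
    let ?U = "cmap c ` (cdom c \<inter> F t -` cdom d)"
    have "open (F t -` cdom d)"
      using dm[OF t] by (intro open_vimage open_cdom d) (simp add: diff_map_def)
    with c(1) have "open ?U" by (rule open_chart_image)
    moreover have "s \<longlonglongrightarrow> cmap c x + 0 *\<^sub>R v"
      unfolding s_def by (intro tendsto_add tendsto_scaleR LIMSEQ_Suc[OF lim_1_over_n] tendsto_const)
    moreover have "cmap c x + 0 *\<^sub>R v \<in> ?U" using True c by auto
    ultimately have "\<forall>\<^sub>F n in sequentially. s n \<in> ?U" by (auto dest: topological_tendstoD)
    \<comment> \<open>The masked quotient is the true one as soon as the displaced point stays in
      the chart and is mapped into the domain of \<open>d\<close>. How soon this happens depends on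
      \<open>t\<close>, but only the pointwise limit matters.\<close>
    then have "\<forall>\<^sub>F n in sequentially. real (Suc n) *\<^sub>R (?h (s n) - ?h (cmap c x)) = D n t"
    proof eventually_elim
      case (elim n)
      then have "F t (cinv c (s n)) \<in> cdom d" using c by (auto simp: cinv_cmap)
      then show ?case using True c by (simp add: D_def k_def cinv_cmap)
    qed
    from Lim_transform_eventually[OF lim this] show ?thesis using True by simp
  qed (simp add: D_def)
qed

text \<open>Stated for any predicate that is open in bundle charts, so that it serves both the
  action on lines, with open sets of directions, and the norm of the image vector.\<close>

lemma tangent_map_measurable:
  assumes dm: "\<And>t. t \<in> space p \<Longrightarrow> diff_map (F t)" and F: "\<And>x. (\<lambda>t. F t x) \<in> p \<rightarrow>\<^sub>M borel"
    and \<xi>: "\<xi> \<in> tangent_space A x"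
    and P: "\<And>d. d \<in> A \<Longrightarrow> open {z. fst z \<in> cimage d \<and> P (cinv d (fst z)) (tvec_of A (cinv d (fst z)) d (snd z))}"
  shows "{t \<in> space p. P (F t x) (tangent_map A (F t) x \<xi>)} \<in> sets p"
proof -
  obtain A0 where A0: "A0 \<subseteq> A" "countable A0" "\<And>x. \<exists>c\<in>A0. x \<in> cdom c" using countable_subatlas by metis
  obtain c where c: "c \<in> A" "x \<in> cdom c" using chart_exists by blast
  let ?V = "\<lambda>d. {z. fst z \<in> cimage d \<and> P (cinv d (fst z)) (tvec_of A (cinv d (fst z)) d (snd z))}"
  let ?r = "\<lambda>d t. (indicator (cdom d) (F t x) *\<^sub>R cmap d (F t x),
      indicator (cdom d) (F t x) *\<^sub>R chart_deriv (F t) c d (cmap c x) (\<xi> c))"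
  have "{t \<in> space p. P (F t x) (tangent_map A (F t) x \<xi>)} =
     (\<Union>d\<in>A0. ((\<lambda>t. F t x) -` cdom d \<inter> space p) \<inter> (?r d -` ?V d \<inter> space p))"
  proof -
    have iff: "P (F t x) (tangent_map A (F t) x \<xi>) \<longleftrightarrow> ?r d t \<in> ?V d" if "t \<in> space p" "d \<in> A0" "F t x \<in> cdom d" for t d
    proof -
      have d: "d \<in> A" using that A0 by blast
      show ?thesis using tangent_map_eq[OF dm[OF that(1)] c d that(3) \<xi>] that(3) d by (auto simp: cinv_cmap)
    qed
    show ?thesis
    proof (intro equalityI subsetI)
      fix t assume "t \<in> {t \<in> space p. P (F t x) (tangent_map A (F t) x \<xi>)}"
      then have t: "t \<in> space p" "P (F t x) (tangent_map A (F t) x \<xi>)" by auto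
      obtain d where d: "d \<in> A0" "F t x \<in> cdom d" using A0(3) by blast
      have "?r d t \<in> ?V d" using iff[OF t(1) d] t(2) by (rule iffD1)
      then show "t \<in> (\<Union>d\<in>A0. ((\<lambda>t. F t x) -` cdom d \<inter> space p) \<inter> (?r d -` ?V d \<inter> space p))"
        using d t(1) by (intro UN_I[of d] IntI vimageI2)
    next
      fix t assume "t \<in> (\<Union>d\<in>A0. ((\<lambda>t. F t x) -` cdom d \<inter> space p) \<inter> (?r d -` ?V d \<inter> space p))"
      then obtain d where d: "d \<in> A0" "t \<in> space p" "F t x \<in> cdom d" "?r d t \<in> ?V d" by blast
      have "P (F t x) (tangent_map A (F t) x \<xi>)" using iff[OF d(2,1,3)] d(4) by (rule iffD2)
      then show "t \<in> {t \<in> space p. P (F t x) (tangent_map A (F t) x \<xi>)}" using d(2) by blast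
    qed
  qed
  also have "\<dots> \<in> sets p"
  proof (rule sets.countable_UN''[OF A0(2)])
    fix d assume "d \<in> A0"
    then have d: "d \<in> A" using A0 by blast
    have 1: "(\<lambda>t. F t x) -` cdom d \<inter> space p \<in> sets p"
      by (rule measurable_sets[OF F]) (use open_cdom[OF d] in auto)
    have "?r d \<in> borel_measurable p"
      by (intro borel_measurable_Pair chart_deriv_measurable[OF dm F c d]
          measurable_compose[OF F borel_measurable_chart[OF d]])
    then have "?r d -` ?V d \<inter> space p \<in> sets p"
      by (rule measurable_sets) (use P[OF d] in auto)
    with 1 show "((\<lambda>t. F t x) -` cdom d \<inter> space p) \<inter> (?r d -` ?V d \<inter> space p) \<in> sets p"
      by (rule sets.Int)
  qed
  finally show ?thesis .
qed

lemma proj_map_eq: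
  assumes "diff_map h" "\<xi> \<in> tangent_space A x"
  shows "proj_map A h (x, tangent_line \<xi>) = (h x, tangent_line (tangent_map A h x \<xi>))"
proof -
  have "tangent_map A h x ` tangent_line \<xi> = tangent_line (tangent_map A h x \<xi>)"
    unfolding tangent_line_def image_image by (simp add: tangent_map_scale[OF assms])
  then show ?thesis by (simp add: proj_map_def)
qed

end

context riemannian_manifold
begin

lemma proj_map_measurable:
  assumes reg: "\<And>t. t \<in> space p \<Longrightarrow> regular_map (F t)" and F: "\<And>x. (\<lambda>t. F t x) \<in> p \<rightarrow>\<^sub>M borel"
    and inv: "\<And>t. t \<in> space p \<Longrightarrow> F t ` X \<subseteq> X" and w: "w \<in> proj_bundle A X"
  shows "(\<lambda>t. proj_map A (F t) w) \<in> p \<rightarrow>\<^sub>M borel_top (subtopology (proj_topology A) (proj_bundle A X))"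
proof (rule measurable_borel_topI)
  show "(\<lambda>t. proj_map A (F t) w) \<in> space p \<rightarrow> topspace (subtopology (proj_topology A) (proj_bundle A X))"
    unfolding topspace_proj_sub using proj_map_bundle[OF reg inv w] by auto
  fix U assume "openin (subtopology (proj_topology A) (proj_bundle A X)) U"
  then obtain V where V: "proj_open A V" "U = V \<inter> proj_bundle A X"
    by (auto simp: openin_subtopology openin_proj_topology)
  obtain x \<xi> where x: "w = (x, tangent_line \<xi>)" "x \<in> X" "\<xi> \<in> tangent_space A x" "\<xi> \<noteq> (\<lambda>_. 0)"
    using w by (auto simp: proj_bundle_def)
  have dm: "diff_map (F t)" if "t \<in> space p" for t using reg[OF that] by (simp add: regular_map_def)
  \<comment> \<open>The quotient topology controls nonzero vectors only, so the predicate includes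
    nonvanishing; for image vectors it holds automatically by regularity.\<close>
  have "{t \<in> space p. (\<lambda>y \<eta>. \<eta> \<noteq> (\<lambda>_. 0) \<and> (y, tangent_line \<eta>) \<in> V) (F t x) (tangent_map A (F t) x \<xi>)} \<in> sets p"
  proof (rule tangent_map_measurable[OF dm F x(3)])
    fix d assume d: "d \<in> A"
    have "{z. fst z \<in> cimage d \<and> (\<lambda>y \<eta>. \<eta> \<noteq> (\<lambda>_. 0) \<and> (y, tangent_line \<eta>) \<in> V) (cinv d (fst z)) (tvec_of A (cinv d (fst z)) d (snd z))}
      = {z \<in> bundle_dom d. bundle_pt d z \<in> V}"
      using tvec_of_nonzero[OF d cinv_in] by (auto simp: bundle_dom_def bundle_pt_def)
    also have "open \<dots>" using V(1) d by (simp add: proj_open_iff)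
    finally show "open {z. fst z \<in> cimage d \<and> (\<lambda>y \<eta>. \<eta> \<noteq> (\<lambda>_. 0) \<and> (y, tangent_line \<eta>) \<in> V) (cinv d (fst z)) (tvec_of A (cinv d (fst z)) d (snd z))}" .
  qed
  also have "{t \<in> space p. (\<lambda>y \<eta>. \<eta> \<noteq> (\<lambda>_. 0) \<and> (y, tangent_line \<eta>) \<in> V) (F t x) (tangent_map A (F t) x \<xi>)}
     = (\<lambda>t. proj_map A (F t) w) -` U \<inter> space p"
    using tangent_map_nonzero[OF reg x(3,4)] proj_map_bundle[OF reg inv w]
    unfolding V(2) x(1) by (auto simp: proj_map_eq[OF dm x(3)])
  finally show "(\<lambda>t. proj_map A (F t) w) -` U \<inter> space p \<in> sets p" .
qed

lemma log_growth_measurable: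
  assumes reg: "\<And>t. t \<in> space p \<Longrightarrow> regular_map (F t)" and F: "\<And>x. (\<lambda>t. F t x) \<in> p \<rightarrow>\<^sub>M borel"
    and w: "w \<in> proj_bundle A UNIV"
  shows "(\<lambda>t. log_growth (F t) w) \<in> borel_measurable p"
proof -
  obtain x \<xi> where x: "w = (x, tangent_line \<xi>)" "\<xi> \<in> tangent_space A x" "\<xi> \<noteq> (\<lambda>_. 0)"
    using w by (auto simp: proj_bundle_def)
  have dm: "diff_map (F t)" if "t \<in> space p" for t using reg[OF that] by (simp add: regular_map_def)
  have [measurable]: "(\<lambda>t. tnorm g (F t x) (tangent_map A (F t) x \<xi>)) \<in> borel_measurable p"
  proof (rule borel_measurableI_greater)
    fix a
    show "{t \<in> space p. a < tnorm g (F t x) (tangent_map A (F t) x \<xi>)} \<in> sets p"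
    proof (rule tangent_map_measurable[OF dm F x(2)])
      fix d assume d: "d \<in> A"
      have "open (cimage d \<times> (UNIV :: 'e set))" using open_cimage[OF d] by (intro open_Times) auto
      from continuous_open_preimage[OF tnorm_chart_cont[OF d] this open_greaterThan[of a]]
      have "open ((cimage d \<times> UNIV) \<inter> (\<lambda>z. tnorm g (cinv d (fst z)) (tvec_of A (cinv d (fst z)) d (snd z))) -` {a<..})" .
      moreover have "(cimage d \<times> UNIV) \<inter> (\<lambda>z. tnorm g (cinv d (fst z)) (tvec_of A (cinv d (fst z)) d (snd z))) -` {a<..} =
        {z. fst z \<in> cimage d \<and> a < tnorm g (cinv d (fst z)) (tvec_of A (cinv d (fst z)) d (snd z))}"
        by (auto simp: mem_Times_iff)
      ultimately show "open {z. fst z \<in> cimage d \<and> a < tnorm g (cinv d (fst z)) (tvec_of A (cinv d (fst z)) d (snd z))}"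
        by simp
    qed
  qed
  have "(\<lambda>t. ln (tnorm g (F t x) (tangent_map A (F t) x \<xi>) / tnorm g x \<xi>)) \<in> borel_measurable p"
    by measurable
  then show ?thesis
    by (rule measurable_cong[THEN iffD1, rotated]) (simp add: x(1) log_growth_eq[OF reg x(2,3)])
qed

section \<open>Operator norms as maxima over directions\<close>

lemma unit_vectors_ex: "\<exists>\<xi>. \<xi> \<in> tangent_space A x \<and> tnorm g x \<xi> = 1"
proof -
  have "x \<in> fst ` proj_bundle A UNIV" by (simp add: fst_proj_bundle)
  then obtain \<eta> where \<eta>: "\<eta> \<in> tangent_space A x" "\<eta> \<noteq> (\<lambda>_. 0)" by (auto simp: proj_bundle_def)
  obtain \<xi> where \<xi>: "\<xi> \<in> tangent_line \<eta>" "tnorm g x \<xi> = 1" using unit_vector_ex[OF \<eta>] by blast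
  then show ?thesis using tangent_space_scale[OF \<eta>(1)] by (auto simp: tangent_line_def)
qed

lemma tnorm_zero: "tnorm g x (\<lambda>_. 0) = 0"
proof -
  obtain \<xi> where "\<xi> \<in> tangent_space A x" "tnorm g x \<xi> = 1" using unit_vectors_ex by blast
  then show ?thesis using tnorm_scale[of \<xi> x 0] by simp
qed

lemma proj_bundleI: "x \<in> X \<Longrightarrow> \<xi> \<in> tangent_space A x \<Longrightarrow> \<xi> \<noteq> (\<lambda>_. 0) \<Longrightarrow> (x, tangent_line \<xi>) \<in> proj_bundle A X"
  unfolding proj_bundle_def by blast

text \<open>The growth exponent is an arbitrary function \<open>K\<close> because the lemma is
  applied both to a single map, with \<open>log_growth\<close>, and to iterates, with the
  accumulated growth \<open>Phi\<close>.\<close>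

lemma deriv_norm_eq:
  assumes K: "\<And>\<xi>. \<xi> \<in> tangent_space A x \<Longrightarrow> \<xi> \<noteq> (\<lambda>_. 0) \<Longrightarrow>
        tnorm g (h x) (tangent_map A h x \<xi>) = exp (K (x, tangent_line \<xi>)) * tnorm g x \<xi>"
    and w0: "w0 \<in> proj_bundle A UNIV" "fst w0 = x"
    and max: "\<And>w. w \<in> proj_bundle A UNIV \<Longrightarrow> fst w = x \<Longrightarrow> K w \<le> K w0"
  shows "deriv_norm A g h x = exp (K w0)"
  unfolding deriv_norm_def tangent_onorm_def
proof (rule cSup_eq_maximum)
  obtain \<eta> where \<eta>: "w0 = (x, tangent_line \<eta>)" "\<eta> \<in> tangent_space A x" "\<eta> \<noteq> (\<lambda>_. 0)"
    using w0 by (auto simp: proj_bundle_def)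
  define \<xi> where "\<xi> = (\<lambda>c. (1 / tnorm g x \<eta>) *\<^sub>R \<eta> c)"
  have pos: "tnorm g x \<eta> > 0" using tnorm_pos[OF \<eta>(2,3)] .
  have \<xi>: "\<xi> \<in> tangent_space A x" unfolding \<xi>_def by (rule tangent_space_scale[OF \<eta>(2)])
  have n\<xi>: "tnorm g x \<xi> = 1" unfolding \<xi>_def using tnorm_scale[OF \<eta>(2)] pos by simp
  have "\<xi> \<noteq> (\<lambda>_. 0)" using n\<xi> tnorm_zero by auto
  moreover have "tangent_line \<xi> = tangent_line \<eta>" unfolding \<xi>_def using pos by (intro tangent_line_scale) auto
  ultimately have "tnorm g (h x) (tangent_map A h x \<xi>) = exp (K w0)"
    using K[OF \<xi>] n\<xi> \<eta>(1) by simp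
  then show "exp (K w0) \<in> (\<lambda>\<xi>. tnorm g (h x) (tangent_map A h x \<xi>)) ` {\<xi> \<in> tangent_space A x. tnorm g x \<xi> = 1}"
    using \<xi> n\<xi> by (intro image_eqI[of _ _ \<xi>]) auto
next
  fix y assume "y \<in> (\<lambda>\<xi>. tnorm g (h x) (tangent_map A h x \<xi>)) ` {\<xi> \<in> tangent_space A x. tnorm g x \<xi> = 1}"
  then obtain \<xi> where \<xi>: "\<xi> \<in> tangent_space A x" "tnorm g x \<xi> = 1" "y = tnorm g (h x) (tangent_map A h x \<xi>)" by auto
  have nz: "\<xi> \<noteq> (\<lambda>_. 0)" using \<xi>(2) tnorm_zero by auto
  have "K (x, tangent_line \<xi>) \<le> K w0" using \<xi> nz by (intro max proj_bundleI) auto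
  then show "y \<le> exp (K w0)" using K[OF \<xi>(1) nz] \<xi> by simp
qed

text \<open>An injective linear map between spaces of the same finite dimension is surjective.
  Bijectivity gives \<open>inv_into\<close> in \<open>inv_deriv_norm\<close> its meaning as the
  inverse derivative.\<close>

lemma tangent_map_bij:
  assumes h: "regular_map h" shows "bij_betw (tangent_map A h x) (tangent_space A x) (tangent_space A (h x))"
proof -
  obtain c where c: "c \<in> A" "x \<in> cdom c" using chart_exists by blast
  obtain d where d: "d \<in> A" "h x \<in> cdom d" using chart_exists by blast
  have dm: "diff_map h" using h by (simp add: regular_map_def)
  let ?D = "chart_deriv h c d (cmap c x)"
  have lin: "linear ?D" by (rule linear_chart_deriv[OF dm c(1) d(1) c(2) d(2)])
  have "\<forall>v. ?D v = 0 \<longrightarrow> v = 0" using h c d unfolding regular_map_def by blast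
  then have inj: "inj ?D" using lin by (simp add: linear_injective_0)
  then have surj: "surj ?D" using lin linear_injective_imp_surjective by blast
  show ?thesis
    unfolding bij_betw_def
  proof
    show "inj_on (tangent_map A h x) (tangent_space A x)"
    proof (rule inj_onI)
      fix \<xi> \<eta> assume *: "\<xi> \<in> tangent_space A x" "\<eta> \<in> tangent_space A x" "tangent_map A h x \<xi> = tangent_map A h x \<eta>"
      then have "?D (\<xi> c) = ?D (\<eta> c)"
        using tangent_map_eq[OF dm c d] tvec_of_apply[OF d] by metis
      then have "\<xi> c = \<eta> c" using inj by (simp add: inj_eq)
      then show "\<xi> = \<eta>" using tangent_space_eqI[OF *(1,2) c] by simp
    qed
    show "tangent_map A h x ` tangent_space A x = tangent_space A (h x)"
    proof
      show "tangent_space A (h x) \<subseteq> tangent_map A h x ` tangent_space A x"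
      proof
        fix \<eta> assume \<eta>: "\<eta> \<in> tangent_space A (h x)"
        obtain v where v: "\<eta> d = ?D v" using surj by (metis surjD)
        have "tangent_map A h x (tvec_of A x c v) = \<eta>"
          unfolding tangent_map_tvec_of[OF dm c d] v[symmetric] using tangent_space_eq[OF \<eta> d] by simp
        then show "\<eta> \<in> tangent_map A h x ` tangent_space A x" using tvec_of_in[OF c] by blast
      qed
    qed (use tangent_map_in[OF dm] in blast)
  qed
qed

text \<open>The direction that grows least under the derivative is the image of the unit direction
  that grows most under its inverse, which turns the minimum into a maximum with opposite
  sign.\<close>

lemma inv_deriv_norm_eq:
  assumes h: "regular_map h" and w0: "w0 \<in> proj_bundle A UNIV" "fst w0 = x"
    and min: "\<And>w. w \<in> proj_bundle A UNIV \<Longrightarrow> fst w = x \<Longrightarrow> log_growth h w0 \<le> log_growth h w"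
  shows "inv_deriv_norm A g h x = exp (- log_growth h w0)"
  unfolding inv_deriv_norm_def tangent_onorm_def
proof (rule cSup_eq_maximum)
  let ?T = "tangent_map A h x" and ?I = "inv_into (tangent_space A x) (tangent_map A h x)"
  have dm: "diff_map h" using h by (simp add: regular_map_def)
  note bij = tangent_map_bij[OF h, of x]
  have K: "tnorm g (h x) (?T \<xi>) = exp (log_growth h (x, tangent_line \<xi>)) * tnorm g x \<xi>"
    if "\<xi> \<in> tangent_space A x" "\<xi> \<noteq> (\<lambda>_. 0)" for \<xi>
    using log_growth_eq[OF h that] tnorm_pos[OF that] tnorm_pos[OF tangent_map_in[OF dm that(1)] tangent_map_nonzero[OF h that]]
    by simp
  {
    obtain \<eta> where \<eta>: "w0 = (x, tangent_line \<eta>)" "\<eta> \<in> tangent_space A x" "\<eta> \<noteq> (\<lambda>_. 0)"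
      using w0 by (auto simp: proj_bundle_def)
    define r where "r = tnorm g (h x) (?T \<eta>)"
    have r: "r > 0" unfolding r_def by (rule tnorm_pos[OF tangent_map_in[OF dm \<eta>(2)] tangent_map_nonzero[OF h \<eta>(2,3)]])
    \<comment> \<open>Scaled so that the image of the vector, not the vector itself, has norm
      1.\<close>
    define \<zeta> where "\<zeta> = (\<lambda>c. (1 / r) *\<^sub>R \<eta> c)"
    have \<zeta>: "\<zeta> \<in> tangent_space A x" unfolding \<zeta>_def by (rule tangent_space_scale[OF \<eta>(2)])
    have T\<zeta>: "tnorm g (h x) (?T \<zeta>) = 1"
      unfolding \<zeta>_def tangent_map_scale[OF dm \<eta>(2)] tnorm_scale[OF tangent_map_in[OF dm \<eta>(2)]] using r by (simp add: r_def)
    have n\<zeta>: "tnorm g x \<zeta> = exp (- log_growth h w0)"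
      unfolding \<zeta>_def tnorm_scale[OF \<eta>(2)] using K[OF \<eta>(2,3)] r tnorm_pos[OF \<eta>(2,3)] \<eta>(1)
      by (simp add: r_def exp_minus field_simps)
    have "?I (?T \<zeta>) = \<zeta>" using bij \<zeta> by (simp add: bij_betw_inv_into_left)
    then show "exp (- log_growth h w0) \<in> (\<lambda>\<xi>. tnorm g x (?I \<xi>)) ` {\<xi> \<in> tangent_space A (h x). tnorm g (h x) \<xi> = 1}"
      using n\<zeta> T\<zeta> tangent_map_in[OF dm \<zeta>] by (intro image_eqI[of _ _ "?T \<zeta>"]) auto
  }
  fix y assume "y \<in> (\<lambda>\<xi>. tnorm g x (?I \<xi>)) ` {\<xi> \<in> tangent_space A (h x). tnorm g (h x) \<xi> = 1}"
  then obtain \<xi> where \<xi>: "\<xi> \<in> tangent_space A (h x)" "tnorm g (h x) \<xi> = 1" "y = tnorm g x (?I \<xi>)" by auto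
  define \<zeta> where "\<zeta> = ?I \<xi>"
  have \<zeta>: "\<zeta> \<in> tangent_space A x" "?T \<zeta> = \<xi>"
    unfolding \<zeta>_def using bij \<xi>(1) by (auto simp: bij_betw_inv_into_right bij_betw_def inv_into_into)
  have T0: "?T (\<lambda>_. 0) = (\<lambda>_. 0)" using tangent_map_scale[OF dm \<zeta>(1), of 0] by simp
  have nz: "\<zeta> \<noteq> (\<lambda>_. 0)" using \<zeta>(2) \<xi>(2) T0 tnorm_zero[of "h x"] by auto
  have "exp (log_growth h (x, tangent_line \<zeta>)) * tnorm g x \<zeta> = 1" using K[OF \<zeta>(1) nz] \<zeta>(2) \<xi>(2) by simp
  then have "tnorm g x \<zeta> = exp (- log_growth h (x, tangent_line \<zeta>))"
    by (simp add: exp_minus field_simps)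
  moreover have "log_growth h w0 \<le> log_growth h (x, tangent_line \<zeta>)"
    using \<zeta> nz by (intro min proj_bundleI) auto
  ultimately show "y \<le> exp (- log_growth h w0)" using \<xi>(3) by (simp add: \<zeta>_def)
qed

end


section \<open>Lyapunov exponents of the given random map\<close>

lemma (in real_param) attains_max:
  assumes h: "continuous_map T euclideanreal h" and D: "closedin T D" "D \<noteq> {}"
  obtains z where "z \<in> D" "\<And>z'. z' \<in> D \<Longrightarrow> h z' \<le> h z"
proof -
  let ?K = "{t \<in> C. q t \<in> D}"
  have sub: "D \<subseteq> topspace T" using D(1) by (rule closedin_subset)
  have ne: "?K \<noteq> {}"
  proof -
    obtain z where "z \<in> D" using D(2) by auto
    then have "z \<in> q ` C" using sub surj_q by blast
    then show ?thesis using \<open>z \<in> D\<close> by auto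
  qed
  have "continuous_on ?K (\<lambda>t. h (q t))"
    using continuous_comp_q[OF h] by (rule continuous_on_subset) auto
  from continuous_attains_sup[OF compact_preimage[OF D(1)] ne this]
  obtain t where t: "t \<in> ?K" "\<forall>s\<in>?K. h (q s) \<le> h (q t)" by blast
  have "h z' \<le> h (q t)" if "z' \<in> D" for z'
  proof -
    have "z' \<in> q ` C" using that sub surj_q by blast
    then obtain s where "s \<in> C" "z' = q s" by auto
    then show ?thesis using t(2) that by auto
  qed
  then show ?thesis using that[of "q t"] t(1) by auto
qed

lemma Hausdorff_space_t2: "Hausdorff_space (euclidean :: 'a::t2_space topology)"
  unfolding Hausdorff_space_def
proof (intro allI impI)
  fix x y :: 'a assume "x \<in> topspace euclidean \<and> y \<in> topspace euclidean \<and> x \<noteq> y"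
  then have "x \<noteq> y" by blast
  from hausdorff[OF this] show "\<exists>U V. openin euclidean U \<and> openin euclidean V \<and> x \<in> U \<and> y \<in> V \<and> disjnt U V"
    by (auto simp: disjnt_def)
qed

text \<open>For exceptional sequences \<open>H w\<close> need not be measurable, and its image
  measure is then meaningless; the integral over sequences ignores them, and at the others it sees
  only the first coordinate.\<close>

lemma (in random_map) stationary_measures_iff:
  assumes N: "sets N = sets (borel_top T)"
    and H: "AE w in W. \<forall>z\<in>topspace T. H w z = G (w 0) z"
  shows "\<mu> \<in> stationary_measures W N H \<longleftrightarrow> stat \<mu>"
proof -
  have "(\<integral>\<^sup>+w. emeasure (distr \<mu> N (H w)) B \<partial>W) = (\<integral>\<^sup>+t. emeasure \<mu> (G t -` B \<inter> topspace T) \<partial>p)"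
    if mu: "prob_space \<mu>" "sets \<mu> = sets N" and B: "B \<in> sets N" for B
  proof -
    interpret mu: prob_space \<mu> by fact
    have s: "sets \<mu> = sets (borel_top T)" using mu N by simp
    note [measurable_cong] = s N
    have sp: "space \<mu> = topspace T" using sets_eq_imp_space_eq[OF s] by simp
    have mG: "(\<lambda>x. G (fst x) (snd x)) \<in> p \<Otimes>\<^sub>M \<mu> \<rightarrow>\<^sub>M borel_top T"
      using G_joint by (simp cong: measurable_cong_sets)
    have "(\<lambda>t. emeasure \<mu> (Pair t -` ((\<lambda>x. G (fst x) (snd x)) -` B \<inter> space (p \<Otimes>\<^sub>M \<mu>)))) \<in> borel_measurable p"
      using B N by (intro mu.measurable_emeasure_Pair measurable_sets[OF mG]) auto
    then have m: "(\<lambda>t. emeasure \<mu> (G t -` B \<inter> topspace T)) \<in> borel_measurable p"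
      by (rule measurable_cong[THEN iffD1, rotated])
         (intro arg_cong[where f="emeasure \<mu>"], auto simp: space_pair_measure sp)
    have "AE w in W. emeasure (distr \<mu> N (H w)) B = emeasure \<mu> (G (w 0) -` B \<inter> topspace T)"
      using H AE_space
    proof eventually_elim
      case (elim w)
      have "G (w 0) \<in> \<mu> \<rightarrow>\<^sub>M N"
        using continuous_map_measurable_top[OF cont_G[OF W_comp[OF elim(2)]]] by simp
      then have "H w \<in> \<mu> \<rightarrow>\<^sub>M N"
        by (rule measurable_cong[THEN iffD1, rotated]) (use elim in \<open>auto simp: sp\<close>)
      then have "emeasure (distr \<mu> N (H w)) B = emeasure \<mu> (H w -` B \<inter> space \<mu>)"
        using B by (rule emeasure_distr)
      also have "H w -` B \<inter> space \<mu> = G (w 0) -` B \<inter> topspace T" using elim sp by auto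
      finally show ?case .
    qed
    then have "(\<integral>\<^sup>+w. emeasure (distr \<mu> N (H w)) B \<partial>W) = (\<integral>\<^sup>+w. emeasure \<mu> (G (w 0) -` B \<inter> topspace T) \<partial>W)"
      by (rule nn_integral_cong_AE)
    also have "\<dots> = (\<integral>\<^sup>+t. emeasure \<mu> (G t -` B \<inter> topspace T) \<partial>distr W p (\<lambda>w. w 0))"
      using m by (intro nn_integral_distr[symmetric]) auto
    also have "distr W p (\<lambda>w. w 0) = p"
      using distr_PiM_component[of UNIV "\<lambda>_. p" 0] prob_space_axioms by simp
    finally show ?thesis .
  qed
  then show ?thesis
    unfolding stationary_measures_def prob_measures_def stat_def mem_Collect_eq N[symmetric] by (metis (no_types, lifting))
qed

lemma sets_borel_top_of_set:
  fixes X :: "'a::topological_space set"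
  shows "sets (restrict_space borel X) = sets (borel_top (top_of_set X))"
proof -
  have "sets (restrict_space borel X) = sets (vimage_algebra X (\<lambda>x. x) (sigma UNIV {U :: 'a set. open U}))"
    unfolding borel_def[symmetric] by (intro restrict_space_eq_vimage_algebra) simp
  also have "\<dots> = sets (sigma X {(\<lambda>x. x) -` U \<inter> X |U. U \<in> {U. open U}})"
    by (subst vimage_algebra_sigma) auto
  also have "{(\<lambda>x. x) -` U \<inter> X |U. U \<in> {U. open U}} = {U. openin (top_of_set X) U}"
    by (auto simp: openin_open)
  finally show ?thesis by (simp add: borel_top_def)
qed

section \<open>The given random map as a random system\<close>

context compact_random_map
begin

text \<open>Since the map depends on the first coordinate alone, the constant sequence is a
  measurable representative of all sequences that start with \<open>t\<close>.\<close>

lemma const_seq_measurable: "(\<lambda>t _. t) \<in> p \<rightarrow>\<^sub>M iid_seq p"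
  unfolding iid_seq_def by (rule measurable_PiM_single') (auto simp: space_PiM)

lemma const_seq_space: "t \<in> space p \<Longrightarrow> (\<lambda>_. t) \<in> space (iid_seq p)"
  using measurable_space[OF const_seq_measurable] by simp

text \<open>Fubini splits off the first coordinate. Whether a sequence is good depends on this
  coordinate only, so almost every sequence being good means almost every coordinate being
  good.\<close>

lemma good_set:
  obtains G0 where "G0 \<in> sets p" "AE t in p. t \<in> G0"
    "\<And>t. t \<in> G0 \<Longrightarrow> C1_local_diffeo A (f (\<lambda>_. t)) \<and> f (\<lambda>_. t) ` X \<subseteq> X"
proof -
  interpret seq: sequence_space p by unfold_locales
  interpret PP: pair_prob_space p seq.S ..
  let ?good = "\<lambda>h. C1_local_diffeo A h \<and> h ` X \<subseteq> X"
  have "AE w in seq.S. ?good (f w)"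
    using f_local_diffeo f_invariant unfolding iid_seq_def by eventually_elim simp
  then have "AE w in distr (p \<Otimes>\<^sub>M seq.S) seq.S (\<lambda>(t, w). case_nat t w). ?good (f w)"
    unfolding seq.PiM_iter .
  then have "AE x in p \<Otimes>\<^sub>M seq.S. ?good (f ((\<lambda>(t, w). case_nat t w) x))"
    by (rule AE_distrD[rotated]) measurable
  then have "AE t in p. AE w in seq.S. ?good (f (case_nat t w))"
    using PP.AE_pair[of "\<lambda>x. ?good (f ((\<lambda>(t, w). case_nat t w) x))"] by simp
  then have "AE t in p. ?good (f (\<lambda>_. t))"
    using AE_space
  proof eventually_elim
    case (elim t)
    \<comment> \<open>One good continuation of \<open>t\<close> is enough, because every other
      continuation defines the same map.\<close>
    have "\<exists>w\<in>space seq.S. ?good (f (case_nat t w))"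
    proof (rule ccontr)
      assume no: "\<not> ?thesis"
      from elim(1) AE_space have "AE w in seq.S. False" by eventually_elim (use no in blast)
      then show False by simp
    qed
    then obtain w where w: "w \<in> space seq.S" "?good (f (case_nat t w))" by blast
    have "f (case_nat t w) = f (\<lambda>_. t)"
      using w(1) elim(2) const_seq_space[OF elim(2)]
      by (intro f_depends_on_0) (auto simp: iid_seq_def space_PiM PiE_iff split: nat.split)
    then show ?case using w(2) by simp
  qed
  then obtain N where N: "{t \<in> space p. \<not> ?good (f (\<lambda>_. t))} \<subseteq> N" "N \<in> null_sets p"
    unfolding eventually_ae_filter by auto
  show ?thesis
  proof (rule that[of "space p - N"])
    show "AE t in p. t \<in> space p - N" using AE_not_in[OF N(2)] AE_space by eventually_elim auto
    show "?good (f (\<lambda>_. t))" if "t \<in> space p - N" for t using that N(1) by blast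
  qed (use N(2) in auto)
qed

text \<open>For almost every sequence the given objects coincide with those of an everywhere regular
  random system. Stationarity, the exponent and \<open>phi\<close> are therefore the same for both,
  and the abstract bounds carry over.\<close>

lemma lyapunov_bounds:
  assumes li: "log_integrable A g p f X" and qi: "quasi_irreducible_measure A g p f X \<mu>0" and e: "e > 0"
  obtains u v where "continuous_on X u" "continuous_on X v"
    "\<And>\<mu>. \<mu> \<in> stationary p f X \<Longrightarrow>
       (\<integral>x. v x \<partial>\<mu>) \<le> top_lyapunov A g p f \<mu> \<and> top_lyapunov A g p f \<mu> \<le> (\<integral>x. u x \<partial>\<mu>)"
    "top_lyapunov A g p f \<mu>0 - e < (\<integral>x. v x \<partial>\<mu>0)" "(\<integral>x. u x \<partial>\<mu>0) < top_lyapunov A g p f \<mu>0 + e"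
proof -
  obtain G0 where G0: "G0 \<in> sets p" "AE t in p. t \<in> G0"
    "\<And>t. t \<in> G0 \<Longrightarrow> C1_local_diffeo A (f (\<lambda>_. t)) \<and> f (\<lambda>_. t) ` X \<subseteq> X"
    using good_set by blast
  let ?TY = "subtopology (proj_topology A) (proj_bundle A X)"
  let ?TX = "top_of_set X"
  let ?N = "restrict_space borel X"
  have topY: "topspace ?TY = proj_bundle A X" by (rule topspace_proj_sub)
  have fstX: "fst w \<in> X" if "w \<in> proj_bundle A X" for w using that by (auto simp: proj_bundle_def)
  have inY: "w \<in> proj_bundle A X" if "w \<in> proj_bundle A UNIV" "fst w \<in> X" for w
    using that unfolding proj_bundle_Int[of X] by simp
  have sub: "proj_bundle A X \<subseteq> proj_bundle A UNIV" by (auto simp: proj_bundle_def)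

  \<comment> \<open>On a null set the random map is replaced by the identity, so that its properties hold surely.\<close>
  define F where "F t = (if t \<in> G0 then f (\<lambda>_. t) else id)" for t
  have reg: "regular_map (F t)" for t
    using G0(3) regular_map_C1_local_diffeo regular_map_id by (auto simp: F_def)
  have dm: "diff_map (F t)" for t using reg by (simp add: regular_map_def)
  have inv: "F t ` X \<subseteq> X" for t using G0(3) by (auto simp: F_def)
  have mF: "(\<lambda>t. F t x) \<in> p \<rightarrow>\<^sub>M borel" for x
  proof -
    have "(\<lambda>t. ((\<lambda>_. t), x)) \<in> p \<rightarrow>\<^sub>M iid_seq p \<Otimes>\<^sub>M borel"
      by (intro measurable_Pair const_seq_measurable) simp
    from measurable_compose[OF this measurable_f] have [measurable]: "(\<lambda>t. f (\<lambda>_. t) x) \<in> p \<rightarrow>\<^sub>M borel" by simp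
    have [measurable]: "G0 \<in> sets p" by (rule G0(1))
    have "(\<lambda>t. if t \<in> G0 then f (\<lambda>_. t) x else x) \<in> p \<rightarrow>\<^sub>M borel" by measurable
    then show ?thesis by (rule measurable_cong[THEN iffD1, rotated]) (simp add: F_def)
  qed
  define G where "G t = proj_map A (F t)" for t

  obtain C q where C: "compact (C :: real set)" "continuous_map (top_of_set C) (proj_topology A) q" "q ` C = proj_bundle A X"
    using real_image_proj_bundle[OF compact_X] by (auto simp: real_image_def)
  interpret Yp: real_param ?TY C q
  proof
    show "Hausdorff_space ?TY" using Hausdorff_proj by (rule Hausdorff_space_subtopology)
    show "continuous_map (top_of_set C) ?TY q" using C by (auto simp: continuous_map_in_subtopology)
  qed (use C topY in auto)
  have cK: "continuous_map ?TY euclideanreal (log_growth (F t))" for t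
    using log_growth_cont[OF reg] by (rule continuous_map_from_subtopology)
  have mK: "(\<lambda>t. log_growth (F t) w) \<in> borel_measurable p" if "w \<in> proj_bundle A X" for w
    using log_growth_measurable[OF reg mF] sub that by blast
  interpret Y: random_map ?TY C q p G
  proof
    fix t
    show "continuous_map ?TY ?TY (G t)"
      unfolding continuous_map_in_subtopology G_def
      using continuous_map_from_subtopology[OF proj_map_cont[OF reg]] proj_map_bundle[OF reg inv] topY by auto
    show "(\<lambda>t. G t z) \<in> p \<rightarrow>\<^sub>M borel_top ?TY" if "z \<in> topspace ?TY" for z
      unfolding G_def using proj_map_measurable[OF reg mF inv] that topY by simp
  qed
  have W: "Y.W = iid_seq p" by (simp add: iid_seq_def)

  have mu0: "\<mu>0 \<in> stationary p f X" using qi by (simp add: quasi_irreducible_measure_def)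
  \<comment> \<open>The stationary measure itself shows that \<open>X\<close> is nonempty; the
    suprema below need points over which to be attained.\<close>
  have Xne: "X \<noteq> {}"
  proof
    assume "X = {}"
    then have "space \<mu>0 = {}" "prob_space \<mu>0"
      using mu0 sets_eq_imp_space_eq[of \<mu>0 ?N]
      by (auto simp: stationary_measures_def prob_measures_def space_restrict_space)
    then show False using prob_space.not_empty by blast
  qed
  have Cne: "C \<noteq> {}" using C(3) Xne fst_proj_bundle[of X] by auto

  define Mx where "Mx t = (SUP s\<in>C. log_growth (F t) (q s))" for t
  define Mn where "Mn t = (SUP s\<in>C. - log_growth (F t) (q s))" for t
  \<comment> \<open>\<open>L\<close> turns out to be the integrand of \<open>log_integrable\<close>.
    Defining it through suprema of the growth over parameters makes its measurability
    visible.\<close>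
  define L where "L t = max 0 (Mx t) + max 0 (Mn t)" for t
  have cKm: "continuous_map ?TY euclideanreal (\<lambda>w. - log_growth (F t) w)" for t
    using continuous_map_real_mult_left[OF cK, of "-1"] by simp
  have mL: "L \<in> borel_measurable p"
  proof -
    have [measurable]: "Mx \<in> borel_measurable p"
      unfolding Mx_def[abs_def] by (rule Yp.measurable_SUP) (use C(1) Cne mK cK topY in auto)
    have [measurable]: "Mn \<in> borel_measurable p"
      unfolding Mn_def[abs_def] by (rule Yp.measurable_SUP) (use C(1) Cne mK cKm topY in auto)
    show ?thesis unfolding L_def[abs_def] by measurable
  qed
  have Sup_max: "\<exists>w\<in>proj_bundle A X. (SUP s\<in>C. h (q s)) = h w \<and> (\<forall>w'\<in>proj_bundle A X. h w' \<le> h w)"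
    if hc: "continuous_map ?TY euclideanreal h" for h :: "('a, 'e) pvec \<Rightarrow> real"
  proof -
    have "closedin ?TY (proj_bundle A X)" "proj_bundle A X \<noteq> {}" using topY closedin_topspace[of ?TY] C(3) Cne by auto
    then obtain w where w: "w \<in> proj_bundle A X" "\<And>w'. w' \<in> proj_bundle A X \<Longrightarrow> h w' \<le> h w"
      using Yp.attains_max[OF hc] by metis
    have "(SUP s\<in>C. h (q s)) = h w"
    proof (rule cSup_eq_maximum)
      show "h w \<in> (\<lambda>s. h (q s)) ` C" using w(1) C(3) by (metis (no_types, lifting) image_iff)
    next
      fix y assume "y \<in> (\<lambda>s. h (q s)) ` C"
      then obtain s where "s \<in> C" "y = h (q s)" by auto
      then show "y \<le> h w" using w(2) C(3) by blast
    qed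
    then show ?thesis using w by blast
  qed
  have bound: "\<bar>log_growth (F t) w\<bar> \<le> L t" if "w \<in> proj_bundle A X" for t w
  proof -
    have "log_growth (F t) w \<le> Mx t" "- log_growth (F t) w \<le> Mn t"
      using Sup_max[OF cK] Sup_max[OF cKm] that unfolding Mx_def Mn_def by metis+
    then show ?thesis by (auto simp: L_def)
  qed
  have closed_fiber: "closedin ?TY {w \<in> topspace ?TY. fst w \<in> {x}}" if "x \<in> X" for x
    using fst_proj_sub_cont[of X] that
    by (intro closedin_continuous_map_preimage) (auto simp: closedin_Hausdorff_singleton Hausdorff_space_subtopology)
  have ne_fiber: "{w \<in> topspace ?TY. fst w \<in> {x}} \<noteq> {}" if "x \<in> X" for x
    using fst_proj_bundle[of X] that topY by (metis (no_types, lifting) empty_iff imageE mem_Collect_eq singletonI)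
  \<comment> \<open>The maximum over base points of the maxima over fibres is the maximum over the
    whole bundle, and the logarithm undoes the exponential. Applied to the growth and its negative,
    this identifies the norms of the derivative and of its inverse.\<close>
  have Sup_exp: "log_plus (SUP x\<in>X. N x) = max 0 (SUP s\<in>C. h (q s))"
    if h: "continuous_map ?TY euclideanreal h"
      and N: "\<And>x w. x \<in> X \<Longrightarrow> w \<in> proj_bundle A X \<Longrightarrow> fst w = x \<Longrightarrow>
        (\<And>w'. w' \<in> proj_bundle A X \<Longrightarrow> fst w' = x \<Longrightarrow> h w' \<le> h w) \<Longrightarrow> N x = exp (h w)"
    for h :: "('a, 'e) pvec \<Rightarrow> real" and N :: "'a \<Rightarrow> real"
  proof -
    have each: "\<exists>w\<in>proj_bundle A X. fst w = x \<and> N x = exp (h w) \<and>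
        (\<forall>w'\<in>proj_bundle A X. fst w' = x \<longrightarrow> h w' \<le> h w)" if x: "x \<in> X" for x
    proof -
      obtain w where w: "w \<in> proj_bundle A X" "fst w = x"
        "\<And>w'. w' \<in> proj_bundle A X \<Longrightarrow> fst w' = x \<Longrightarrow> h w' \<le> h w"
        using Yp.attains_max[OF h closed_fiber[OF x] ne_fiber[OF x]] topY
        by (metis (mono_tags, lifting) mem_Collect_eq singletonD singletonI)
      then show ?thesis using N[OF x w] by blast
    qed
    obtain w where w: "w \<in> proj_bundle A X" "(SUP s\<in>C. h (q s)) = h w"
      "\<And>w'. w' \<in> proj_bundle A X \<Longrightarrow> h w' \<le> h w"
      using Sup_max[OF h] by metis
    have "(SUP x\<in>X. N x) = exp (h w)"
    proof (rule cSup_eq_maximum)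
      obtain w' where w': "w' \<in> proj_bundle A X" "N (fst w) = exp (h w')" "h w \<le> h w'"
        using each[OF fstX[OF w(1)]] w(1) by blast
      then have "N (fst w) = exp (h w)" using w by (metis order_antisym)
      then show "exp (h w) \<in> N ` X" using fstX[OF w(1)] by (metis imageI)
    next
      fix y assume "y \<in> N ` X"
      then obtain x where "x \<in> X" "y = N x" by auto
      then show "y \<le> exp (h w)" using each[of x] w(3) by (metis exp_le_cancel_iff)
    qed
    then show ?thesis by (simp add: log_plus_def w(2))
  qed
  have dn: "log_plus (SUP x\<in>X. deriv_norm A g (F t) x) = max 0 (Mx t)" for t
    unfolding Mx_def
  proof (rule Sup_exp[OF cK], rule deriv_norm_eq)
    fix x w \<xi> assume \<xi>: "\<xi> \<in> tangent_space A x" "\<xi> \<noteq> (\<lambda>_. 0)"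
    show "tnorm g (F t x) (tangent_map A (F t) x \<xi>) = exp (log_growth (F t) (x, tangent_line \<xi>)) * tnorm g x \<xi>"
      using log_growth_eq[OF reg \<xi>] tnorm_pos[OF \<xi>] tnorm_pos[OF tangent_map_in[OF dm \<xi>(1)] tangent_map_nonzero[OF reg \<xi>]]
      by simp
  qed (use sub inY in auto)
  have idn: "log_plus (SUP x\<in>X. inv_deriv_norm A g (F t) x) = max 0 (Mn t)" for t
    unfolding Mn_def
  proof (rule Sup_exp[OF cKm], rule inv_deriv_norm_eq[OF reg])
    fix x w w' assume x: "x \<in> X" and w': "w' \<in> proj_bundle A UNIV" "fst w' = x"
      and max: "\<And>w'. w' \<in> proj_bundle A X \<Longrightarrow> fst w' = x \<Longrightarrow> - log_growth (F t) w' \<le> - log_growth (F t) w"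
    show "log_growth (F t) w \<le> log_growth (F t) w'"
      using max[of w'] w' inY[of w'] x by simp
  qed (use sub in auto)

  have aeG: "AE w in Y.W. \<forall>n. w n \<in> G0"
    unfolding AE_all_countable
    using AE_PiM_component[of UNIV "\<lambda>_. p"] prob_space_axioms G0(2) by auto
  \<comment> \<open>The shifted sequence starts with \<open>w n\<close>, so it may be replaced by
    the constant sequence that defines \<open>F (w n)\<close>.\<close>
  have fF: "f (\<lambda>i. w (i + n)) = F (w n)" if "w \<in> space Y.W" "w n \<in> G0" for w n
  proof -
    have "(\<lambda>i. w (i + n)) \<in> space (iid_seq p)"
      using measurable_space[OF Y.shift_measurable that(1)] by (simp add: W)
    then have "f (\<lambda>i. w (i + n)) = f (\<lambda>_. w n)"
      using const_seq_space[OF Y.W_comp[OF that(1)]] by (intro f_depends_on_0) auto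
    then show ?thesis using that(2) by (simp add: F_def)
  qed
  have aef: "AE w in Y.W. f w = F (w 0)"
    using aeG AE_space
  proof eventually_elim
    case (elim w)
    then show ?case using fF[of w 0] by simp
  qed
  have intL: "integrable p L"
  proof (rule integrableI_nonneg[OF mL])
    show "AE t in p. 0 \<le> L t" by (auto simp: L_def)
    have dp: "distr Y.W p (\<lambda>w. w 0) = p"
      using distr_PiM_component[of UNIV "\<lambda>_. p" 0] prob_space_axioms by simp
    have "(\<integral>\<^sup>+t. ennreal (L t) \<partial>p) = (\<integral>\<^sup>+t. ennreal (L t) \<partial>distr Y.W p (\<lambda>w. w 0))"
      unfolding dp ..
    also have "\<dots> = (\<integral>\<^sup>+w. ennreal (L (w 0)) \<partial>Y.W)"
      using mL by (intro nn_integral_distr) auto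
    also have "\<dots> = (\<integral>\<^sup>+w. ennreal (log_plus (SUP x\<in>X. deriv_norm A g (f w) x) +
        log_plus (SUP x\<in>X. inv_deriv_norm A g (f w) x)) \<partial>Y.W)"
    proof (rule nn_integral_cong_AE)
      show "AE w in Y.W. ennreal (L (w 0)) = ennreal (log_plus (SUP x\<in>X. deriv_norm A g (f w) x) +
        log_plus (SUP x\<in>X. inv_deriv_norm A g (f w) x))"
        using aef by eventually_elim (simp add: dn idn L_def)
    qed
    also have "\<dots> < \<infinity>" using li by (simp add: log_integrable_def W)
    finally show "(\<integral>\<^sup>+t. ennreal (L t) \<partial>p) < \<infinity>" .
  qed

  interpret RS: random_system ?TY C q p G ?TX fst F "\<lambda>t. log_growth (F t)" L
  proof
    show "fst (G t z) = F t (fst z)" for t z by (simp add: G_def proj_map_def case_prod_beta')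
    show "Hausdorff_space ?TX" by (rule Hausdorff_space_subtopology[OF Hausdorff_space_t2])
    show "continuous_map ?TY ?TX fst" by (rule fst_proj_sub_cont)
    show "open_map ?TY ?TX fst" by (rule fst_proj_sub_open)
    show "fst ` topspace ?TY = topspace ?TX" using fst_proj_bundle[of X] topY by simp
  qed (use cK mK bound intL topY in auto)

  have itF: "AE w in Y.W. \<forall>n. random_iter f n w = RS.X.it n w"
    using aeG AE_space
  proof eventually_elim
    case (elim w)
    have "random_iter f n w = RS.X.it n w" for n
    proof (induction n)
      case (Suc n)
      then show ?case using fF[of w n] elim by (auto simp: fun_eq_iff)
    qed (auto simp: fun_eq_iff)
    then show ?case by blast
  qed

  \<comment> \<open>The direction and the norm of the transported vector are followed together: the
    growth of the next step is evaluated at the direction reached so far, and the factors multiply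
    to the exponential of \<open>Phi\<close>.\<close>
  have it_props: "diff_map (RS.X.it n w) \<and> (\<forall>x\<in>X. \<forall>\<xi>\<in>tangent_space A x. \<xi> \<noteq> (\<lambda>_. 0) \<longrightarrow>
      tangent_map A (RS.X.it n w) x \<xi> \<noteq> (\<lambda>_. 0) \<and>
      Y.it n w (x, tangent_line \<xi>) = (RS.X.it n w x, tangent_line (tangent_map A (RS.X.it n w) x \<xi>)) \<and>
      tnorm g (RS.X.it n w x) (tangent_map A (RS.X.it n w) x \<xi>) = exp (RS.Phi n w (x, tangent_line \<xi>)) * tnorm g x \<xi>)"
    for n w
  proof (induction n)
    case 0
    have it0: "RS.X.it 0 w = id" by (auto simp: fun_eq_iff)
    show ?case unfolding it0 by (simp add: diff_map_id[unfolded id_def] tangent_map_id[unfolded id_def] RS.Phi_def id_def)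
  next
    case (Suc n)
    have eq: "RS.X.it (Suc n) w = F (w n) \<circ> RS.X.it n w" by (auto simp: fun_eq_iff)
    have d: "diff_map (RS.X.it n w)" using Suc by blast
    show ?case
    proof (intro conjI ballI impI)
      show "diff_map (RS.X.it (Suc n) w)" unfolding eq by (rule diff_map_comp[OF d dm])
      fix x \<xi> assume x: "x \<in> X" and \<xi>: "\<xi> \<in> tangent_space A x" "\<xi> \<noteq> (\<lambda>_. 0)"
      let ?y = "RS.X.it n w x" and ?\<eta> = "tangent_map A (RS.X.it n w) x \<xi>"
      have IH: "?\<eta> \<noteq> (\<lambda>_. 0)" "Y.it n w (x, tangent_line \<xi>) = (?y, tangent_line ?\<eta>)"
        "tnorm g ?y ?\<eta> = exp (RS.Phi n w (x, tangent_line \<xi>)) * tnorm g x \<xi>"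
        using Suc x \<xi> by blast+
      have \<eta>: "?\<eta> \<in> tangent_space A ?y" using tangent_map_in[OF d \<xi>(1)] .
      have T: "tangent_map A (RS.X.it (Suc n) w) x \<xi> = tangent_map A (F (w n)) ?y ?\<eta>"
        unfolding eq by (rule tangent_map_comp[OF d dm \<xi>(1)])
      show "tangent_map A (RS.X.it (Suc n) w) x \<xi> \<noteq> (\<lambda>_. 0)"
        unfolding T by (rule tangent_map_nonzero[OF reg \<eta> IH(1)])
      show "Y.it (Suc n) w (x, tangent_line \<xi>) = (RS.X.it (Suc n) w x, tangent_line (tangent_map A (RS.X.it (Suc n) w) x \<xi>))"
        unfolding T by (simp add: IH(2) G_def proj_map_eq[OF dm \<eta>])
      have "tnorm g (F (w n) ?y) (tangent_map A (F (w n)) ?y ?\<eta>) = exp (log_growth (F (w n)) (?y, tangent_line ?\<eta>)) * tnorm g ?y ?\<eta>"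
        using log_growth_eq[OF reg \<eta> IH(1)] tnorm_pos[OF \<eta> IH(1)]
          tnorm_pos[OF tangent_map_in[OF dm \<eta>] tangent_map_nonzero[OF reg \<eta> IH(1)]] by simp
      then show "tnorm g (RS.X.it (Suc n) w x) (tangent_map A (RS.X.it (Suc n) w) x \<xi>) =
          exp (RS.Phi (Suc n) w (x, tangent_line \<xi>)) * tnorm g x \<xi>"
        unfolding T by (simp add: IH(2,3) RS.Phi_def exp_add)
    qed
  qed
  have dn_it: "deriv_norm A g (RS.X.it n w) x = exp (RS.Psi n w x)" if w: "w \<in> space Y.W" and x: "x \<in> X" for n w x
  proof -
    have xT: "x \<in> topspace ?TX" using x by simp
    obtain w0 where w0: "w0 \<in> topspace ?TY" "fst w0 = x" "RS.Psi n w x = RS.Phi n w w0"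
      "\<And>z'. z' \<in> topspace ?TY \<Longrightarrow> fst z' = x \<Longrightarrow> RS.Phi n w z' \<le> RS.Phi n w w0"
      using RS.fmax_attained[OF RS.Phi_cont[OF w] xT] unfolding RS.Psi_def by metis
    show ?thesis
      unfolding w0(3)
    proof (rule deriv_norm_eq)
      show "tnorm g (RS.X.it n w x) (tangent_map A (RS.X.it n w) x \<xi>) =
          exp (RS.Phi n w (x, tangent_line \<xi>)) * tnorm g x \<xi>"
        if "\<xi> \<in> tangent_space A x" "\<xi> \<noteq> (\<lambda>_. 0)" for \<xi>
        using it_props[of n w] x that by blast
      show "w0 \<in> proj_bundle A UNIV" "fst w0 = x" using w0 sub topY by blast+
      show "RS.Phi n w w' \<le> RS.Phi n w w0" if "w' \<in> proj_bundle A UNIV" "fst w' = x" for w'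
        using w0(4)[of w'] inY[OF that(1)] that(2) x topY by blast
    qed
  qed
  have b_eq: "(\<integral>w. ln (deriv_norm A g (random_iter f n w) x) \<partial>completion (iid_seq p)) = RS.b n x" if x: "x \<in> X" for n x
    unfolding RS.b_def W[symmetric]
  proof (rule integral_completion_AE)
    show "AE w in Y.W. ln (deriv_norm A g (random_iter f n w) x) = RS.Psi n w x"
      using itF AE_space by eventually_elim (simp add: dn_it x)
    show "(\<lambda>w. RS.Psi n w x) \<in> borel_measurable Y.W" using x by (intro RS.Psi_measurable) simp
  qed
  have setsN: "sets ?N = sets (borel_top ?TX)" by (rule sets_borel_top_of_set)
  have stX: "\<mu> \<in> stationary p f X \<longleftrightarrow> RS.X.stat \<mu>" for \<mu>
    unfolding W[symmetric]
    by (rule RS.X.stationary_measures_iff[OF setsN]) (use aef in \<open>eventually_elim, simp\<close>)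
  have lam: "top_lyapunov A g p f \<mu> = RS.lam \<mu>" if "RS.X.stat \<mu>" for \<mu>
  proof -
    have "space \<mu> = X" using that sets_eq_imp_space_eq[of \<mu> "borel_top ?TX"] by (simp add: RS.X.stat_def)
    then have "(\<integral>x. (\<integral>w. ln (deriv_norm A g (random_iter f n w) x) \<partial>completion (iid_seq p)) \<partial>\<mu>) = (\<integral>x. RS.b n x \<partial>\<mu>)" for n
      by (intro Bochner_Integration.integral_cong) (auto simp: b_eq)
    then show ?thesis by (simp add: top_lyapunov_def RS.lam_def)
  qed
  have pb: "proj_borel A X = borel_top ?TY"
    unfolding proj_borel_def borel_top_def topY ..
  have stY: "\<nu> \<in> stationary_measures (iid_seq p) (proj_borel A X) (\<lambda>w. proj_map A (f w)) \<longleftrightarrow> Y.stat \<nu>" for \<nu>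
    unfolding W[symmetric] pb
    by (rule Y.stationary_measures_iff[OF refl]) (use aef in \<open>eventually_elim, simp add: G_def\<close>)
  have phi: "phi A g p f z = RS.phi z" if z: "z \<in> proj_bundle A X" for z
  proof -
    have "phi A g p f z = (\<integral>w. log_growth (f w) z \<partial>completion Y.W)"
      by (simp add: phi_def log_growth_def case_prod_beta' Let_def W)
    also have "\<dots> = (\<integral>w. log_growth (F (w 0)) z \<partial>Y.W)"
    proof (rule integral_completion_AE)
      show "AE w in Y.W. log_growth (f w) z = log_growth (F (w 0)) z" using aef by eventually_elim simp
      show "(\<lambda>w. log_growth (F (w 0)) z) \<in> borel_measurable Y.W"
        using measurable_compose[OF measurable_component_singleton[of 0 UNIV "\<lambda>_. p"] mK[OF z]] by simp
    qed
    also have "\<dots> = RS.phi z" unfolding RS.phi_def by (rule Y.integral_comp[OF mK[OF z]])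
    finally show ?thesis .
  qed
  have qi': "(\<integral>z. RS.phi z \<partial>\<nu>) = RS.lam \<mu>0" if \<nu>: "Y.stat \<nu>" "distr \<nu> (borel_top ?TX) fst = \<mu>0" for \<nu>
  proof -
    \<comment> \<open>The two targets are different measures with the same measurable sets, and the
      image measure depends only on the latter.\<close>
    have "distr \<nu> ?N fst = distr \<nu> (borel_top ?TX) fst" using setsN by (intro distr_cong) auto
    then have "\<nu> \<in> stationary_lifts A p f X \<mu>0" using \<nu> stY by (simp add: stationary_lifts_def)
    then have "(\<integral>z. phi A g p f z \<partial>\<nu>) = top_lyapunov A g p f \<mu>0"
      using qi by (simp add: quasi_irreducible_measure_def)
    moreover have "space \<nu> = proj_bundle A X"
      using \<nu>(1) sets_eq_imp_space_eq[of \<nu> "borel_top ?TY"] topY by (simp add: Y.stat_def)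
    then have "(\<integral>z. phi A g p f z \<partial>\<nu>) = (\<integral>z. RS.phi z \<partial>\<nu>)"
      by (intro Bochner_Integration.integral_cong) (auto simp: phi)
    ultimately show ?thesis using lam mu0 stX by simp
  qed
  have st0: "RS.X.stat \<mu>0" using mu0 stX by blast
  show ?thesis
  proof (rule RS.lam_bounds_at_quasi_irreducible[OF st0 e qi'])
    fix u v
    assume "continuous_map ?TX euclideanreal u" "continuous_map ?TX euclideanreal v"
      "\<And>\<mu>'. RS.X.stat \<mu>' \<Longrightarrow> (\<integral>x. v x \<partial>\<mu>') \<le> RS.lam \<mu>' \<and> RS.lam \<mu>' \<le> (\<integral>x. u x \<partial>\<mu>')"
      "RS.lam \<mu>0 - e < (\<integral>x. v x \<partial>\<mu>0)" "(\<integral>x. u x \<partial>\<mu>0) < RS.lam \<mu>0 + e"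
    then show thesis
      using that[of u v] lam stX st0 by simp
  qed
qed

section \<open>Continuity in the weak* topology\<close>

lemma topcontinuous_at_quasi_irreducible:
  assumes li: "log_integrable A g p f X" and qi: "quasi_irreducible_measure A g p f X \<mu>0"
  shows "topcontinuous_at (subtopology (weak_star_topology X) (stationary p f X))
           euclideanreal (top_lyapunov A g p f) \<mu>0"
proof -
  let ?P = "prob_measures (restrict_space borel X)"
  have base: "openin (weak_star_topology X) {\<mu> \<in> ?P. (\<integral>x. h x \<partial>\<mu>) \<in> V}"
    if "continuous_on X h" "open V" for h :: "'a \<Rightarrow> real" and V
    unfolding weak_star_topology_def using that by (intro topology_generated_by_Basis) blast
  have st: "stationary p f X \<subseteq> ?P" by (auto simp: stationary_measures_def)
  have "openin (weak_star_topology X) ?P"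
    using base[of "\<lambda>_. 0" UNIV] by simp
  then have top: "?P \<subseteq> topspace (weak_star_topology X)" by (rule openin_subset)
  have mu0: "\<mu>0 \<in> stationary p f X" using qi by (simp add: quasi_irreducible_measure_def)
  show ?thesis
    unfolding topcontinuous_at_def
  proof (intro conjI allI impI)
    show "\<mu>0 \<in> topspace (subtopology (weak_star_topology X) (stationary p f X))"
      using mu0 st top by auto
    fix V assume V: "openin euclideanreal V \<and> top_lyapunov A g p f \<mu>0 \<in> V"
    then obtain e where e: "e > 0" "\<And>y. \<bar>y - top_lyapunov A g p f \<mu>0\<bar> < e \<Longrightarrow> y \<in> V"
      by (auto simp: open_dist dist_real_def)
    obtain u v where uv: "continuous_on X u" "continuous_on X v"
      "\<And>\<mu>. \<mu> \<in> stationary p f X \<Longrightarrow>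
         (\<integral>x. v x \<partial>\<mu>) \<le> top_lyapunov A g p f \<mu> \<and> top_lyapunov A g p f \<mu> \<le> (\<integral>x. u x \<partial>\<mu>)"
      "top_lyapunov A g p f \<mu>0 - e < (\<integral>x. v x \<partial>\<mu>0)" "(\<integral>x. u x \<partial>\<mu>0) < top_lyapunov A g p f \<mu>0 + e"
      using lyapunov_bounds[OF li qi e(1)] by metis
    let ?l = "top_lyapunov A g p f \<mu>0"
    \<comment> \<open>One subbasic set caps the integral of \<open>u\<close>, the other bounds that
      of \<open>v\<close> from below. As these integrals enclose the exponent of every stationary
      measure, both sets together trap it within \<open>e\<close> of \<open>?l\<close>.\<close>
    let ?U = "({\<mu> \<in> ?P. (\<integral>x. u x \<partial>\<mu>) \<in> {..<?l + e}} \<inter> {\<mu> \<in> ?P. (\<integral>x. v x \<partial>\<mu>) \<in> {?l - e<..}}) \<inter> stationary p f X"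
    show "\<exists>U. openin (subtopology (weak_star_topology X) (stationary p f X)) U \<and> \<mu>0 \<in> U \<and>
        (\<forall>\<mu>\<in>U. top_lyapunov A g p f \<mu> \<in> V)"
    proof (intro exI[of _ ?U] conjI ballI)
      show "openin (subtopology (weak_star_topology X) (stationary p f X)) ?U"
        by (rule openin_subtopology_Int) (intro openin_Int base uv(1,2) open_lessThan open_greaterThan)
      show "\<mu>0 \<in> ?U" using mu0 st uv(4,5) by auto
      fix \<mu> assume "\<mu> \<in> ?U"
      then have "\<mu> \<in> stationary p f X" "(\<integral>x. u x \<partial>\<mu>) < ?l + e" "?l - e < (\<integral>x. v x \<partial>\<mu>)" by auto
      then show "top_lyapunov A g p f \<mu> \<in> V" using uv(3)[of \<mu>] by (intro e(2)) auto
    qed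
  qed auto
qed

end

theorem theorem4:
  fixes A :: "('a::{t2_space, second_countable_topology}, 'e::euclidean_space) chart set"
    and g :: "'a \<Rightarrow> ('a, 'e) tvec \<Rightarrow> ('a, 'e) tvec \<Rightarrow> real"
    and p :: "'t measure"
    and f :: "(nat \<Rightarrow> 't) \<Rightarrow> 'a \<Rightarrow> 'a"
    and X :: "'a set"
  assumes "compact_random_map A g p f X"
    and "log_integrable A g p f X"
  shows "(\<forall>\<mu>\<^sub>0 \<in> stationary p f X. quasi_irreducible_measure A g p f X \<mu>\<^sub>0 \<longrightarrow>
            topcontinuous_at (subtopology (weak_star_topology X) (stationary p f X))
              euclideanreal (top_lyapunov A g p f) \<mu>\<^sub>0) \<and>
         (quasi_irreducible A g p f X \<longrightarrow>
            continuous_map (subtopology (weak_star_topology X) (stationary p f X))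
              euclideanreal (top_lyapunov A g p f))"
proof -
  interpret compact_random_map A g p f X by fact
  note at = topcontinuous_at_quasi_irreducible[OF assms(2)]
  then show ?thesis
    unfolding continuous_map_eq_topcontinuous_at quasi_irreducible_def by auto
qed

end
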